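(* Let $M(t)$ be the $N\times N$ non-Hermitian matrix-valued Brownian motion started from a deterministic matrix $M(0)$. For $(z,w)\in\mathbb{C}\times\mathbb{C}^\times$ and $t\ge0$, with $\mathbb{C}^\times=\mathbb{C}\setminus\{0\}$, let $\Delta_w(M(t)-zI)$, $\Delta^2(z,w;t)$, $\Psi(z,w;t)$ be the random fields defined in the context. They satisfy the stochastic partial differential equations $$d\Delta_w(M(t)-zI)=d\mathcal{M}^{\Delta}(z,w;t)+\frac{1}{2N}\left\{\frac{\partial^2\Delta_w(M(t)-zI)}{\partial w\,\partial\overline w}+\frac{3}{\Delta_w(M(t)-zI)}\left|\frac{\partial\Delta_w(M(t)-zI)}{\partial w}\right|^2\right\}dt,$$ $$d\Delta^2(z,w;t)=d\mathcal{M}^{\Delta^2}(z,w;t)+\frac{1}{4N}\nabla_w^2\Delta^2(z,w;t)\,dt,$$ $$d\Psi(z,w;t)=d\mathcal{M}^{\Psi}(z,w;t)+2\left|\frac{\partial\Psi(z,w;t)}{\partial w}\right|^2dt,\qquad (z,w)\in\mathbb{C}\times\mathbb{C}^\times,\ t\ge0,$$ where $\mathcal{M}^{\Delta}$, $\mathcal{M}^{\Delta^2}$, $\mathcal{M}^{\Psi}$ are local martingales (in $t$) satisfying $$d\mathcal{M}^{\Delta}(z,w;t)=N\Delta_w(M(t)-zI)\,d\mathcal{M}^{\Psi}(z,w;t),\qquad d\mathcal{M}^{\Delta^2}(z,w;t)=2N\Delta^2(z,w;t)\,d\mathcal{M}^{\Psi}(z,w;t),$$ with $$d\mathcal{M}^{\Psi}(z,w;t)=\frac{1}{2N}\Big\{\mathrm{Tr}\big[\widehat{\mathsf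 h}^{-1}(z,w;M(t))(M^\dagger(t)-\overline zI)\,dM(t)\big]+\mathrm{Tr}\big[(M(t)-zI)\widehat{\mathsf h}^{-1}(z,w;M(t))\,dM^\dagger(t)\big]\Big\}.$$ The quadratic variation is $$\langle d\mathcal{M}^{\Psi}(z,w;\cdot),d\mathcal{M}^{\Psi}(z,w;\cdot)\rangle_t=\frac{1}{4N^2}\nabla_w^2\Psi(z,w;t)\,dt,\qquad (z,w)\in\mathbb{C}\times\mathbb{C}^\times,\ t\ge0.$$
   Context: Let $(B^{\rm R}_{jk}),(B^{\rm I}_{jk})$, $1\le j,k\le N$, be $2N^2$ independent one-dimensional standard Brownian motions on a filtered probability space. The non-Hermitian matrix-valued Brownian motion $M(t)=(M_{jk}(t))$ starts from the deterministic matrix $M(0)$ and has increments $dM_{jk}(t)=(dB^{\rm R}_{jk}(t)+i\,dB^{\rm I}_{jk}(t))/\sqrt{2N}$. $\dagger$ denotes Hermitian conjugate and $I$ the identity matrix. For $\mathsf m\in\mathbb{C}^{N\times N}$ put $\widehat{\mathsf h}(z,w;\mathsf m)=(\mathsf m^\dagger-\overline zI)(\mathsf m-zI)+|w|^2I$, a positive-definite Hermitian matrix for $w\ne0$. The random field associated with the regularized Fuglede--Kadison determinant, and its squared and logarithmic variations, are $$\Delta_w(M(t)-zI)=\sqrt{\det\widehat{\mathsf h}(z,w;M(t))},\quad \Delta^2(z,w;t)=\det\widehat{\mathsf h}(z,w;M(t)),\quad \Psi(z,w;t)=\frac{1}{2N}\log\det\widehat{\mathsf h}(z,w;M(t)).$$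 Derivatives in $w,\overline w$ are Wirtinger derivatives, and $\nabla_w^2=4\,\partial^2/\partial w\,\partial\overline w$ is the Laplacian in $w$. *)

theory Defs
  imports "HOL-Analysis.Analysis" "HOL-Probability.Probability"
begin

section \<open>Stochastic calculus\<close>

text \<open>
  Processes are functions of type \<open>real \<Rightarrow> 'a \<Rightarrow> 'b\<close> (time, sample point), used at times \<open>t \<ge> 0\<close>
  only.  The filtration is indexed by all reals so that the library locale \<^locale>\<open>filtration\<close>
  applies; a filtration indexed by \<open>[0,\<infinity>)\<close> is extended by \<open>F t = F 0\<close> for \<open>t < 0\<close>.  The usual
  conditions are not assumed.
\<close>

definition filtered_prob_space :: "'a measure \<Rightarrow> (real \<Rightarrow> 'a measure) \<Rightarrow> bool" where
  "filtered_prob_space P F \<longleftrightarrow>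
     prob_space P \<and> filtration (space P) F \<and> (\<forall>t. subalgebra P (F t))"

definition adapted_continuous ::
    "'a measure \<Rightarrow> (real \<Rightarrow> 'a measure) \<Rightarrow> (real \<Rightarrow> 'a \<Rightarrow> 'b::topological_space) \<Rightarrow> bool" where
  "adapted_continuous P F X \<longleftrightarrow>
     (\<forall>t\<ge>0. X t \<in> borel_measurable (F t)) \<and>
     (\<forall>\<omega>\<in>space P. continuous_on {0..} (\<lambda>t. X t \<omega>))"

definition standard_brownian_motion ::
    "'a measure \<Rightarrow> (real \<Rightarrow> 'a measure) \<Rightarrow> (real \<Rightarrow> 'a \<Rightarrow> real) \<Rightarrow> bool" where
  "standard_brownian_motion P F B \<longleftrightarrow>
     adapted_continuous P F B \<and>
     (AE \<omega> in P. B 0 \<omega> = 0) \<and>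
     (\<forall>s t. 0 \<le> s \<and> s < t \<longrightarrow>
        distributed P lborel (\<lambda>\<omega>. B t \<omega> - B s \<omega>) (normal_density 0 (sqrt (t - s))) \<and>
        prob_space.indep_set P (sets (F s))
          {(\<lambda>\<omega>. B t \<omega> - B s \<omega>) -` A \<inter> space P | A. A \<in> sets borel})"

definition independent_processes ::
    "'a measure \<Rightarrow> ('i \<Rightarrow> real \<Rightarrow> 'a \<Rightarrow> real) \<Rightarrow> bool" where
  "independent_processes P B \<longleftrightarrow>
     prob_space.indep_vars P (\<lambda>_. \<Pi>\<^sub>M t\<in>{0..}. borel) (\<lambda>i \<omega>. \<lambda>t\<in>{0..}. B i t \<omega>) UNIV"

definition martingale ::
    "'a measure \<Rightarrow> (real \<Rightarrow> 'a measure) \<Rightarrow> (real \<Rightarrow> 'a \<Rightarrow> real) \<Rightarrow> bool" where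
  "martingale P F X \<longleftrightarrow>
     (\<forall>t\<ge>0. X t \<in> borel_measurable (F t) \<and> integrable P (X t)) \<and>
     (\<forall>s t. 0 \<le> s \<and> s \<le> t \<longrightarrow> (AE \<omega> in P. real_cond_exp P (F s) (X t) \<omega> = X s \<omega>))"

text \<open>
  The localizing stopping times may be taken finite, since \<open>\<tau> n\<close> can be replaced by
  \<open>min (\<tau> n) n\<close>.
\<close>

definition continuous_local_martingale ::
    "'a measure \<Rightarrow> (real \<Rightarrow> 'a measure) \<Rightarrow> (real \<Rightarrow> 'a \<Rightarrow> real) \<Rightarrow> bool" where
  "continuous_local_martingale P F X \<longleftrightarrow>
     adapted_continuous P F X \<and>
     (\<exists>\<tau> :: nat \<Rightarrow> 'a \<Rightarrow> real.
        (\<forall>n. stopping_time F (\<tau> n) \<and> (\<forall>\<omega>\<in>space P. 0 \<le> \<tau> n \<omega>)) \<and>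
        (AE \<omega> in P. mono (\<lambda>n. \<tau> n \<omega>) \<and> filterlim (\<lambda>n. \<tau> n \<omega>) at_top sequentially) \<and>
        (\<forall>n. martingale P F (\<lambda>t \<omega>. X (min t (\<tau> n \<omega>)) \<omega> - X 0 \<omega>)))"

text \<open>\<open>A\<close> is the quadratic variation \<open>\<langle>X, X\<rangle>\<close> of the continuous local martingale \<open>X\<close>.\<close>

definition quadratic_variation ::
    "'a measure \<Rightarrow> (real \<Rightarrow> 'a measure) \<Rightarrow> (real \<Rightarrow> 'a \<Rightarrow> real) \<Rightarrow> (real \<Rightarrow> 'a \<Rightarrow> real) \<Rightarrow> bool" where
  "quadratic_variation P F X A \<longleftrightarrow>
     adapted_continuous P F A \<and>
     (\<forall>\<omega>\<in>space P. A 0 \<omega> = 0 \<and> mono_on {0..} (\<lambda>t. A t \<omega>)) \<and>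
     continuous_local_martingale P F (\<lambda>t \<omega>. (X t \<omega>)\<^sup>2 - A t \<omega>)"

text \<open>
  The data \<open>m, \<tau>, \<xi>\<close> encode the simple predictable process equal to \<open>\<xi> i\<close> on \<open>(\<tau> i, \<tau> (i+1)]\<close> for
  \<open>i < m\<close>, and to \<open>0\<close> after \<open>\<tau> m\<close>.  Its value at time \<open>0\<close> does not affect the integral and is ignored.
\<close>

definition simple_predictable ::
    "(real \<Rightarrow> 'a measure) \<Rightarrow> nat \<Rightarrow> (nat \<Rightarrow> real) \<Rightarrow> (nat \<Rightarrow> 'a \<Rightarrow> 'h::real_normed_vector) \<Rightarrow> bool" where
  "simple_predictable F m \<tau> \<xi> \<longleftrightarrow>
     \<tau> 0 = 0 \<and> (\<forall>i<m. \<tau> i \<le> \<tau> (Suc i) \<and> \<xi> i \<in> borel_measurable (F (\<tau> i)))"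

definition simple_value ::
    "nat \<Rightarrow> (nat \<Rightarrow> real) \<Rightarrow> (nat \<Rightarrow> 'a \<Rightarrow> 'h::real_normed_vector) \<Rightarrow> real \<Rightarrow> 'a \<Rightarrow> 'h" where
  "simple_value m \<tau> \<xi> t \<omega> = (\<Sum>i<m. indicator {\<tau> i<..\<tau> (Suc i)} t *\<^sub>R \<xi> i \<omega>)"

definition simple_integral ::
    "('h \<Rightarrow> 'x \<Rightarrow> 'y) \<Rightarrow> nat \<Rightarrow> (nat \<Rightarrow> real) \<Rightarrow> (nat \<Rightarrow> 'a \<Rightarrow> 'h) \<Rightarrow> (real \<Rightarrow> 'a \<Rightarrow> 'x::real_normed_vector)
      \<Rightarrow> real \<Rightarrow> 'a \<Rightarrow> 'y::real_normed_vector" where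
  "simple_integral b m \<tau> \<xi> X t \<omega> =
     (\<Sum>i<m. b (\<xi> i \<omega>) (X (min t (\<tau> (Suc i))) \<omega> - X (min t (\<tau> i)) \<omega>))"

text \<open>
  Uniform convergence on compact time intervals in probability.  Exceptional events are named
  explicitly so that no measurability of the suprema is presupposed.
\<close>

definition ucp_tendsto ::
    "'a measure \<Rightarrow> (nat \<Rightarrow> real \<Rightarrow> 'a \<Rightarrow> 'h::real_normed_vector) \<Rightarrow> (real \<Rightarrow> 'a \<Rightarrow> 'h) \<Rightarrow> bool" where
  "ucp_tendsto P Y Z \<longleftrightarrow>
     (\<forall>t>0. \<forall>\<epsilon>>0. \<forall>\<delta>>0. \<forall>\<^sub>F n in sequentially.
        \<exists>E\<in>sets P. measure P E < \<delta> \<and>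
          (\<forall>\<omega>\<in>space P - E. \<forall>s\<in>{0<..t}. norm (Y n s \<omega> - Z s \<omega>) < \<epsilon>))"

definition tendsto_in_prob ::
    "'a measure \<Rightarrow> (nat \<Rightarrow> 'a \<Rightarrow> 'y::real_normed_vector) \<Rightarrow> ('a \<Rightarrow> 'y) \<Rightarrow> bool" where
  "tendsto_in_prob P Y Z \<longleftrightarrow>
     (\<forall>\<epsilon>>0. (\<lambda>n. measure P {\<omega>\<in>space P. norm (Y n \<omega> - Z \<omega>) > \<epsilon>}) \<longlonglongrightarrow> 0)"

text \<open>
  \<open>I\<close> is the Ito integral \<open>I t = \<integral>\<^sub>0\<^sup>t b (H s) (dX s)\<close> of the adapted process \<open>H\<close> with left-continuous
  paths with respect to the continuous semimartingale \<open>X\<close>; the bilinear map \<open>b\<close> says how an integrand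
  multiplies an increment (for scalar processes \<open>b = (*)\<close>).  The integral is the continuous extension
  of the elementary integral of simple predictable processes.  As \<open>I\<close> has continuous paths, the
  limits in probability at fixed times determine it up to indistinguishability.
\<close>

definition ito_integral ::
    "'a measure \<Rightarrow> (real \<Rightarrow> 'a measure) \<Rightarrow> ('h::real_normed_vector \<Rightarrow> 'x::real_normed_vector \<Rightarrow> 'y::real_normed_vector)
      \<Rightarrow> (real \<Rightarrow> 'a \<Rightarrow> 'h) \<Rightarrow> (real \<Rightarrow> 'a \<Rightarrow> 'x) \<Rightarrow> (real \<Rightarrow> 'a \<Rightarrow> 'y) \<Rightarrow> bool" where
  "ito_integral P F b H X I \<longleftrightarrow>
     bounded_bilinear b \<and> adapted_continuous P F I \<and>
     (\<exists>m \<tau> \<xi>.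
        (\<forall>n. simple_predictable F (m n) (\<tau> n) (\<xi> n)) \<and>
        ucp_tendsto P (\<lambda>n. simple_value (m n) (\<tau> n) (\<xi> n)) H \<and>
        (\<forall>t\<ge>0. tendsto_in_prob P (\<lambda>n. simple_integral b (m n) (\<tau> n) (\<xi> n) X t) (I t)))"

text \<open>
  The equation \<open>dX = dL + a dt\<close> in integrated form.  The drift \<open>a\<close> is complex-valued because it is
  built from Wirtinger derivatives; the equation says in particular that its integral is real.
\<close>

definition solves_sde ::
    "'a measure \<Rightarrow> (real \<Rightarrow> 'a \<Rightarrow> real) \<Rightarrow> (real \<Rightarrow> 'a \<Rightarrow> real) \<Rightarrow> (real \<Rightarrow> 'a \<Rightarrow> complex) \<Rightarrow> bool" where
  "solves_sde P X L a \<longleftrightarrow>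
     (AE \<omega> in P. \<forall>t\<ge>0.
        ((\<lambda>s. a s \<omega>) has_integral
           complex_of_real ((X t \<omega> - X 0 \<omega>) - (L t \<omega> - L 0 \<omega>))) {0..t})"

section \<open>Wirtinger derivatives\<close>

definition wirtinger :: "(complex \<Rightarrow> complex) \<Rightarrow> complex \<Rightarrow> complex" where
  "wirtinger f w = (frechet_derivative f (at w) 1 - \<i> * frechet_derivative f (at w) \<i>) / 2"

definition wirtinger_bar :: "(complex \<Rightarrow> complex) \<Rightarrow> complex \<Rightarrow> complex" where
  "wirtinger_bar f w = (frechet_derivative f (at w) 1 + \<i> * frechet_derivative f (at w) \<i>) / 2"

definition laplacian :: "(complex \<Rightarrow> complex) \<Rightarrow> complex \<Rightarrow> complex" where
  "laplacian f w = 4 * wirtinger (wirtinger_bar f) w"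

section \<open>The matrix-valued Brownian motion and its random fields\<close>

definition dagger :: "complex^'n^'n \<Rightarrow> complex^'n^'n" where
  "dagger A = (\<chi> j k. cnj (A $ k $ j))"

definition matrix_bm ::
    "complex^'n^'n \<Rightarrow> ('n::finite \<Rightarrow> 'n \<Rightarrow> real \<Rightarrow> 'a \<Rightarrow> real) \<Rightarrow> ('n \<Rightarrow> 'n \<Rightarrow> real \<Rightarrow> 'a \<Rightarrow> real)
      \<Rightarrow> real \<Rightarrow> 'a \<Rightarrow> complex^'n^'n" where
  "matrix_bm M0 BR BI t \<omega> =
     (\<chi> j k. M0 $ j $ k +
        (complex_of_real (BR j k t \<omega>) + \<i> * complex_of_real (BI j k t \<omega>)) / sqrt (2 * CARD('n)))"

definition hhat :: "complex \<Rightarrow> complex \<Rightarrow> complex^'n^'n \<Rightarrow> complex^'n^'n" where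
  "hhat z w m = (dagger m - mat (cnj z)) ** (m - mat z) + mat (complex_of_real ((cmod w)\<^sup>2))"

text \<open>\<^const>\<open>Re\<close> only changes the type here: the determinant of a Hermitian matrix is real.\<close>

definition Delta2 :: "complex \<Rightarrow> complex \<Rightarrow> complex^'n^'n \<Rightarrow> real" where
  "Delta2 z w m = Re (det (hhat z w m))"

definition Delta :: "complex \<Rightarrow> complex \<Rightarrow> complex^'n^'n \<Rightarrow> real" where
  "Delta z w m = sqrt (Delta2 z w m)"

definition Psi :: "complex \<Rightarrow> complex \<Rightarrow> complex^'n^'n \<Rightarrow> real" where
  "Psi z w m = ln (Delta2 z w m) / (2 * CARD('n))"

lemma dagger_hhat: "dagger (hhat z w m) = hhat z w m"
  by (auto simp: dagger_def hhat_def vec_eq_iff matrix_matrix_mult_def mat_def intro!: sum.cong)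

lemma det_dagger: "det (dagger A) = cnj (det A)"
proof -
  have "dagger A = transpose (\<chi> j k. cnj (A $ j $ k))"
    by (simp add: dagger_def transpose_def)
  then have "det (dagger A) = det (\<chi> j k. cnj (A $ j $ k))"
    by (simp add: det_transpose)
  also have "\<dots> = cnj (det A)"
    by (simp add: det_def)
  finally show ?thesis .
qed

lemma complex_of_real_Delta2: "complex_of_real (Delta2 z w m) = det (hhat z w m)"
  by (metis Delta2_def Reals_cnj_iff det_dagger dagger_hhat of_real_Re)

end

theory Submission
  imports Defs
begin

text \<open>
  Write \<open>W = M(t)\<close> for the matrix process, seen as a process in the real Euclidean space of dimension
  \<open>2 N\<^sup>2\<close>; each of its coordinates is a Brownian motion with variance \<open>t / (2 N)\<close>.  The three fields are
  functions \<open>f(M(t))\<close> of the current position, so that Ito's formula says that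
  \<open>Z\<^sup>f(t) = f(W(t)) - f(W(0)) - \<integral>\<^sub>0\<^sup>t (1 / (4 N)) (laplace f)(W(s)) ds\<close> is a local martingale with
  differential \<open>\<nabla>f(W) \<cdot> dW\<close> and quadratic variation \<open>\<integral> (1 / (2 N)) |\<nabla>f(W)|\<^sup>2 ds\<close>.  The proof has a
  probabilistic half, which establishes this for a suitable class of \<open>f\<close>, and an algebraic half, which
  computes Laplacians and gradients of the three fields and matches them with their derivatives in \<open>w\<close>.

  The probabilistic half rests on one fact about the fields: for fixed \<open>w \<noteq> 0\<close> the determinant of
  \<open>A\<^sup>* A + |w|\<^sup>2\<close> is bounded below by a positive constant, uniformly in \<open>A\<close>
  (\<open>gramdet_lower_bound\<close>).  Hence \<open>\<Delta>\<^sup>2\<close>, \<open>\<Delta>\<close> and \<open>\<Psi>\<close> are smooth with all derivatives of polynomial growth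
  (\<open>tame\<close>), all random variables in sight have moments of every order, and the local martingales are
  true martingales, so that deterministic localizing times suffice.  Moreover \<open>Z\<^sup>f\<close> is defined path by path
  as the left side of Ito's formula, which makes it continuous and adapted without completing the filtration.

  The martingale property is obtained by sewing.  A third-order Taylor expansion gives, for \<open>s < t\<close>,
  \<open>Z\<^sup>f(t) - Z\<^sup>f(s) = \<nabla>f(W(s)) \<cdot> \<delta>W + (centred quadratic form in \<delta>W) + R\<close> with \<open>\<delta>W = W(t) - W(s)\<close> and all
  moments of \<open>R\<close> of the order of \<open>(t - s)\<^sup>3\<^sup>/\<^sup>2\<close>.  The first two terms are orthogonal to every random variable \<open>Y\<close>
  known at time \<open>s\<close>, so \<open>E[Y (Z\<^sup>f(t) - Z\<^sup>f(s))]\<close> is of order \<open>(t - s)\<^sup>3\<^sup>/\<^sup>2\<close>, and summing over a fine partition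
  shows that it vanishes (\<open>mean_zero_incrementsI\<close>).  The same argument, applied to \<open>(Z\<^sup>f)\<^sup>2\<close> minus its candidate
  bracket, gives the quadratic variation.  For the stochastic integrals, the error that one cell of a
  partition contributes is a martingale difference of order \<open>t - s\<close>; by orthogonality the variance of the total
  error tends to \<open>0\<close> with the mesh (\<open>ito_integralI\<close>).  The bookkeeping of orders is done by \<open>moment_order\<close>.

  One point needs care: the coordinates are assumed to be independent of each other as processes, and each
  one to be a Brownian motion for the filtration, but joint independence of the increments from the past is
  not assumed.  Only conditional covariances enter, and these vanish because the covariation of two
  independent Brownian motions is zero, and covariation is computed from the paths, whatever the filtration
  (\<open>dW_conditional_covariance_zero\<close>).

  For the algebraic half put \<open>A = m - z\<close>, \<open>r = |w|\<^sup>2\<close>, \<open>p = det (A\<^sup>* A + r)\<close>, \<open>G = (A\<^sup>* A + r)\<^sup>-\<^sup>1\<close>, and let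
  \<open>T\<^sub>1\<close>, \<open>T\<^sub>2\<close> be the traces of \<open>G\<close> and \<open>G\<^sup>2\<close>.  Jacobi's formula gives \<open>laplace p = 4 p (T\<^sub>1 - r T\<^sub>2 + r T\<^sub>1\<^sup>2)\<close> and
  \<open>|\<nabla>p|\<^sup>2 = 4 p\<^sup>2 (T\<^sub>1 - r T\<^sub>2)\<close> in the variable \<open>m\<close>, while \<open>dp/dr = p T\<^sub>1\<close> and \<open>dT\<^sub>1/dr = - T\<^sub>2\<close>.  Since the fields
  depend on \<open>w\<close> only through \<open>r\<close>, both sides of each equation become the same expression in \<open>p\<close>, \<open>T\<^sub>1\<close>,
  \<open>T\<^sub>2\<close> and \<open>r\<close>.
\<close>

section \<open>Smooth functions of polynomial growth\<close>

definition poly_growth :: "('v::real_normed_vector \<Rightarrow> real) \<Rightarrow> bool" where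
  "poly_growth f \<longleftrightarrow> (\<exists>C p. \<forall>x. \<bar>f x\<bar> \<le> C * (1 + norm x) ^ p)"

lemma poly_growthE:
  assumes "poly_growth f"
  obtains C p where "C \<ge> 0" "\<And>x. \<bar>f x\<bar> \<le> C * (1 + norm x) ^ p"
proof -
  obtain C p where Cp: "\<And>x. \<bar>f x\<bar> \<le> C * (1 + norm x) ^ p"
    using assms unfolding poly_growth_def by blast
  have "0 \<le> C" using Cp[of 0] abs_ge_zero[of "f 0"] by simp
  then show thesis using Cp that by blast
qed

lemma poly_growth_dominated:
  assumes "poly_growth g" "\<And>x. \<bar>f x\<bar> \<le> \<bar>g x\<bar>"
  shows "poly_growth f"
  using assms unfolding poly_growth_def by (meson order_trans)

lemma poly_growth_const: "poly_growth (\<lambda>x. c)"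
  unfolding poly_growth_def by (intro exI[of _ "\<bar>c\<bar>"] exI[of _ 0]) simp

lemma poly_growth_inner: "poly_growth (\<lambda>x::'v::real_inner. x \<bullet> b)"
  unfolding poly_growth_def
proof (intro exI[of _ "norm b"] exI[of _ 1] allI)
  fix x :: 'v
  have "\<bar>x \<bullet> b\<bar> \<le> norm x * norm b" by (rule Cauchy_Schwarz_ineq2)
  then show "\<bar>x \<bullet> b\<bar> \<le> norm b * (1 + norm x) ^ 1" by (simp add: algebra_simps add_increasing)
qed

lemma poly_growth_add:
  assumes "poly_growth f" "poly_growth g"
  shows "poly_growth (\<lambda>x. f x + g x)"
proof -
  obtain C p where C: "C \<ge> 0" "\<And>x. \<bar>f x\<bar> \<le> C * (1 + norm x) ^ p" by (rule poly_growthE[OF assms(1)]) blast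
  obtain D q where D: "D \<ge> 0" "\<And>x. \<bar>g x\<bar> \<le> D * (1 + norm x) ^ q" by (rule poly_growthE[OF assms(2)]) blast
  show ?thesis unfolding poly_growth_def
  proof (intro exI[of _ "C + D"] exI[of _ "p + q"] allI)
    fix x :: 'a
    have "C * (1 + norm x) ^ p \<le> C * (1 + norm x) ^ (p + q)"
         "D * (1 + norm x) ^ q \<le> D * (1 + norm x) ^ (p + q)"
      by (intro mult_left_mono power_increasing C D; simp)+
    then show "\<bar>f x + g x\<bar> \<le> (C + D) * (1 + norm x) ^ (p + q)"
      using C(2)[of x] D(2)[of x] by (simp add: algebra_simps)
  qed
qed

lemma poly_growth_mult:
  assumes "poly_growth f" "poly_growth g"
  shows "poly_growth (\<lambda>x. f x * g x)"
proof -
  obtain C p where C: "C \<ge> 0" "\<And>x. \<bar>f x\<bar> \<le> C * (1 + norm x) ^ p" by (rule poly_growthE[OF assms(1)]) blast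
  obtain D q where D: "D \<ge> 0" "\<And>x. \<bar>g x\<bar> \<le> D * (1 + norm x) ^ q" by (rule poly_growthE[OF assms(2)]) blast
  show ?thesis unfolding poly_growth_def
  proof (intro exI[of _ "C * D"] exI[of _ "p + q"] allI)
    fix x :: 'a
    have "\<bar>f x\<bar> * \<bar>g x\<bar> \<le> (C * (1 + norm x) ^ p) * (D * (1 + norm x) ^ q)"
      by (intro mult_mono C D) (auto intro!: mult_nonneg_nonneg C)
    then show "\<bar>f x * g x\<bar> \<le> (C * D) * (1 + norm x) ^ (p + q)"
      by (simp add: abs_mult power_add algebra_simps)
  qed
qed

text \<open>
  The derivative of \<open>f\<close> in the direction \<open>b\<close>; for \<open>b\<close> in the standard basis this is a partial derivative.
\<close>

definition pd :: "'v \<Rightarrow> ('v::real_normed_vector \<Rightarrow> real) \<Rightarrow> 'v \<Rightarrow> real" where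
  "pd b f x = frechet_derivative f (at x) b"

lemma pd_eq: "(f has_derivative f') (at x) \<Longrightarrow> pd b f x = f' b"
  unfolding pd_def using frechet_derivative_at by metis

text \<open>
  Differentiability is required everywhere and the partial derivatives are again in the class, so that all
  derivatives up to order \<open>k\<close> are continuous and of polynomial growth.  The recursion turns closure
  properties into inductions on \<open>k\<close>.
\<close>

primrec tame :: "nat \<Rightarrow> ('v::euclidean_space \<Rightarrow> real) \<Rightarrow> bool" where
  "tame 0 f \<longleftrightarrow> poly_growth f \<and> continuous_on UNIV f"
| "tame (Suc k) f \<longleftrightarrow> poly_growth f \<and> (\<forall>x. f differentiable at x) \<and> (\<forall>b\<in>Basis. tame k (pd b f))"

lemma tame_poly_growth: "tame k f \<Longrightarrow> poly_growth f"
  by (cases k) auto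

lemma tame_continuous: "tame k f \<Longrightarrow> continuous_on UNIV f"
  by (cases k) (auto intro!: continuous_at_imp_continuous_on differentiable_imp_continuous_within)

lemma tame_SucD: "tame (Suc k) f \<Longrightarrow> tame k f"
proof (induction k arbitrary: f)
  case 0
  then show ?case using tame_continuous tame_poly_growth by fastforce
next
  case (Suc k)
  then show ?case by (auto simp: tame.simps(2))
qed

lemma tame_mono: "tame k f \<Longrightarrow> j \<le> k \<Longrightarrow> tame j f"
  by (induction k) (use tame_SucD in \<open>auto simp: le_Suc_eq simp del: tame.simps\<close>)

lemma tame_SucI:
  assumes "\<And>x. (f has_derivative f' x) (at x)" "poly_growth f"
    "\<And>b. b \<in> Basis \<Longrightarrow> tame k (\<lambda>x. f' x b)"
  shows "tame (Suc k) f"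
proof -
  have "pd b f = (\<lambda>x. f' x b)" for b
    using pd_eq[OF assms(1)] by blast
  then show ?thesis using assms by (auto simp: differentiable_def)
qed

lemma tame_has_derivative:
  "tame (Suc k) f \<Longrightarrow> (f has_derivative (\<lambda>h. pd h f x)) (at x)"
  by (simp add: pd_def[abs_def] frechet_derivative_works)

lemma tame_pd: "tame (Suc k) f \<Longrightarrow> b \<in> Basis \<Longrightarrow> tame k (pd b f)"
  by simp

lemma tame_const: "tame k (\<lambda>x. c)"
proof (induction k arbitrary: c)
  case (Suc k)
  show ?case by (rule tame_SucI[where f' = "\<lambda>x h. 0"]) (auto simp: poly_growth_const intro!: Suc)
qed (auto simp: poly_growth_const)

lemma tame_inner: "tame k (\<lambda>x. x \<bullet> b)"
proof (cases k)
  case (Suc k)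
  show ?thesis unfolding Suc
    by (rule tame_SucI[where f' = "\<lambda>x h. h \<bullet> b"])
       (auto simp: poly_growth_inner tame_const intro!: derivative_eq_intros)
qed (auto simp: poly_growth_inner intro!: continuous_intros)

lemma tame_add: "tame k f \<Longrightarrow> tame k g \<Longrightarrow> tame k (\<lambda>x. f x + g x)"
proof (induction k arbitrary: f g)
  case (Suc k)
  show ?case
  proof (rule tame_SucI[where f' = "\<lambda>x h. pd h f x + pd h g x"])
    show "((\<lambda>x. f x + g x) has_derivative (\<lambda>h. pd h f x + pd h g x)) (at x)" for x
      by (intro has_derivative_add tame_has_derivative[OF Suc.prems(1)] tame_has_derivative[OF Suc.prems(2)])
    show "poly_growth (\<lambda>x. f x + g x)"
      by (intro poly_growth_add tame_poly_growth[OF Suc.prems(1)] tame_poly_growth[OF Suc.prems(2)])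
    show "tame k (\<lambda>x. pd b f x + pd b g x)" if "b \<in> Basis" for b
      by (intro Suc.IH tame_pd Suc.prems that)
  qed
qed (auto intro!: poly_growth_add continuous_on_add)

lemma tame_mult: "tame k f \<Longrightarrow> tame k g \<Longrightarrow> tame k (\<lambda>x. f x * g x)"
proof (induction k arbitrary: f g)
  case (Suc k)
  show ?case
  proof (rule tame_SucI[where f' = "\<lambda>x h. f x * pd h g x + pd h f x * g x"])
    show "((\<lambda>x. f x * g x) has_derivative (\<lambda>h. f x * pd h g x + pd h f x * g x)) (at x)" for x
      by (intro has_derivative_mult tame_has_derivative[OF Suc.prems(1)] tame_has_derivative[OF Suc.prems(2)])
    show "poly_growth (\<lambda>x. f x * g x)"
      by (intro poly_growth_mult tame_poly_growth[OF Suc.prems(1)] tame_poly_growth[OF Suc.prems(2)])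
    show "tame k (\<lambda>x. f x * pd b g x + pd b f x * g x)" if "b \<in> Basis" for b
      by (intro tame_add Suc.IH tame_SucD[OF Suc.prems(1)] tame_SucD[OF Suc.prems(2)] tame_pd Suc.prems that)
  qed
qed (auto intro!: poly_growth_mult continuous_on_mult)

lemma tame_cmult: "tame k f \<Longrightarrow> tame k (\<lambda>x. c * f x)"
  by (intro tame_mult tame_const)

lemma tame_diff: "tame k f \<Longrightarrow> tame k g \<Longrightarrow> tame k (\<lambda>x. f x - g x)"
  using tame_add[OF _ tame_cmult[of k g "-1"], of f] by simp

lemma tame_sum: "(\<And>i. i \<in> I \<Longrightarrow> tame k (f i)) \<Longrightarrow> tame k (\<lambda>x. \<Sum>i\<in>I. f i x)"
  by (induction I rule: infinite_finite_induct) (auto simp: tame_const tame_add)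

lemma poly_growth_inverse:
  assumes "c > 0" "\<And>x. f x \<ge> c"
  shows "poly_growth (\<lambda>x. inverse (f x))"
proof (rule poly_growth_dominated[OF poly_growth_const[of "inverse c"]])
  fix x show "\<bar>inverse (f x)\<bar> \<le> \<bar>inverse c\<bar>"
    using assms(1) assms(2)[of x] by (simp add: le_imp_inverse_le)
qed

text \<open>
  Induction on \<open>k\<close> works because the derivative \<open>- f' / f\<^sup>2\<close> is built from \<open>1 / f\<close> itself and
  from \<open>f'\<close>.  The positive lower bound supplies the growth estimate.
\<close>

lemma tame_inverse:
  assumes "tame k f" "c > 0" "\<And>x. f x \<ge> c"
  shows "tame k (\<lambda>x. inverse (f x))"
  using assms(1)
proof (induction k)
  case 0
  have "f x \<noteq> 0" for x using assms(2) assms(3)[of x] by linarith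
  then show ?case using 0
    by (auto intro!: poly_growth_inverse[OF assms(2,3)] continuous_on_inverse)
next
  case (Suc k)
  have nz: "f x \<noteq> 0" for x using assms(2) assms(3)[of x] by linarith
  show ?case
  proof (rule tame_SucI[where f' = "\<lambda>x h. -1 * (inverse (f x) * pd h f x * inverse (f x))"])
    show "((\<lambda>x. inverse (f x)) has_derivative (\<lambda>h. -1 * (inverse (f x) * pd h f x * inverse (f x)))) (at x)" for x
      using Deriv.has_derivative_inverse[OF nz tame_has_derivative[OF Suc.prems]] by simp
    show "tame k (\<lambda>x. -1 * (inverse (f x) * pd b f x * inverse (f x)))" if "b \<in> Basis" for b
      by (intro tame_cmult tame_mult Suc.IH tame_SucD[OF Suc.prems] tame_pd[OF Suc.prems] that)
  qed (rule poly_growth_inverse[OF assms(2,3)])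
qed

text \<open>
  The derivative \<open>f' / f\<close> is a product of functions already known to be tame, and \<open>ln\<close> itself grows more slowly than the
  identity.
\<close>

lemma tame_ln:
  assumes "tame k f" "c > 0" "\<And>x. f x \<ge> c"
  shows "tame k (\<lambda>x. ln (f x))"
proof -
  have pos: "f x > 0" for x using assms(2) assms(3)[of x] by linarith
  have growth: "poly_growth (\<lambda>x. ln (f x))"
  proof (rule poly_growth_dominated[OF poly_growth_add[OF tame_poly_growth[OF assms(1)] poly_growth_const[of "\<bar>ln c\<bar>"]]])
    fix x
    have "ln (f x) \<le> f x" using ln_less_self[OF pos[of x]] by simp
    moreover have "ln (f x) \<ge> ln c" using assms(2) assms(3)[of x] pos[of x] by simp
    ultimately show "\<bar>ln (f x)\<bar> \<le> \<bar>f x + \<bar>ln c\<bar>\<bar>" using pos[of x] by linarith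
  qed
  show ?thesis
  proof (cases k)
    case 0
    have "f x \<noteq> 0" for x using pos[of x] by simp
    then show ?thesis using 0 growth assms(1) by (auto intro!: continuous_on_ln pos)
  next
    case (Suc j)
    show ?thesis unfolding Suc
    proof (rule tame_SucI[where f' = "\<lambda>x h. pd h f x * inverse (f x)"])
      show "((\<lambda>x. ln (f x)) has_derivative (\<lambda>h. pd h f x * inverse (f x))) (at x)" for x
        using has_derivative_ln[OF pos[of x] tame_has_derivative[OF assms(1)[unfolded Suc]]] by (simp add: mult.commute)
      show "tame j (\<lambda>x. pd b f x * inverse (f x))" if "b \<in> Basis" for b
        using assms(1) Suc that
        by (intro tame_mult tame_inverse[OF tame_SucD assms(2,3)]) auto
    qed (rule growth)
  qed
qed

text \<open>
  The derivative is written as \<open>f' \<surd>f f\<^sup>-\<^sup>1 / 2\<close> instead of \<open>f' / (2 \<surd>f)\<close>, so that the induction hypothesis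
  applies to the factor \<open>\<surd>f\<close>.
\<close>

lemma tame_sqrt:
  assumes "tame k f" "c > 0" "\<And>x. f x \<ge> c"
  shows "tame k (\<lambda>x. sqrt (f x))"
  using assms(1)
proof (induction k)
  have pos: "f x > 0" for x using assms(2) assms(3)[of x] by linarith
  have growth: "poly_growth (\<lambda>x. sqrt (f x))"
  proof (rule poly_growth_dominated[OF poly_growth_add[OF tame_poly_growth[OF assms(1)] poly_growth_const[of 1]]])
    fix x
    have "sqrt (f x) \<le> sqrt ((f x + 1)^2)"
      using pos[of x] by (intro real_sqrt_le_mono) (simp add: power2_eq_square algebra_simps)
    then show "\<bar>sqrt (f x)\<bar> \<le> \<bar>f x + 1\<bar>" using pos[of x] by simp
  qed
  {
    case 0
    then show ?case using growth by (auto intro!: continuous_on_real_sqrt)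
  next
    case (Suc k)
    show ?case
    proof (rule tame_SucI[where f' = "\<lambda>x h. pd h f x * (1/2 * (sqrt (f x) * inverse (f x)))"])
      fix x
      have "sqrt (f x) * inverse (f x) = inverse (sqrt (f x))"
      proof -
        define s where "s = sqrt (f x)"
        have "f x = s * s" "s \<noteq> 0" using pos[of x] by (auto simp: s_def)
        then show ?thesis unfolding s_def[symmetric] by simp
      qed
      then have "(\<lambda>h. pd h f x * (1/2 * (sqrt (f x) * inverse (f x)))) = (\<lambda>h. pd h f x * (inverse (sqrt (f x)) / 2))"
        by (intro ext) simp
      then show "((\<lambda>x. sqrt (f x)) has_derivative (\<lambda>h. pd h f x * (1/2 * (sqrt (f x) * inverse (f x))))) (at x)"
        by (simp only: has_derivative_real_sqrt[OF pos[of x] tame_has_derivative[OF Suc.prems]])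
    next
      show "tame k (\<lambda>x. pd b f x * (1/2 * (sqrt (f x) * inverse (f x))))" if "b \<in> Basis" for b
        by (intro tame_cmult tame_mult Suc.IH tame_inverse[OF tame_SucD[OF Suc.prems] assms(2,3)]
            tame_SucD[OF Suc.prems] tame_pd[OF Suc.prems] that)
    qed (rule growth)
  }
qed

definition laplace :: "('v::euclidean_space \<Rightarrow> real) \<Rightarrow> 'v \<Rightarrow> real" where
  "laplace f x = (\<Sum>b\<in>Basis. pd b (pd b f) x)"

lemma tame_laplace: "tame (Suc (Suc k)) f \<Longrightarrow> tame k (laplace f)"
  unfolding laplace_def[abs_def] by (intro tame_sum) (auto simp: tame.simps)

definition ddir :: "'v \<Rightarrow> ('v::euclidean_space \<Rightarrow> real) \<Rightarrow> 'v \<Rightarrow> real" where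
  "ddir h f x = (\<Sum>b\<in>Basis. (h \<bullet> b) * pd b f x)"

lemma tame_pd_eq_ddir:
  assumes "tame (Suc k) f" shows "pd h f x = ddir h f x"
proof -
  have l: "linear (\<lambda>h. pd h f x)" using tame_has_derivative[OF assms] has_derivative_linear by blast
  have "pd h f x = pd (\<Sum>b\<in>Basis. (h \<bullet> b) *\<^sub>R b) f x" by (simp add: euclidean_representation)
  also have "\<dots> = ddir h f x"
    unfolding ddir_def using linear_sum[OF l, of "\<lambda>b. (h \<bullet> b) *\<^sub>R b" Basis]
    by (simp add: linear_cmul[OF l])
  finally show ?thesis .
qed

lemma tame_ddir: "tame (Suc k) f \<Longrightarrow> tame k (ddir h f)"
  unfolding ddir_def[abs_def] by (intro tame_sum tame_cmult) (auto simp: tame.simps)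

lemma tame_line_deriv:
  assumes "tame (Suc k) f"
  shows "((\<lambda>t. f (x + t *\<^sub>R h)) has_real_derivative ddir h f (x + t *\<^sub>R h)) (at t)"
proof -
  have "((\<lambda>t. f (x + t *\<^sub>R h)) has_derivative (\<lambda>u. pd (u *\<^sub>R h) f (x + t *\<^sub>R h))) (at t)"
    by (rule has_derivative_compose[OF _ tame_has_derivative[OF assms]]) (auto intro!: derivative_eq_intros)
  moreover have "pd (u *\<^sub>R h) f y = u * ddir h f y" for u y
    using tame_pd_eq_ddir[OF assms, of "u *\<^sub>R h" y] by (simp add: ddir_def sum_distrib_left mult.assoc)
  ultimately show ?thesis unfolding has_field_derivative_def by (simp add: mult_commute_abs)
qed

lemma ddir_sum:
  assumes "\<And>i. i \<in> I \<Longrightarrow> tame (Suc k) (f i)"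
  shows "ddir h (\<lambda>x. \<Sum>i\<in>I. a i * f i x) x = (\<Sum>i\<in>I. a i * ddir h (f i) x)"
proof -
  have "((\<lambda>x. \<Sum>i\<in>I. a i * f i x) has_derivative (\<lambda>h. \<Sum>i\<in>I. a i * pd h (f i) x)) (at x)"
    using tame_has_derivative assms by (intro has_derivative_sum has_derivative_mult_right) blast
  then have "pd b (\<lambda>x. \<Sum>i\<in>I. a i * f i x) x = (\<Sum>i\<in>I. a i * pd b (f i) x)" for b
    by (rule pd_eq)
  then show ?thesis
    unfolding ddir_def by (simp add: sum_distrib_left mult_ac sum.swap[of _ I])
qed

lemma tame_ddir_power: "tame (k + m) f \<Longrightarrow> tame k ((ddir h ^^ m) f)"
proof (induction m arbitrary: k)
  case (Suc m)
  have "tame (Suc k) ((ddir h ^^ m) f)" by (rule Suc.IH) (use Suc.prems in \<open>simp del: tame.simps\<close>)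
  then show ?case by (simp add: tame_ddir del: tame.simps)
qed simp

lemma ddir_power_sum:
  assumes "\<And>i. i \<in> I \<Longrightarrow> tame m (f i)"
  shows "(ddir h ^^ m) (\<lambda>x. \<Sum>i\<in>I. a i * f i x) = (\<lambda>x. \<Sum>i\<in>I. a i * (ddir h ^^ m) (f i) x)"
proof -
  have "(ddir h ^^ j) (\<lambda>x. \<Sum>i\<in>I. a i * f i x) = (\<lambda>x. \<Sum>i\<in>I. a i * (ddir h ^^ j) (f i) x)" if "j \<le> m" for j
    using that
  proof (induction j)
    case (Suc j)
    have "tame (Suc 0) ((ddir h ^^ j) (f i))" if "i \<in> I" for i
      using Suc.prems assms[OF that] by (intro tame_ddir_power) (auto elim!: tame_mono simp del: tame.simps)
    then have "ddir h (\<lambda>x. \<Sum>i\<in>I. a i * (ddir h ^^ j) (f i) x) = (\<lambda>x. \<Sum>i\<in>I. a i * ddir h ((ddir h ^^ j) (f i)) x)"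
      by (intro ext ddir_sum) blast
    then show ?case using Suc by simp
  qed simp
  then show ?thesis by simp
qed

lemma ddir_power_Suc_eq:
  assumes "tame (Suc m) f"
  shows "(ddir h ^^ Suc m) f x = (\<Sum>b\<in>Basis. (h \<bullet> b) * (ddir h ^^ m) (pd b f) x)"
proof -
  have "(ddir h ^^ m) (ddir h f) = (\<lambda>x. \<Sum>b\<in>Basis. (h \<bullet> b) * (ddir h ^^ m) (pd b f) x)"
    unfolding ddir_def[of h f, abs_def] using assms by (intro ddir_power_sum) simp
  then show ?thesis by (simp add: funpow_Suc_right del: funpow.simps)
qed

lemma poly_growth_sum: "(\<And>i. i \<in> I \<Longrightarrow> poly_growth (f i)) \<Longrightarrow> poly_growth (\<lambda>x. \<Sum>i\<in>I. f i x)"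
  by (induction I rule: infinite_finite_induct) (auto simp: poly_growth_const poly_growth_add)

text \<open>
  The \<open>m\<close>-th directional derivative is homogeneous of degree \<open>m\<close> in the direction, with coefficients of
  polynomial growth; this is the form of bound that the Taylor remainder needs.
\<close>

lemma ddir_power_growth:
  assumes "tame m f"
  shows "\<exists>G. poly_growth G \<and> (\<forall>h x. \<bar>(ddir h ^^ m) f x\<bar> \<le> norm h ^ m * G x)"
  using assms
proof (induction m arbitrary: f)
  case 0
  then show ?case
    by (intro exI[of _ "\<lambda>x. \<bar>f x\<bar>"]) (auto intro: poly_growth_dominated)
next
  case (Suc m)
  have "\<exists>G. poly_growth G \<and> (\<forall>h x. \<bar>(ddir h ^^ m) (pd b f) x\<bar> \<le> norm h ^ m * G x)" if "b \<in> Basis" for b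
    using Suc that by simp
  then obtain G where G: "\<And>b. b \<in> Basis \<Longrightarrow> poly_growth (G b)"
    "\<And>b h x. b \<in> Basis \<Longrightarrow> \<bar>(ddir h ^^ m) (pd b f) x\<bar> \<le> norm h ^ m * G b x"
    by metis
  show ?case
  proof (intro exI[of _ "\<lambda>x. \<Sum>b\<in>Basis. G b x"] conjI allI poly_growth_sum G(1))
    fix h x :: 'a
    have "\<bar>(ddir h ^^ Suc m) f x\<bar> \<le> (\<Sum>b\<in>Basis. norm h * (norm h ^ m * G b x))"
      unfolding ddir_power_Suc_eq[OF Suc.prems]
      by (intro order_trans[OF sum_abs] sum_mono)
        (auto simp: abs_mult intro!: mult_mono G(2) Basis_le_norm)
    then show "\<bar>(ddir h ^^ Suc m) f x\<bar> \<le> norm h ^ Suc m * (\<Sum>b\<in>Basis. G b x)"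
      by (simp add: sum_distrib_left mult_ac)
  qed
qed

text \<open>
  Taylor's formula with Lagrange remainder on the segment from \<open>x\<close> to \<open>x + h\<close>.  The intermediate point is
  absorbed by the factor \<open>1 + |x| + |h|\<close>, which leaves a bound in terms of the two end points alone.
\<close>

lemma tame_taylor:
  assumes "tame m (f::'v::euclidean_space \<Rightarrow> real)" "m > 0"
  shows "\<exists>C p. C \<ge> 0 \<and> (\<forall>x h. \<bar>f (x + h) - (\<Sum>j<m. (ddir h ^^ j) f x / fact j)\<bar>
      \<le> C * ((1 + norm x + norm h) ^ p * norm h ^ m))"
proof -
  obtain G where G: "poly_growth G" "\<And>h x. \<bar>(ddir h ^^ m) f x\<bar> \<le> norm h ^ m * G x"
    using ddir_power_growth[OF assms(1)] by blast
  obtain C p where C: "C \<ge> 0" "\<And>x. \<bar>G x\<bar> \<le> C * (1 + norm x) ^ p"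
    by (rule poly_growthE[OF G(1)]) blast
  have "\<bar>f (x + h) - (\<Sum>j<m. (ddir h ^^ j) f x / fact j)\<bar>
      \<le> C * ((1 + norm x + norm h) ^ p * norm h ^ m)" for x h
  proof -
    have "\<forall>j t. j < m \<and> 0 \<le> t \<and> t \<le> 1 \<longrightarrow>
        ((\<lambda>t. (ddir h ^^ j) f (x + t *\<^sub>R h)) has_real_derivative (ddir h ^^ Suc j) f (x + t *\<^sub>R h)) (at t)"
    proof (intro allI impI)
      fix j t assume "j < m \<and> 0 \<le> t \<and> t \<le> (1::real)"
      then have "tame (Suc 0) ((ddir h ^^ j) f)"
        using assms(1) by (intro tame_ddir_power) (auto elim!: tame_mono simp del: tame.simps)
      from tame_line_deriv[OF this]
      show "((\<lambda>t. (ddir h ^^ j) f (x + t *\<^sub>R h)) has_real_derivative (ddir h ^^ Suc j) f (x + t *\<^sub>R h)) (at t)"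
        by simp
    qed
    from Maclaurin[OF zero_less_one assms(2) _ this, of "\<lambda>t. f (x + t *\<^sub>R h)"]
    obtain \<theta> where \<theta>: "0 < \<theta>" "\<theta> < 1"
      "f (x + h) = (\<Sum>j<m. (ddir h ^^ j) f x / fact j) + (ddir h ^^ m) f (x + \<theta> *\<^sub>R h) / fact m"
      by auto
    have "norm (x + \<theta> *\<^sub>R h) \<le> norm x + \<theta> * norm h"
      using norm_triangle_ineq[of x "\<theta> *\<^sub>R h"] \<theta> by simp
    also have "\<dots> \<le> norm x + norm h" using \<theta> by (simp add: mult_left_le_one_le)
    finally have *: "(1 + norm (x + \<theta> *\<^sub>R h)) ^ p \<le> (1 + norm x + norm h) ^ p"
      by (intro power_mono) auto
    have "\<bar>(ddir h ^^ m) f (x + \<theta> *\<^sub>R h) / fact m\<bar> \<le> \<bar>(ddir h ^^ m) f (x + \<theta> *\<^sub>R h)\<bar>"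
      by (simp add: divide_le_eq mult_le_cancel_left1)
    also have "\<dots> \<le> norm h ^ m * G (x + \<theta> *\<^sub>R h)" by (rule G(2))
    also have "\<dots> \<le> norm h ^ m * (C * (1 + norm (x + \<theta> *\<^sub>R h)) ^ p)"
      using C(2)[of "x + \<theta> *\<^sub>R h"] by (intro mult_left_mono) auto
    also have "\<dots> \<le> norm h ^ m * (C * (1 + norm x + norm h) ^ p)"
      using * C(1) by (intro mult_left_mono) auto
    finally show ?thesis using \<theta>(3) by (simp add: mult_ac)
  qed
  then show ?thesis using C(1) by blast
qed

section \<open>Riemann sums and mean inequalities\<close>

lemma integral_diff_const_bound:
  fixes f :: "real \<Rightarrow> real"
  assumes "a \<le> b" "continuous_on {a..b} f" "\<And>t. t \<in> {a..b} \<Longrightarrow> \<bar>f t - c\<bar> \<le> e"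
  shows "\<bar>integral {a..b} f - (b - a) * c\<bar> \<le> e * (b - a)"
proof -
  have "integral {a..b} (\<lambda>t. f t - c) = integral {a..b} f - (b - a) * c"
    using assms(1,2) by (subst integral_diff) (auto intro: integrable_continuous_real)
  moreover have "norm (integral {a..b} (\<lambda>t. f t - c)) \<le> e * (b - a)"
    by (rule integral_bound[OF assms(1)]) (auto intro!: continuous_intros assms)
  ultimately show ?thesis by simp
qed

lemma integral_grid_sum:
  fixes f :: "real \<Rightarrow> real"
  assumes "h \<ge> 0" "continuous_on {a..a + real n * h} f"
  shows "integral {a..a + real n * h} f = (\<Sum>k<n. integral {a + real k * h..a + real (Suc k) * h} f)"
  using assms(2)
proof (induction n)
  case (Suc n)
  have le: "a + real n * h \<le> a + real (Suc n) * h" "a \<le> a + real n * h" using assms(1) by (auto simp: algebra_simps)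
  have "integral {a..a + real n * h} f + integral {a + real n * h..a + real (Suc n) * h} f = integral {a..a + real (Suc n) * h} f"
    by (rule Henstock_Kurzweil_Integration.integral_combine[OF le(2,1)]) (rule integrable_continuous_real[OF Suc.prems])
  moreover have "integral {a..a + real n * h} f = (\<Sum>k<n. integral {a + real k * h..a + real (Suc k) * h} f)"
    using le by (intro Suc.IH continuous_on_subset[OF Suc.prems]) auto
  ultimately show ?case by simp
qed simp

text \<open>
  The sums use the right end points, so that the integral of an adapted process over \<open>[0, t]\<close> is a limit of random
  variables known at time \<open>t\<close>, and all sampling points are strictly later than \<open>a\<close>.
\<close>

lemma riemann_sum_tendsto:
  fixes f :: "real \<Rightarrow> real"
  assumes "a \<le> b" "continuous_on {a..b} f"
  shows "(\<lambda>n. \<Sum>k<Suc n. (b - a) / Suc n * f (a + real (Suc k) * ((b - a) / Suc n))) \<longlonglongrightarrow> integral {a..b} f"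
proof (rule LIMSEQ_I)
  fix r :: real assume r: "r > 0"
  define e where "e = r / (b - a + 1)"
  have e: "e > 0" "e * (b - a) < r"
    using r assms(1) by (auto simp: e_def field_simps)
  have "uniformly_continuous_on {a..b} f" by (rule compact_uniformly_continuous[OF assms(2)]) simp
  then obtain d where d: "d > 0" "\<And>x y. x \<in> {a..b} \<Longrightarrow> y \<in> {a..b} \<Longrightarrow> dist y x < d \<Longrightarrow> dist (f y) (f x) < e"
    unfolding uniformly_continuous_on_def using e(1) by metis
  obtain n0 :: nat where n0: "(b - a) / d < real n0" using reals_Archimedean2 by blast
  show "\<exists>no. \<forall>n\<ge>no. norm ((\<Sum>k<Suc n. (b - a) / Suc n * f (a + real (Suc k) * ((b - a) / Suc n))) - integral {a..b} f) < r"
  proof (intro exI[of _ n0] allI impI)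
    fix n assume "n0 \<le> n"
    define h where "h = (b - a) / Suc n"
    have h: "h \<ge> 0" "real (Suc n) * h = b - a" using assms(1) by (auto simp: h_def)
    have hd: "h < d"
    proof -
      have "(b - a) / d < Suc n" using n0 \<open>n0 \<le> n\<close> by linarith
      then show ?thesis using d(1) by (simp add: h_def field_simps)
    qed
    have ab: "{a..b} = {a..a + real (Suc n) * h}" using h by simp
    have sub: "{a + real k * h..a + real (Suc k) * h} \<subseteq> {a..b}" if "k < Suc n" for k
    proof -
      have "real (Suc k) * h \<le> real (Suc n) * h" using that h(1) by (intro mult_right_mono) auto
      moreover have "0 \<le> real k * h" using h by simp
      ultimately show ?thesis using h(2) by auto
    qed
    have piece: "\<bar>integral {a + real k * h..a + real (Suc k) * h} f - h * f (a + real (Suc k) * h)\<bar> \<le> e * h" if "k < Suc n" for k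
    proof -
      have "\<bar>integral {a + real k * h..a + real (Suc k) * h} f - ((a + real (Suc k) * h) - (a + real k * h)) * f (a + real (Suc k) * h)\<bar>
          \<le> e * ((a + real (Suc k) * h) - (a + real k * h))"
      proof (rule integral_diff_const_bound)
        show "a + real k * h \<le> a + real (Suc k) * h" using h by (simp add: algebra_simps)
        then have end_in: "a + real (Suc k) * h \<in> {a..b}" using sub[OF that] by auto
        show "continuous_on {a + real k * h..a + real (Suc k) * h} f" by (rule continuous_on_subset[OF assms(2) sub[OF that]])
        fix t assume t: "t \<in> {a + real k * h..a + real (Suc k) * h}"
        then have "dist t (a + real (Suc k) * h) \<le> h" by (auto simp: dist_real_def algebra_simps)
        then have "dist (f t) (f (a + real (Suc k) * h)) < e"
          using hd sub[OF that] t end_in by (intro d(2)) auto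
        then show "\<bar>f t - f (a + real (Suc k) * h)\<bar> \<le> e" by (simp add: dist_real_def)
      qed
      then show ?thesis by (simp add: algebra_simps)
    qed
    have "integral {a..b} f = (\<Sum>k<Suc n. integral {a + real k * h..a + real (Suc k) * h} f)"
      unfolding ab by (rule integral_grid_sum[OF h(1)]) (use assms(2) ab in simp)
    then have "\<bar>(\<Sum>k<Suc n. h * f (a + real (Suc k) * h)) - integral {a..b} f\<bar>
        = \<bar>\<Sum>k<Suc n. (integral {a + real k * h..a + real (Suc k) * h} f - h * f (a + real (Suc k) * h))\<bar>"
      by (simp only: sum_subtractf abs_minus_commute)
    also have "\<dots> \<le> (\<Sum>k<Suc n. e * h)"
      by (intro order_trans[OF sum_abs] sum_mono) (use piece in auto)
    also have "\<dots> = e * (b - a)" using h(2) by (simp add: mult_ac)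
    also have "\<dots> < r" by (rule e)
    finally show "norm ((\<Sum>k<Suc n. (b - a) / Suc n * f (a + real (Suc k) * ((b - a) / Suc n))) - integral {a..b} f) < r"
      unfolding h_def by simp
  qed
qed

lemma convex_on_power_nonneg: "convex_on {0::real..} (\<lambda>x. x ^ n)"
proof (cases "even n")
  case True
  then show ?thesis using convex_on_subset[OF convex_power_even] by blast
qed (rule convex_power_odd)

lemma abs_mean_power_le:
  fixes y :: "nat \<Rightarrow> real"
  assumes "n > 0"
  shows "\<bar>\<Sum>k<n. y k / n\<bar> ^ p \<le> (\<Sum>k<n. \<bar>y k\<bar> ^ p / n)"
proof -
  have "\<bar>\<Sum>k<n. y k / n\<bar> ^ p \<le> (\<Sum>k<n. (1 / n) *\<^sub>R \<bar>y k\<bar>) ^ p"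
    by (intro power_mono order_trans[OF sum_abs]) auto
  also have "\<dots> \<le> (\<Sum>k<n. (1 / n) * \<bar>y k\<bar> ^ p)"
    using assms by (intro convex_on_sum[OF _ _ convex_on_power_nonneg]) auto
  finally show ?thesis by simp
qed

lemma abs_add_power_le: "\<bar>x + y\<bar> ^ k \<le> 2 ^ k * (\<bar>x\<bar> ^ k + \<bar>y\<bar> ^ k)" for x y :: real
proof -
  have "\<bar>x + y\<bar> ^ k \<le> (2 * max \<bar>x\<bar> \<bar>y\<bar>) ^ k" by (intro power_mono) auto
  also have "\<dots> = 2 ^ k * (max \<bar>x\<bar> \<bar>y\<bar>) ^ k" by (simp add: power_mult_distrib)
  also have "(max \<bar>x\<bar> \<bar>y\<bar>) ^ k \<le> \<bar>x\<bar> ^ k + \<bar>y\<bar> ^ k" by (auto simp: max_def)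
  finally show ?thesis by simp
qed

section \<open>Orders of magnitude of random increments\<close>

definition moment_le :: "'a measure \<Rightarrow> nat \<Rightarrow> real \<Rightarrow> ('a \<Rightarrow> real) \<Rightarrow> bool" where
  "moment_le M k B X \<longleftrightarrow>
     X \<in> borel_measurable M \<and> integrable M (\<lambda>\<omega>. \<bar>X \<omega>\<bar> ^ k) \<and> (\<integral>\<omega>. \<bar>X \<omega>\<bar> ^ k \<partial>M) \<le> B"

lemma moment_le_measurable: "moment_le M k B X \<Longrightarrow> X \<in> borel_measurable M"
  by (simp add: moment_le_def)

lemma moment_le_integrable: "moment_le M k B X \<Longrightarrow> integrable M (\<lambda>\<omega>. \<bar>X \<omega>\<bar> ^ k)"
  by (simp add: moment_le_def)

lemma moment_le_integral: "moment_le M k B X \<Longrightarrow> (\<integral>\<omega>. \<bar>X \<omega>\<bar> ^ k \<partial>M) \<le> B"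
  by (simp add: moment_le_def)

lemma moment_le_weaken: "moment_le M k B X \<Longrightarrow> B \<le> B' \<Longrightarrow> moment_le M k B' X"
  by (simp add: moment_le_def)

lemma moment_leI:
  assumes "X \<in> borel_measurable M" "integrable M Y" "(\<integral>\<omega>. Y \<omega> \<partial>M) \<le> B" "AE \<omega> in M. \<bar>X \<omega>\<bar> ^ k \<le> Y \<omega>"
  shows "moment_le M k B X"
proof -
  have "integrable M (\<lambda>\<omega>. \<bar>X \<omega>\<bar> ^ k)"
    using assms(1,4) by (intro Bochner_Integration.integrable_bound[OF assms(2)]) auto
  moreover have "(\<integral>\<omega>. \<bar>X \<omega>\<bar> ^ k \<partial>M) \<le> (\<integral>\<omega>. Y \<omega> \<partial>M)"
    by (rule integral_mono_AE[OF calculation assms(2,4)])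
  ultimately show ?thesis using assms(1,3) by (simp add: moment_le_def)
qed

lemma moment_le_dominated:
  assumes "moment_le M k B Y" "X \<in> borel_measurable M" "AE \<omega> in M. \<bar>X \<omega>\<bar> \<le> \<bar>Y \<omega>\<bar>"
  shows "moment_le M k B X"
proof (rule moment_leI[OF assms(2)])
  show "AE \<omega> in M. \<bar>X \<omega>\<bar> ^ k \<le> \<bar>Y \<omega>\<bar> ^ k"
    using assms(3) by eventually_elim (intro power_mono, auto)
qed (use assms(1) in \<open>auto simp: moment_le_def\<close>)

lemma moment_le_add:
  assumes X: "moment_le M k B X" and Y: "moment_le M k C Y"
  shows "moment_le M k (2 ^ k * (B + C)) (\<lambda>\<omega>. X \<omega> + Y \<omega>)"
proof (rule moment_leI)
  note i = moment_le_integrable[OF X] moment_le_integrable[OF Y]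
  show "integrable M (\<lambda>\<omega>. 2 ^ k * (\<bar>X \<omega>\<bar> ^ k + \<bar>Y \<omega>\<bar> ^ k))" using i by simp
  have "(\<integral>\<omega>. 2 ^ k * (\<bar>X \<omega>\<bar> ^ k + \<bar>Y \<omega>\<bar> ^ k) \<partial>M) = 2 ^ k * ((\<integral>\<omega>. \<bar>X \<omega>\<bar> ^ k \<partial>M) + (\<integral>\<omega>. \<bar>Y \<omega>\<bar> ^ k \<partial>M))"
    using i by simp
  also have "\<dots> \<le> 2 ^ k * (B + C)"
    using moment_le_integral[OF X] moment_le_integral[OF Y] by (intro mult_left_mono add_mono) auto
  finally show "(\<integral>\<omega>. 2 ^ k * (\<bar>X \<omega>\<bar> ^ k + \<bar>Y \<omega>\<bar> ^ k) \<partial>M) \<le> 2 ^ k * (B + C)" .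
qed (use moment_le_measurable[OF X] moment_le_measurable[OF Y] in \<open>auto intro: abs_add_power_le\<close>)

text \<open>
  The Cauchy--Schwarz inequality in the form \<open>2 a b \<le> (v / u) a\<^sup>2 + (u / v) b\<^sup>2\<close>, where \<open>u\<close> and \<open>v\<close> are the expected
  magnitudes of the two factors.
\<close>

lemma moment_le_mult:
  assumes X: "moment_le M (2 * k) (B * (u * u)) X" and Y: "moment_le M (2 * k) (C * (v * v)) Y"
    and uv: "u > 0" "v > 0"
  shows "moment_le M k ((B + C) / 2 * (u * v)) (\<lambda>\<omega>. X \<omega> * Y \<omega>)"
proof (rule moment_leI)
  let ?Z = "\<lambda>\<omega>. (v / u * \<bar>X \<omega>\<bar> ^ (2 * k) + u / v * \<bar>Y \<omega>\<bar> ^ (2 * k)) / 2"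
  note i = moment_le_integrable[OF X] moment_le_integrable[OF Y]
  show "integrable M ?Z" using i by simp
  have "(\<integral>\<omega>. ?Z \<omega> \<partial>M) = (v / u * (\<integral>\<omega>. \<bar>X \<omega>\<bar> ^ (2 * k) \<partial>M) + u / v * (\<integral>\<omega>. \<bar>Y \<omega>\<bar> ^ (2 * k) \<partial>M)) / 2"
    using i by simp
  also have "\<dots> \<le> (v / u * (B * (u * u)) + u / v * (C * (v * v))) / 2"
    using uv by (intro divide_right_mono add_mono mult_left_mono moment_le_integral[OF X] moment_le_integral[OF Y]) auto
  also have "\<dots> = (B + C) / 2 * (u * v)" using uv by (simp add: field_simps)
  finally show "(\<integral>\<omega>. ?Z \<omega> \<partial>M) \<le> (B + C) / 2 * (u * v)" .
  have "a * b \<le> (v / u * (a * a) + u / v * (b * b)) / 2" for a b :: real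
  proof -
    have "0 \<le> (v * a - u * b)\<^sup>2" by simp
    then have "2 * (a * b) * (u * v) \<le> v * v * (a * a) + u * u * (b * b)"
      by (simp add: power2_eq_square algebra_simps)
    then show ?thesis using uv by (simp add: field_simps)
  qed
  then show "AE \<omega> in M. \<bar>X \<omega> * Y \<omega>\<bar> ^ k \<le> ?Z \<omega>"
    by (simp add: abs_mult power_mult_distrib mult_2 power_add)
qed (use moment_le_measurable[OF X] moment_le_measurable[OF Y] in simp)

text \<open>
  Moment bounds pass to pointwise limits by Fatou's lemma; applied to Riemann sums, this avoids joint measurability and Fubini's
  theorem for time integrals.
\<close>

lemma moment_le_limit:
  assumes R: "\<And>n. moment_le M k B (R n)" and lim: "\<And>\<omega>. \<omega> \<in> space M \<Longrightarrow> (\<lambda>n. R n \<omega>) \<longlonglongrightarrow> Y \<omega>"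
  shows "moment_le M k B Y"
proof -
  note meas = moment_le_measurable[OF R] and int = moment_le_integrable[OF R] and le = moment_le_integral[OF R]
  have Y: "Y \<in> borel_measurable M" by (rule borel_measurable_LIMSEQ_real[OF lim meas])
  have "0 \<le> (\<integral>\<omega>. \<bar>R 0 \<omega>\<bar> ^ k \<partial>M)" by (intro Bochner_Integration.integral_nonneg) simp
  then have B: "B \<ge> 0" using le[of 0] by linarith
  have "(\<integral>\<^sup>+\<omega>. ennreal (\<bar>Y \<omega>\<bar> ^ k) \<partial>M) = (\<integral>\<^sup>+\<omega>. liminf (\<lambda>n. ennreal (\<bar>R n \<omega>\<bar> ^ k)) \<partial>M)"
    by (intro nn_integral_cong lim_imp_Liminf[symmetric] tendsto_ennrealI tendsto_power tendsto_rabs lim) auto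
  also have "\<dots> \<le> liminf (\<lambda>n. \<integral>\<^sup>+\<omega>. ennreal (\<bar>R n \<omega>\<bar> ^ k) \<partial>M)"
    using meas by (intro nn_integral_liminf) simp
  also have "\<dots> \<le> liminf (\<lambda>n. ennreal B)"
    using int le by (intro Liminf_mono always_eventually) (auto simp: nn_integral_eq_integral ennreal_leI)
  also have "\<dots> = ennreal B" by (simp add: Liminf_const)
  finally have *: "(\<integral>\<^sup>+\<omega>. ennreal (\<bar>Y \<omega>\<bar> ^ k) \<partial>M) \<le> ennreal B" .
  have i: "integrable M (\<lambda>\<omega>. \<bar>Y \<omega>\<bar> ^ k)"
    using Y * by (intro integrableI_nonneg) (auto simp: le_less_trans)
  then show ?thesis using Y * B nn_integral_eq_integral[OF i] by (simp add: moment_le_def)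
qed

text \<open>
  A family \<open>X s t\<close> of random variables has order \<open>q\<close> if it is of size \<open>(t - s)\<^sup>q\<^sup>/\<^sup>2\<close> in every \<open>L\<^sup>k\<close>, uniformly for
  \<open>0 \<le> s < t \<le> T\<close>: a Brownian increment has order \<open>1\<close>, an increment of time order \<open>2\<close>.  Demanding all \<open>k\<close> at once is
  what makes the class closed under products.
\<close>

definition moment_order :: "'a measure \<Rightarrow> real \<Rightarrow> nat \<Rightarrow> (real \<Rightarrow> real \<Rightarrow> 'a \<Rightarrow> real) \<Rightarrow> bool" where
  "moment_order M T q X \<longleftrightarrow> (\<forall>k. \<exists>C\<ge>0. \<forall>s t. 0 \<le> s \<longrightarrow> s < t \<longrightarrow> t \<le> T \<longrightarrow>
     moment_le M k (C * sqrt (t - s) ^ (q * k)) (X s t))"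

lemma moment_orderE:
  assumes "moment_order M T q X"
  obtains C where "C \<ge> 0"
    "\<And>s t. 0 \<le> s \<Longrightarrow> s < t \<Longrightarrow> t \<le> T \<Longrightarrow> moment_le M k (C * sqrt (t - s) ^ (q * k)) (X s t)"
  using assms unfolding moment_order_def by metis

lemma moment_orderI:
  assumes "\<And>k s t. 0 \<le> s \<Longrightarrow> s < t \<Longrightarrow> t \<le> T \<Longrightarrow> moment_le M k (C k * sqrt (t - s) ^ (q * k)) (X s t)"
    "\<And>k. C k \<ge> 0"
  shows "moment_order M T q X"
  using assms unfolding moment_order_def by blast

lemma moment_order_measurable:
  "moment_order M T q X \<Longrightarrow> 0 \<le> s \<Longrightarrow> s < t \<Longrightarrow> t \<le> T \<Longrightarrow> X s t \<in> borel_measurable M"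
  unfolding moment_order_def moment_le_def by metis

lemma moment_order_dominated:
  assumes "moment_order M T q Y"
    "\<And>s t. 0 \<le> s \<Longrightarrow> s < t \<Longrightarrow> t \<le> T \<Longrightarrow> X s t \<in> borel_measurable M"
    "\<And>s t. 0 \<le> s \<Longrightarrow> s < t \<Longrightarrow> t \<le> T \<Longrightarrow> AE \<omega> in M. \<bar>X s t \<omega>\<bar> \<le> \<bar>Y s t \<omega>\<bar>"
  shows "moment_order M T q X"
  unfolding moment_order_def
proof
  fix k
  obtain C where "C \<ge> 0" "\<And>s t. 0 \<le> s \<Longrightarrow> s < t \<Longrightarrow> t \<le> T \<Longrightarrow> moment_le M k (C * sqrt (t - s) ^ (q * k)) (Y s t)"
    by (rule moment_orderE[OF assms(1), of k]) blast
  then show "\<exists>C\<ge>0. \<forall>s t. 0 \<le> s \<longrightarrow> s < t \<longrightarrow> t \<le> T \<longrightarrow> moment_le M k (C * sqrt (t - s) ^ (q * k)) (X s t)"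
    using moment_le_dominated assms(2,3) by blast
qed

lemma moment_order_cong:
  assumes "moment_order M T q Y"
    "\<And>s t \<omega>. 0 \<le> s \<Longrightarrow> s < t \<Longrightarrow> t \<le> T \<Longrightarrow> \<omega> \<in> space M \<Longrightarrow> X s t \<omega> = Y s t \<omega>"
  shows "moment_order M T q X"
proof (rule moment_order_dominated[OF assms(1)])
  fix s t :: real assume st: "0 \<le> s" "s < t" "t \<le> T"
  show "X s t \<in> borel_measurable M"
    using moment_order_measurable[OF assms(1) st] assms(2)[OF st] by (simp cong: measurable_cong)
  show "AE \<omega> in M. \<bar>X s t \<omega>\<bar> \<le> \<bar>Y s t \<omega>\<bar>" using assms(2)[OF st] by (intro AE_I2) simp
qed

lemma moment_order_const:
  assumes "prob_space M" shows "moment_order M T 0 (\<lambda>s t \<omega>. c)"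
  by (rule moment_orderI[of _ _ "\<lambda>k. \<bar>c\<bar> ^ k"])
    (auto simp: moment_le_def prob_space.prob_space[OF assms] prob_space.finite_measure[OF assms] finite_measure.integrable_const)

lemma moment_order_add:
  assumes "moment_order M T q X" "moment_order M T q Y"
  shows "moment_order M T q (\<lambda>s t \<omega>. X s t \<omega> + Y s t \<omega>)"
  unfolding moment_order_def
proof
  fix k
  obtain C where C: "C \<ge> 0" "\<And>s t. 0 \<le> s \<Longrightarrow> s < t \<Longrightarrow> t \<le> T \<Longrightarrow> moment_le M k (C * sqrt (t - s) ^ (q * k)) (X s t)"
    by (rule moment_orderE[OF assms(1), of k]) blast
  obtain D where D: "D \<ge> 0" "\<And>s t. 0 \<le> s \<Longrightarrow> s < t \<Longrightarrow> t \<le> T \<Longrightarrow> moment_le M k (D * sqrt (t - s) ^ (q * k)) (Y s t)"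
    by (rule moment_orderE[OF assms(2), of k]) blast
  show "\<exists>C\<ge>0. \<forall>s t. 0 \<le> s \<longrightarrow> s < t \<longrightarrow> t \<le> T \<longrightarrow>
      moment_le M k (C * sqrt (t - s) ^ (q * k)) (\<lambda>\<omega>. X s t \<omega> + Y s t \<omega>)"
    using moment_le_add[OF C(2) D(2)] C(1) D(1)
    by (intro exI[of _ "2 ^ k * (C + D)"]) (auto simp: distrib_left distrib_right mult.assoc)
qed

lemma moment_order_mult:
  assumes "moment_order M T q X" "moment_order M T r Y"
  shows "moment_order M T (q + r) (\<lambda>s t \<omega>. X s t \<omega> * Y s t \<omega>)"
  unfolding moment_order_def
proof
  fix k
  obtain C where C: "C \<ge> 0" "\<And>s t. 0 \<le> s \<Longrightarrow> s < t \<Longrightarrow> t \<le> T \<Longrightarrow> moment_le M (2 * k) (C * sqrt (t - s) ^ (q * (2 * k))) (X s t)"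
    by (rule moment_orderE[OF assms(1), of "2 * k"]) blast
  obtain D where D: "D \<ge> 0" "\<And>s t. 0 \<le> s \<Longrightarrow> s < t \<Longrightarrow> t \<le> T \<Longrightarrow> moment_le M (2 * k) (D * sqrt (t - s) ^ (r * (2 * k))) (Y s t)"
    by (rule moment_orderE[OF assms(2), of "2 * k"]) blast
  have pow: "sqrt h ^ (n * (2 * k)) = sqrt h ^ (n * k) * sqrt h ^ (n * k)" for h n
    by (simp add: power_add[symmetric] mult_2 distrib_left)
  have "moment_le M k ((C + D) / 2 * sqrt (t - s) ^ ((q + r) * k)) (\<lambda>\<omega>. X s t \<omega> * Y s t \<omega>)"
    if "0 \<le> s" "s < t" "t \<le> T" for s t
    using moment_le_mult[OF C(2)[OF that, unfolded pow] D(2)[OF that, unfolded pow]] that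
    by (simp add: distrib_right power_add)
  then show "\<exists>C\<ge>0. \<forall>s t. 0 \<le> s \<longrightarrow> s < t \<longrightarrow> t \<le> T \<longrightarrow>
      moment_le M k (C * sqrt (t - s) ^ ((q + r) * k)) (\<lambda>\<omega>. X s t \<omega> * Y s t \<omega>)"
    using C(1) D(1) by (intro exI[of _ "(C + D) / 2"]) auto
qed

lemma moment_order_mono:
  assumes "moment_order M T q X" "r \<le> q"
  shows "moment_order M T r X"
  unfolding moment_order_def
proof
  fix k
  obtain C where C: "C \<ge> 0" "\<And>s t. 0 \<le> s \<Longrightarrow> s < t \<Longrightarrow> t \<le> T \<Longrightarrow> moment_le M k (C * sqrt (t - s) ^ (q * k)) (X s t)"
    by (rule moment_orderE[OF assms(1), of k]) blast
  have "C * sqrt (t - s) ^ (q * k) \<le> C * sqrt \<bar>T\<bar> ^ ((q - r) * k) * sqrt (t - s) ^ (r * k)"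
    if "0 \<le> s" "s < t" "t \<le> T" for s t
  proof -
    have "q * k = (q - r) * k + r * k" using assms(2) by (simp add: distrib_right[symmetric])
    then have "sqrt (t - s) ^ (q * k) = sqrt (t - s) ^ ((q - r) * k) * sqrt (t - s) ^ (r * k)"
      by (simp add: power_add)
    also have "\<dots> \<le> sqrt \<bar>T\<bar> ^ ((q - r) * k) * sqrt (t - s) ^ (r * k)"
      using that by (intro mult_right_mono power_mono) auto
    finally show ?thesis using C(1) by (simp add: mult.assoc mult_left_mono)
  qed
  then show "\<exists>C\<ge>0. \<forall>s t. 0 \<le> s \<longrightarrow> s < t \<longrightarrow> t \<le> T \<longrightarrow> moment_le M k (C * sqrt (t - s) ^ (r * k)) (X s t)"
    using C(1) moment_le_weaken[OF C(2)] by (intro exI[of _ "C * sqrt \<bar>T\<bar> ^ ((q - r) * k)"]) simp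
qed

lemma moment_order_cmult:
  assumes "prob_space M" "moment_order M T q X"
  shows "moment_order M T q (\<lambda>s t \<omega>. c * X s t \<omega>)"
  using moment_order_mult[OF moment_order_const[OF assms(1)] assms(2)] by simp

lemma moment_order_diff:
  assumes "prob_space M" "moment_order M T q X" "moment_order M T q Y"
  shows "moment_order M T q (\<lambda>s t \<omega>. X s t \<omega> - Y s t \<omega>)"
  using moment_order_add[OF assms(2) moment_order_cmult[OF assms(1,3), of "-1"]] by simp

lemma moment_order_sum:
  assumes "prob_space M" "finite I" "\<And>i. i \<in> I \<Longrightarrow> moment_order M T q (X i)"
  shows "moment_order M T q (\<lambda>s t \<omega>. \<Sum>i\<in>I. X i s t \<omega>)"
  using assms(2,3)
proof (induction I)
  case empty
  interpret prob_space M by (rule assms)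
  have "moment_le M k (1 * sqrt (t - s) ^ (q * k)) (\<lambda>\<omega>. 0)" if "s < t" for k and s t :: real
    using that by (cases k) (auto simp: moment_le_def prob_space)
  then show ?case by (auto intro!: moment_orderI[of _ _ "\<lambda>k. 1"])
qed (auto intro!: moment_order_add)

lemma moment_order_power:
  assumes "prob_space M" "moment_order M T q X"
  shows "moment_order M T (q * n) (\<lambda>s t \<omega>. X s t \<omega> ^ n)"
proof (induction n)
  case (Suc n)
  show ?case using moment_order_mult[OF assms(2) Suc] by (simp add: mult_ac)
qed (simp add: moment_order_const[OF assms(1)])

text \<open>
  Increments started at \<open>0\<close> give bounds for one-parameter processes.  The point \<open>s = 0\<close> is not covered by the
  order estimate, which is why the value at \<open>(0, 0)\<close> has to be prescribed.
\<close>

lemma moment_order_from_zero: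
  assumes "prob_space M" "moment_order M T q X" "\<And>\<omega>. \<omega> \<in> space M \<Longrightarrow> X 0 0 \<omega> = 0"
  shows "moment_order M T 0 (\<lambda>s t. X 0 s)" "moment_order M T 0 (\<lambda>s t. X 0 t)"
proof -
  interpret prob_space M by (rule assms)
  have "\<exists>C\<ge>0. \<forall>s. 0 \<le> s \<longrightarrow> s \<le> T \<longrightarrow> moment_le M k C (X 0 s)" for k
  proof -
    obtain C where C: "C \<ge> 0" "\<And>s t. 0 \<le> s \<Longrightarrow> s < t \<Longrightarrow> t \<le> T \<Longrightarrow> moment_le M k (C * sqrt (t - s) ^ (0 * k)) (X s t)"
      by (rule moment_orderE[OF moment_order_mono[OF assms(2), of 0], of k]) auto
    have X0: "X 0 0 \<in> borel_measurable M" using assms(3) by (simp cong: measurable_cong)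
    have "moment_le M k (C + 1) (X 0 s)" if "0 \<le> s" "s \<le> T" for s
    proof (cases "s = 0")
      case True
      show ?thesis unfolding True
        by (rule moment_leI[OF X0, of "\<lambda>_. 1"]) (use assms(3) C(1) in \<open>auto simp: prob_space power_0_left\<close>)
    next
      case False
      then show ?thesis using C(2)[of 0 s] that by (auto intro: moment_le_weaken)
    qed
    then show ?thesis using C(1) by (intro exI[of _ "C + 1"]) auto
  qed
  then obtain C where C: "\<And>k. C k \<ge> 0" "\<And>k s. 0 \<le> s \<Longrightarrow> s \<le> T \<Longrightarrow> moment_le M k (C k) (X 0 s)" by metis
  show "moment_order M T 0 (\<lambda>s t. X 0 s)" "moment_order M T 0 (\<lambda>s t. X 0 t)"
    using C by (auto intro!: moment_orderI[of _ _ C])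
qed

text \<open>
  Integration over \<open>[s, t]\<close> gains a factor \<open>t - s\<close>, that is two orders.  For Riemann sums this is the power mean
  inequality, and Fatou's lemma carries it over to the limit.
\<close>

lemma moment_order_integral:
  assumes X: "moment_order M T q X"
    and cont: "\<And>s \<omega>. 0 \<le> s \<Longrightarrow> \<omega> \<in> space M \<Longrightarrow> continuous_on {s..} (\<lambda>u. X s u \<omega>)"
  shows "moment_order M T (q + 2) (\<lambda>s t \<omega>. integral {s..t} (\<lambda>u. X s u \<omega>))"
  unfolding moment_order_def
proof
  fix k
  obtain C where C: "C \<ge> 0" "\<And>s t. 0 \<le> s \<Longrightarrow> s < t \<Longrightarrow> t \<le> T \<Longrightarrow> moment_le M k (C * sqrt (t - s) ^ (q * k)) (X s t)"
    by (rule moment_orderE[OF X, of k]) blast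
  have "moment_le M k (C * sqrt (t - s) ^ ((q + 2) * k)) (\<lambda>\<omega>. integral {s..t} (\<lambda>u. X s u \<omega>))"
    if st: "0 \<le> s" "s < t" "t \<le> T" for s t
  proof (rule moment_le_limit)
    let ?p = "\<lambda>n j. s + real (Suc j) * ((t - s) / Suc n)"
    show "(\<lambda>n. \<Sum>j<Suc n. (t - s) / Suc n * X s (?p n j) \<omega>) \<longlonglongrightarrow> integral {s..t} (\<lambda>u. X s u \<omega>)"
      if "\<omega> \<in> space M" for \<omega>
      using that st by (intro riemann_sum_tendsto continuous_on_subset[OF cont]) auto
    fix n
    have p: "s < ?p n j" "?p n j \<le> t" if "j < Suc n" for j
    proof -
      show "s < ?p n j" using st by (auto intro!: mult_pos_pos)
      have "real (Suc j) * ((t - s) / Suc n) \<le> real (Suc n) * ((t - s) / Suc n)"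
        using that st by (intro mult_right_mono) auto
      then show "?p n j \<le> t" by simp
    qed
    have le: "moment_le M k (C * sqrt (t - s) ^ (q * k)) (X s (?p n j))" if "j < Suc n" for j
    proof (rule moment_le_weaken[OF C(2)])
      show "C * sqrt (?p n j - s) ^ (q * k) \<le> C * sqrt (t - s) ^ (q * k)"
        using p[OF that] C(1) by (intro mult_left_mono power_mono) auto
    qed (use st p[OF that] in auto)
    let ?Y = "\<lambda>\<omega>. (t - s) ^ k * (\<Sum>j<Suc n. \<bar>X s (?p n j) \<omega>\<bar> ^ k / Suc n)"
    show "moment_le M k (C * sqrt (t - s) ^ ((q + 2) * k)) (\<lambda>\<omega>. \<Sum>j<Suc n. (t - s) / Suc n * X s (?p n j) \<omega>)"
    proof (rule moment_leI[of _ _ ?Y])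
      show "(\<lambda>\<omega>. \<Sum>j<Suc n. (t - s) / Suc n * X s (?p n j) \<omega>) \<in> borel_measurable M"
        using moment_le_measurable[OF le] by (intro borel_measurable_sum borel_measurable_times) auto
      show "integrable M ?Y" using moment_le_integrable[OF le]
        by (intro integrable_mult_right Bochner_Integration.integrable_sum integrable_divide_zero) auto
      have "(\<integral>\<omega>. ?Y \<omega> \<partial>M) = (t - s) ^ k * (\<Sum>j<Suc n. (\<integral>\<omega>. \<bar>X s (?p n j) \<omega>\<bar> ^ k \<partial>M) / Suc n)"
        using moment_le_integrable[OF le] by (subst integral_mult_right_zero, subst Bochner_Integration.integral_sum) auto
      also have "\<dots> \<le> (t - s) ^ k * (\<Sum>j<Suc n. (C * sqrt (t - s) ^ (q * k)) / Suc n)"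
        using st by (intro mult_left_mono sum_mono divide_right_mono moment_le_integral[OF le]) auto
      also have "\<dots> = C * (sqrt (t - s) ^ (q * k) * (sqrt (t - s) ^ 2) ^ k)" using st by simp
      also have "\<dots> = C * sqrt (t - s) ^ ((q + 2) * k)"
        by (simp only: power_mult[symmetric] power_add[symmetric] distrib_right)
      finally show "(\<integral>\<omega>. ?Y \<omega> \<partial>M) \<le> C * sqrt (t - s) ^ ((q + 2) * k)" .
      show "AE \<omega> in M. \<bar>\<Sum>j<Suc n. (t - s) / Suc n * X s (?p n j) \<omega>\<bar> ^ k \<le> ?Y \<omega>"
      proof (intro AE_I2)
        fix \<omega>
        have "(\<Sum>j<Suc n. (t - s) / Suc n * X s (?p n j) \<omega>) = (t - s) * (\<Sum>j<Suc n. X s (?p n j) \<omega> / Suc n)"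
          unfolding sum_distrib_left by simp
        then have "\<bar>\<Sum>j<Suc n. (t - s) / Suc n * X s (?p n j) \<omega>\<bar> ^ k = (t - s) ^ k * \<bar>\<Sum>j<Suc n. X s (?p n j) \<omega> / Suc n\<bar> ^ k"
          using st by (simp add: abs_mult power_mult_distrib)
        also have "\<dots> \<le> ?Y \<omega>" using st by (intro mult_left_mono abs_mean_power_le) auto
        finally show "\<bar>\<Sum>j<Suc n. (t - s) / Suc n * X s (?p n j) \<omega>\<bar> ^ k \<le> ?Y \<omega>" .
      qed
    qed
  qed
  then show "\<exists>C\<ge>0. \<forall>s t. 0 \<le> s \<longrightarrow> s < t \<longrightarrow> t \<le> T \<longrightarrow>
      moment_le M k (C * sqrt (t - s) ^ ((q + 2) * k)) (\<lambda>\<omega>. integral {s..t} (\<lambda>u. X s u \<omega>))"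
    using C(1) by blast
qed

text \<open>
  Random variables with all moments finite are the one-parameter counterpart of families of order \<open>0\<close>, and they
  inherit their closure properties from them.
\<close>

definition all_moments :: "'a measure \<Rightarrow> ('a \<Rightarrow> real) \<Rightarrow> bool" where
  "all_moments M X \<longleftrightarrow> X \<in> borel_measurable M \<and> (\<forall>k. integrable M (\<lambda>\<omega>. \<bar>X \<omega>\<bar> ^ k))"

lemma moment_order_all_moments:
  "moment_order M T q X \<Longrightarrow> 0 \<le> s \<Longrightarrow> s < t \<Longrightarrow> t \<le> T \<Longrightarrow> all_moments M (X s t)"
  unfolding all_moments_def moment_order_def moment_le_def by meson

lemma all_moments_moment_order:
  assumes "all_moments M X" shows "moment_order M T 0 (\<lambda>s t. X)"
  by (rule moment_orderI[of _ _ "\<lambda>k. \<integral>\<omega>. \<bar>X \<omega>\<bar> ^ k \<partial>M"])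
    (use assms in \<open>auto simp: all_moments_def moment_le_def intro: Bochner_Integration.integral_nonneg\<close>)

lemma all_moments_iff_moment_order: "all_moments M X \<longleftrightarrow> moment_order M 1 0 (\<lambda>s t. X)"
  using all_moments_moment_order moment_order_all_moments[of M 1 0 "\<lambda>s t. X" 0 1] by auto

lemma all_moments_integrable_power:
  assumes "all_moments M X" shows "integrable M (\<lambda>\<omega>. X \<omega> ^ k)"
proof (rule integrable_abs_cancel)
  show "integrable M (\<lambda>\<omega>. \<bar>X \<omega> ^ k\<bar>)" using assms by (simp add: all_moments_def power_abs)
  show "(\<lambda>\<omega>. X \<omega> ^ k) \<in> borel_measurable M" using assms by (intro borel_measurable_power) (simp add: all_moments_def)
qed

lemma all_moments_integrable: "all_moments M X \<Longrightarrow> integrable M X"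
  using all_moments_integrable_power[of M X 1] by simp

lemma all_moments_mult: "all_moments M X \<Longrightarrow> all_moments M Y \<Longrightarrow> all_moments M (\<lambda>\<omega>. X \<omega> * Y \<omega>)"
  unfolding all_moments_iff_moment_order using moment_order_mult[of M 1 0 _ 0] by simp

lemma all_moments_add: "all_moments M X \<Longrightarrow> all_moments M Y \<Longrightarrow> all_moments M (\<lambda>\<omega>. X \<omega> + Y \<omega>)"
  unfolding all_moments_iff_moment_order by (rule moment_order_add)

lemma all_moments_diff:
  "prob_space M \<Longrightarrow> all_moments M X \<Longrightarrow> all_moments M Y \<Longrightarrow> all_moments M (\<lambda>\<omega>. X \<omega> - Y \<omega>)"
  unfolding all_moments_iff_moment_order by (rule moment_order_diff)

lemma all_moments_sum:
  "prob_space M \<Longrightarrow> finite I \<Longrightarrow> (\<And>i. i \<in> I \<Longrightarrow> all_moments M (X i)) \<Longrightarrow> all_moments M (\<lambda>\<omega>. \<Sum>i\<in>I. X i \<omega>)"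
  unfolding all_moments_iff_moment_order by (rule moment_order_sum)

text \<open>
  By scaling, the \<open>k\<close>-th absolute moment of a centred normal variable is proportional to the \<open>k\<close>-th power of its
  standard deviation.
\<close>

lemma abs_normal_moment:
  "\<exists>C\<ge>0. \<forall>\<sigma>>0. has_bochner_integral lborel (\<lambda>x. normal_density 0 \<sigma> x * \<bar>x\<bar> ^ k) (C * \<sigma> ^ k)"
proof (cases "even k")
  case True
  then obtain j where k: "k = 2 * j" by (elim evenE)
  show ?thesis
  proof (intro exI[of _ "fact (2 * j) / (2 ^ j * fact j)"] conjI allI impI)
    fix \<sigma> :: real assume s: "0 < \<sigma>"
    have "fact (2 * j) / ((2 / \<sigma>\<^sup>2) ^ j * fact j) = fact (2 * j) / (2 ^ j * fact j) * \<sigma> ^ k"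
      using s by (simp add: k power_divide power_mult[symmetric])
    then show "has_bochner_integral lborel (\<lambda>x. normal_density 0 \<sigma> x * \<bar>x\<bar> ^ k) (fact (2 * j) / (2 ^ j * fact j) * \<sigma> ^ k)"
      using normal_moment_even[OF s, of 0 j] by (simp add: k power_even_abs)
  qed simp
next
  case False
  then obtain j where k: "k = 2 * j + 1" by (elim oddE)
  show ?thesis
  proof (intro exI[of _ "2 ^ j * fact j * sqrt (2 / pi)"] conjI allI impI)
    fix \<sigma> :: real assume s: "0 < \<sigma>"
    show "has_bochner_integral lborel (\<lambda>x. normal_density 0 \<sigma> x * \<bar>x\<bar> ^ k) (2 ^ j * fact j * sqrt (2 / pi) * \<sigma> ^ k)"
      using normal_moment_abs_odd[OF s, of 0 j] by (simp add: k mult_ac)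
  qed simp
qed

section \<open>Brownian vectors\<close>

text \<open>
  The deterministic core of the sewing argument: over \<open>n\<close> equal steps the increments add up to at most
  \<open>n \<cdot> n\<^sup>-\<^sup>3\<^sup>/\<^sup>2\<close> times a constant.
\<close>

lemma constant_of_small_increments:
  fixes \<phi> :: "real \<Rightarrow> real"
  assumes "s < t" "\<And>u v. s \<le> u \<Longrightarrow> u < v \<Longrightarrow> v \<le> t \<Longrightarrow> \<bar>\<phi> v - \<phi> u\<bar> \<le> C * sqrt (v - u) ^ 3"
  shows "\<phi> t = \<phi> s"
proof -
  define K where "K = C * sqrt (t - s) ^ 3"
  have bound: "\<bar>\<phi> t - \<phi> s\<bar> \<le> K * (1 / sqrt (Suc n))" for n
  proof -
    define h where "h = (t - s) / Suc n"
    have h: "h > 0" "s + real (Suc n) * h = t" using assms(1) by (auto simp: h_def)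
    have "\<phi> t - \<phi> s = (\<Sum>k<Suc n. \<phi> (s + real (Suc k) * h) - \<phi> (s + real k * h))"
      unfolding sum_lessThan_telescope[of "\<lambda>k. \<phi> (s + real k * h)"] using h(2) by simp
    also have "\<bar>\<dots>\<bar> \<le> (\<Sum>k<Suc n. C * sqrt h ^ 3)"
    proof (intro order_trans[OF sum_abs] sum_mono)
      fix k assume k: "k \<in> {..<Suc n}"
      have "real (Suc k) * h \<le> real (Suc n) * h" using h(1) k by (intro mult_right_mono) auto
      then have "\<bar>\<phi> (s + real (Suc k) * h) - \<phi> (s + real k * h)\<bar> \<le> C * sqrt ((s + real (Suc k) * h) - (s + real k * h)) ^ 3"
        using h by (intro assms(2)) (auto simp: algebra_simps)
      then show "\<bar>\<phi> (s + real (Suc k) * h) - \<phi> (s + real k * h)\<bar> \<le> C * sqrt h ^ 3" by (simp add: algebra_simps)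
    qed
    also have "\<dots> = C * (real (Suc n) * sqrt h ^ 3)" by simp
    also have "real (Suc n) * sqrt h ^ 3 = sqrt (t - s) ^ 3 * (1 / sqrt (Suc n))"
    proof -
      have "sqrt h ^ 3 = sqrt (t - s) ^ 3 / (sqrt (Suc n) * (sqrt (Suc n) * sqrt (Suc n)))"
        unfolding h_def by (simp add: real_sqrt_divide power_divide power3_eq_cube)
      also have "sqrt (Suc n) * sqrt (Suc n) = Suc n" by simp
      finally show ?thesis by simp
    qed
    finally show ?thesis by (simp add: K_def)
  qed
  have "(\<lambda>n. K * (1 / sqrt (Suc n))) \<longlonglongrightarrow> K * 0"
    by (intro tendsto_mult tendsto_const real_tendsto_divide_at_top[OF tendsto_const] filterlim_compose[OF sqrt_at_top]
        filterlim_compose[OF filterlim_real_sequentially] filterlim_Suc)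
  then have "\<bar>\<phi> t - \<phi> s\<bar> \<le> K * 0"
    by (rule LIMSEQ_le_const) (use bound in blast)
  then show ?thesis by simp
qed

lemma integral_double_sum:
  fixes f :: "'i \<Rightarrow> 'j \<Rightarrow> 'a \<Rightarrow> real"
  assumes "\<And>k l. integrable M (f k l)"
  shows "(\<integral>\<omega>. (\<Sum>k\<in>I. \<Sum>l\<in>J. f k l \<omega>) \<partial>M) = (\<Sum>k\<in>I. \<Sum>l\<in>J. \<integral>\<omega>. f k l \<omega> \<partial>M)"
  using assms by (simp add: Bochner_Integration.integral_sum)

text \<open>
  A process in a Euclidean space whose coordinates are multiples of Brownian motions for the filtration.  The
  mutual independence of the coordinates is expressed by \<open>increment_cross\<close>, the product rule for mixed second moments
  of increments over two intervals.
\<close>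

locale brownian_vector =
  fixes P :: "'a measure" and F :: "real \<Rightarrow> 'a measure" and W :: "real \<Rightarrow> 'a \<Rightarrow> 'v::euclidean_space"
    and \<sigma> :: real and x0 :: 'v
  assumes filtered: "filtered_prob_space P F"
    and adapted: "adapted_continuous P F W"
    and start: "AE \<omega> in P. W 0 \<omega> = x0"
    and scale_pos: "\<sigma> > 0"
    and increment_normal: "b \<in> Basis \<Longrightarrow> 0 \<le> s \<Longrightarrow> s < t \<Longrightarrow>
      distributed P lborel (\<lambda>\<omega>. (W t \<omega> - W s \<omega>) \<bullet> b) (normal_density 0 (\<sigma> * sqrt (t - s)))"
    and increment_indep: "b \<in> Basis \<Longrightarrow> 0 \<le> s \<Longrightarrow> s < t \<Longrightarrow>
      prob_space.indep_set P (sets (F s)) {(\<lambda>\<omega>. (W t \<omega> - W s \<omega>) \<bullet> b) -` A \<inter> space P | A. A \<in> sets borel}"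
    and increment_cross: "b \<in> Basis \<Longrightarrow> c \<in> Basis \<Longrightarrow> b \<noteq> c \<Longrightarrow> 0 \<le> s \<Longrightarrow> s < t \<Longrightarrow> 0 \<le> u \<Longrightarrow> u < v \<Longrightarrow>
      (\<integral>\<omega>. (((W t \<omega> - W s \<omega>) \<bullet> b) * ((W v \<omega> - W u \<omega>) \<bullet> b)) * (((W t \<omega> - W s \<omega>) \<bullet> c) * ((W v \<omega> - W u \<omega>) \<bullet> c)) \<partial>P)
      = (\<integral>\<omega>. ((W t \<omega> - W s \<omega>) \<bullet> b) * ((W v \<omega> - W u \<omega>) \<bullet> b) \<partial>P) * (\<integral>\<omega>. ((W t \<omega> - W s \<omega>) \<bullet> c) * ((W v \<omega> - W u \<omega>) \<bullet> c) \<partial>P)"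
begin

lemma prob: "prob_space P" using filtered by (simp add: filtered_prob_space_def)

sublocale prob_space P by (rule prob)

lemma subalg: "subalgebra P (F t)" using filtered by (simp add: filtered_prob_space_def)

lemma space_F: "space (F t) = space P" using subalg by (simp add: subalgebra_def)

lemma measurable_F: "X \<in> measurable (F t) N \<Longrightarrow> X \<in> measurable P N"
  by (rule measurable_from_subalg[OF subalg])

lemma measurable_F_mono: "X \<in> measurable (F s) N \<Longrightarrow> s \<le> t \<Longrightarrow> X \<in> measurable (F t) N"
proof -
  assume X: "X \<in> measurable (F s) N" "s \<le> t"
  have "sets (F s) \<subseteq> sets (F t)" using filtered X(2) by (simp add: filtered_prob_space_def filtration_def)
  then show ?thesis using X(1) by (auto simp: measurable_def space_F)
qed

lemma W_measurable:
  assumes "0 \<le> s" "s \<le> t" shows "W s \<in> borel_measurable (F t)"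
  by (rule measurable_F_mono[OF _ assms(2)]) (use adapted assms(1) in \<open>auto simp: adapted_continuous_def\<close>)

lemma W_measurable_P: "0 \<le> s \<Longrightarrow> W s \<in> borel_measurable P"
  using W_measurable[of s s] measurable_F by auto

lemma W_continuous: "\<omega> \<in> space P \<Longrightarrow> continuous_on {0..} (\<lambda>t. W t \<omega>)"
  using adapted by (auto simp: adapted_continuous_def)

definition dW :: "'v \<Rightarrow> real \<Rightarrow> real \<Rightarrow> 'a \<Rightarrow> real" where
  "dW b s t \<omega> = (W t \<omega> - W s \<omega>) \<bullet> b"

lemma dW_measurable: "0 \<le> s \<Longrightarrow> s \<le> t \<Longrightarrow> t \<le> r \<Longrightarrow> dW b s t \<in> borel_measurable (F r)"
  unfolding dW_def[abs_def] by (intro borel_measurable_inner borel_measurable_diff W_measurable borel_measurable_const) auto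

text \<open>
  The test variables of the martingale property: they are known at time \<open>s\<close>, and they form an algebra, so that
  coefficients such as \<open>\<nabla>f(W s)\<close> can be absorbed into them.
\<close>

definition admissible :: "real \<Rightarrow> ('a \<Rightarrow> real) \<Rightarrow> bool" where
  "admissible s Y \<longleftrightarrow> Y \<in> borel_measurable (F s) \<and> all_moments P Y"

lemma admissible_mult: "admissible s X \<Longrightarrow> admissible s Y \<Longrightarrow> admissible s (\<lambda>\<omega>. X \<omega> * Y \<omega>)"
  by (auto simp: admissible_def intro: all_moments_mult)

lemma admissible_mono: "admissible s X \<Longrightarrow> s \<le> t \<Longrightarrow> admissible t X"
  by (auto simp: admissible_def intro: measurable_F_mono)

lemma admissible_indicator: "A \<in> sets (F s) \<Longrightarrow> admissible s (indicator A)"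
proof -
  assume A: "A \<in> sets (F s)"
  then have AP: "A \<in> sets P" using subalg by (auto simp: subalgebra_def)
  have "(\<lambda>\<omega>. \<bar>indicator A \<omega> :: real\<bar> ^ k) = (if k = 0 then (\<lambda>\<omega>. 1) else indicator A)" for k :: nat
    by (auto simp: indicator_def fun_eq_iff)
  then show ?thesis using A AP by (auto simp: admissible_def all_moments_def less_top[symmetric])
qed

lemma dW_moment:
  assumes b: "b \<in> Basis"
  shows "\<exists>C\<ge>0. \<forall>s t. 0 \<le> s \<longrightarrow> s < t \<longrightarrow> integrable P (\<lambda>\<omega>. \<bar>dW b s t \<omega>\<bar> ^ k) \<and>
     (\<integral>\<omega>. \<bar>dW b s t \<omega>\<bar> ^ k \<partial>P) = C * sqrt (t - s) ^ k"
proof -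
  obtain C where C: "C \<ge> 0"
    "\<And>\<tau>. \<tau> > 0 \<Longrightarrow> has_bochner_integral lborel (\<lambda>x. normal_density 0 \<tau> x * \<bar>x\<bar> ^ k) (C * \<tau> ^ k)"
    using abs_normal_moment[of k] by blast
  show ?thesis
  proof (intro exI[of _ "C * \<sigma> ^ k"] conjI allI impI)
    show "0 \<le> C * \<sigma> ^ k" using C scale_pos by simp
    fix s t :: real assume st: "0 \<le> s" "s < t"
    have pos: "\<sigma> * sqrt (t - s) > 0" using st scale_pos by simp
    note D = increment_normal[OF b st, folded dW_def]
    show "integrable P (\<lambda>\<omega>. \<bar>dW b s t \<omega>\<bar> ^ k)"
      using C(2)[OF pos] distributed_integrable[OF D, of "\<lambda>x. \<bar>x\<bar> ^ k"] by (auto simp: integrable.simps)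
    show "(\<integral>\<omega>. \<bar>dW b s t \<omega>\<bar> ^ k \<partial>P) = C * \<sigma> ^ k * sqrt (t - s) ^ k"
      using has_bochner_integral_integral_eq[OF C(2)[OF pos]] distributed_integral[OF D, of "\<lambda>x. \<bar>x\<bar> ^ k"]
      by (simp add: power_mult_distrib mult_ac)
  qed
qed

lemma dW_order: assumes "b \<in> Basis" shows "moment_order P T 1 (dW b)"
proof -
  have "dW b s t \<in> borel_measurable P" if "0 \<le> s" "s < t" for s t
    using dW_measurable[of s t t b] measurable_F that by auto
  then show ?thesis
    using dW_moment[OF assms] unfolding moment_order_def moment_le_def by (metis mult_1 order_refl)
qed

lemma dW_all_moments: "b \<in> Basis \<Longrightarrow> 0 \<le> s \<Longrightarrow> s < t \<Longrightarrow> all_moments P (dW b s t)"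
  using moment_order_all_moments[OF dW_order] by auto

lemma dW_admissible: "b \<in> Basis \<Longrightarrow> 0 \<le> s \<Longrightarrow> s < t \<Longrightarrow> t \<le> r \<Longrightarrow> admissible r (dW b s t)"
  by (simp add: admissible_def dW_all_moments dW_measurable)

lemma dW_mean: assumes "b \<in> Basis" "0 \<le> s" "s < t" shows "(\<integral>\<omega>. dW b s t \<omega> \<partial>P) = 0"
proof -
  note D = increment_normal[OF assms, folded dW_def]
  have pos: "\<sigma> * sqrt (t - s) > 0" using assms scale_pos by simp
  show ?thesis
    using distributed_integral[OF D, of "\<lambda>x. x"] integral_normal_moment_odd[OF pos, of 0 0] by simp
qed

lemma dW_variance:
  assumes "b \<in> Basis" "0 \<le> s" "s < t" shows "(\<integral>\<omega>. (dW b s t \<omega>)\<^sup>2 \<partial>P) = \<sigma>\<^sup>2 * (t - s)"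
proof -
  note D = increment_normal[OF assms, folded dW_def]
  have pos: "\<sigma> * sqrt (t - s) > 0" using assms scale_pos by simp
  show ?thesis
    using distributed_integral[OF D, of "\<lambda>x. x\<^sup>2"] integral_normal_moment_even[OF pos, of 0 1] assms
    by (simp add: fact_numeral power_mult_distrib)
qed

text \<open>
  Both generating families are stable under intersection, so independence extends from them to the
  generated \<open>\<sigma>\<close>-algebras.
\<close>

lemma dW_indep:
  assumes "b \<in> Basis" "0 \<le> s" "s < t" "Y \<in> borel_measurable (F s)"
  shows "indep_var borel Y borel (dW b s t)"
proof -
  let ?D = "{dW b s t -` A \<inter> space P | A. A \<in> sets borel}"
  have ind: "indep_set (sets (F s)) ?D"
    using increment_indep[OF assms(1-3)] by (simp only: dW_def[abs_def])
  have stab: "Int_stable ?D"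
    by (auto simp: Int_stable_def) (metis (no_types, lifting) Int_assoc Int_left_commute sets.Int vimage_Int Int_absorb)
  have ind2: "indep_set (sigma_sets (space P) (sets (F s))) (sigma_sets (space P) ?D)"
    by (rule indep_set_sigma_sets[OF ind sets.Int_stable stab])
  have sub: "sigma_sets (space P) {Y -` A \<inter> space P | A. A \<in> sets borel} \<subseteq> sigma_sets (space P) (sets (F s))"
    using assms(4) by (intro sigma_sets_mono') (auto simp: measurable_def space_F)
  have "indep_set (sigma_sets (space P) {Y -` A \<inter> space P | A. A \<in> sets borel}) (sigma_sets (space P) ?D)"
    using indep_sets_mono_sets[OF ind2[unfolded indep_set_def]] sub
    unfolding indep_set_def by (auto split: bool.splits)
  moreover have "Y \<in> borel_measurable P" using assms(4) by (rule measurable_F)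
  moreover have "dW b s t \<in> borel_measurable P" using dW_measurable[of s t t b] assms measurable_F by auto
  ultimately show ?thesis by (simp add: indep_var_eq)
qed

lemma dW_centered:
  assumes "b \<in> Basis" "0 \<le> s" "s < t" "admissible s Y"
  shows "(\<integral>\<omega>. Y \<omega> * dW b s t \<omega> \<partial>P) = 0"
proof -
  have "(\<integral>\<omega>. Y \<omega> * dW b s t \<omega> \<partial>P) = (\<integral>\<omega>. Y \<omega> \<partial>P) * (\<integral>\<omega>. dW b s t \<omega> \<partial>P)"
    using assms by (intro indep_var_lebesgue_integral dW_indep)
      (auto simp: admissible_def dest: all_moments_integrable dW_all_moments)
  then show ?thesis using dW_mean[OF assms(1-3)] by simp
qed

lemma dW_conditional_variance:
  assumes "b \<in> Basis" "0 \<le> s" "s < t" "admissible s Y"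
  shows "(\<integral>\<omega>. Y \<omega> * (dW b s t \<omega>)\<^sup>2 \<partial>P) = \<sigma>\<^sup>2 * (t - s) * (\<integral>\<omega>. Y \<omega> \<partial>P)"
proof -
  have "indep_var borel ((\<lambda>x. x) \<circ> Y) borel ((\<lambda>x. x\<^sup>2) \<circ> dW b s t)"
  proof (rule indep_var_compose[OF dW_indep[OF assms(1-3)]])
    show "Y \<in> borel_measurable (F s)" using assms(4) by (simp add: admissible_def)
  qed simp_all
  then have "(\<integral>\<omega>. Y \<omega> * (dW b s t \<omega>)\<^sup>2 \<partial>P) = (\<integral>\<omega>. Y \<omega> \<partial>P) * (\<integral>\<omega>. (dW b s t \<omega>)\<^sup>2 \<partial>P)"
    using indep_var_lebesgue_integral[of Y "\<lambda>\<omega>. (dW b s t \<omega>)\<^sup>2"] assms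
      all_moments_integrable_power[OF dW_all_moments[OF assms(1-3)], of 2] all_moments_integrable[of P Y]
    by (simp add: admissible_def comp_def)
  then show ?thesis using dW_variance[OF assms(1-3)] by simp
qed

text \<open>
  Different coordinates are conditionally uncorrelated given the past, although only the separate coordinates are known
  to be independent of it.  Cut \<open>[s, t]\<close> into \<open>n\<close> cells and expand the product of the two increments.  In a product
  of increments over different cells, the later increment is independent of the past, which determines the other factors,
  so these terms have mean zero against \<open>Y\<close>.  What remains is \<open>E[Y S]\<close>, where \<open>S\<close> is the sum of the products over equal cells.  As the two
  coordinates are independent of each other, \<open>E[S\<^sup>2]\<close> is of order \<open>1 / n\<close>, so the mean tends to \<open>0\<close>.
\<close>

lemma dW_conditional_covariance_zero:
  assumes b: "b \<in> Basis" and c: "c \<in> Basis" and bc: "b \<noteq> c" and st: "0 \<le> s" "s < t" and Y: "admissible s Y"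
  shows "(\<integral>\<omega>. Y \<omega> * (dW b s t \<omega> * dW c s t \<omega>) \<partial>P) = 0"
proof -
  define K where "K = ((\<integral>\<omega>. (Y \<omega>)\<^sup>2 \<partial>P) + (\<sigma>\<^sup>2 * (t - s))\<^sup>2) / 2"
  have bound: "\<bar>\<integral>\<omega>. Y \<omega> * (dW b s t \<omega> * dW c s t \<omega>) \<partial>P\<bar> \<le> K * (1 / sqrt (Suc n))" for n
  proof -
    define h where "h = (t - s) / Suc n"
    define u where "u k = s + real k * h" for k
    have h: "h > 0" "u (Suc n) = t" "u 0 = s" using st by (auto simp: h_def u_def)
    have u_less: "u k < u l" if "k < l" for k l using h(1) that by (simp add: u_def)
    have u_le: "u k \<le> u l" if "k \<le> l" for k l using h(1) that by (simp add: u_def)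
    have u0: "0 \<le> u k" for k using st h(1) by (simp add: u_def)
    have us: "s \<le> u k" for k using h(1) by (simp add: u_def)
    define X where "X a k = dW a (u k) (u (Suc k))" for a k
    have X_admissible: "admissible (u l) (X a k)" if "a \<in> Basis" "k < l" for a k l
      unfolding X_def using that by (intro dW_admissible u0 u_less u_le) auto
    have X_mom: "all_moments P (X a k)" if "a \<in> Basis" for a k
      unfolding X_def by (intro dW_all_moments that u0 u_less) simp
    have Y_mom: "all_moments P Y" using Y by (simp add: admissible_def)
    have tele: "dW a s t \<omega> = (\<Sum>k<Suc n. X a k \<omega>)" for a \<omega>
    proof -
      have "(\<Sum>k<Suc n. X a k \<omega>) = (\<Sum>k<Suc n. W (u (Suc k)) \<omega> - W (u k) \<omega>) \<bullet> a"
        unfolding X_def dW_def inner_sum_left ..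
      then show ?thesis unfolding sum_lessThan_telescope[of "\<lambda>k. W (u k) \<omega>"] by (simp only: dW_def h)
    qed
    have X_centered: "(\<integral>\<omega>. Z \<omega> * X a l \<omega> \<partial>P) = 0" if "a \<in> Basis" "admissible (u l) Z" for Z a l
      unfolding X_def using that by (intro dW_centered u0 u_less) auto
    have off: "(\<integral>\<omega>. Y \<omega> * (X b k \<omega> * X c l \<omega>) \<partial>P) = 0" if "k \<noteq> l" for k l
    proof (cases "k < l")
      case True
      have "admissible (u l) (\<lambda>\<omega>. Y \<omega> * X b k \<omega>)" by (intro admissible_mult admissible_mono[OF Y us] X_admissible b True)
      from X_centered[OF c this] show ?thesis by (simp add: mult_ac)
    next
      case False
      then have "l < k" using that by simp
      then have "admissible (u k) (\<lambda>\<omega>. Y \<omega> * X c l \<omega>)" by (intro admissible_mult admissible_mono[OF Y us] X_admissible c)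
      from X_centered[OF b this] show ?thesis by (simp add: mult_ac)
    qed
    define S where "S \<omega> = (\<Sum>k<Suc n. X b k \<omega> * X c k \<omega>)" for \<omega>
    have S_mom: "all_moments P S" unfolding S_def[abs_def]
      by (intro all_moments_sum prob all_moments_mult X_mom b c) auto
    have "(\<integral>\<omega>. Y \<omega> * (dW b s t \<omega> * dW c s t \<omega>) \<partial>P)
        = (\<integral>\<omega>. (\<Sum>k<Suc n. \<Sum>l<Suc n. Y \<omega> * (X b k \<omega> * X c l \<omega>)) \<partial>P)"
      by (simp only: tele sum_product) (simp only: sum_distrib_left)
    also have "\<dots> = (\<Sum>k<Suc n. \<Sum>l<Suc n. \<integral>\<omega>. Y \<omega> * (X b k \<omega> * X c l \<omega>) \<partial>P)"
      by (intro integral_double_sum all_moments_integrable all_moments_mult X_mom Y_mom b c)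
    also have "\<dots> = (\<Sum>k<Suc n. \<Sum>l<Suc n. if l = k then \<integral>\<omega>. Y \<omega> * (X b k \<omega> * X c k \<omega>) \<partial>P else 0)"
      by (intro sum.cong refl) (use off in auto)
    also have "\<dots> = (\<Sum>k<Suc n. \<integral>\<omega>. Y \<omega> * (X b k \<omega> * X c k \<omega>) \<partial>P)"
      by (intro sum.cong refl) (subst sum.delta, auto)
    also have "\<dots> = (\<integral>\<omega>. Y \<omega> * S \<omega> \<partial>P)"
      unfolding S_def sum_distrib_left
      by (intro Bochner_Integration.integral_sum[symmetric] all_moments_integrable all_moments_mult X_mom Y_mom b c)
    finally have eq: "(\<integral>\<omega>. Y \<omega> * (dW b s t \<omega> * dW c s t \<omega>) \<partial>P) = (\<integral>\<omega>. Y \<omega> * S \<omega> \<partial>P)" .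
    have XX: "(\<integral>\<omega>. X a k \<omega> * X a l \<omega> \<partial>P) = (if l = k then \<sigma>\<^sup>2 * h else 0)" if a: "a \<in> Basis" for a k l
    proof -
      have "(\<integral>\<omega>. X a k \<omega> * X a l \<omega> \<partial>P) = 0" if "k < l" for k l by (intro X_centered a X_admissible that)
      moreover have "(\<integral>\<omega>. X a k \<omega> * X a l \<omega> \<partial>P) = 0" if "l < k" for k l
        using calculation(1)[OF that] by (simp only: mult.commute[of "X a k _"])
      moreover have "(\<integral>\<omega>. X a k \<omega> * X a k \<omega> \<partial>P) = \<sigma>\<^sup>2 * h" for k
        using dW_variance[OF a u0 u_less, of k "Suc k"] by (simp add: X_def power2_eq_square u_def algebra_simps)
      ultimately show ?thesis by (cases k l rule: linorder_cases) auto
    qed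
    have XXXX: "(\<integral>\<omega>. (X b k \<omega> * X c k \<omega>) * (X b l \<omega> * X c l \<omega>) \<partial>P) = (if l = k then (\<sigma>\<^sup>2 * h)\<^sup>2 else 0)" for k l
    proof -
      have "(\<integral>\<omega>. (X b k \<omega> * X b l \<omega>) * (X c k \<omega> * X c l \<omega>) \<partial>P)
          = (\<integral>\<omega>. X b k \<omega> * X b l \<omega> \<partial>P) * (\<integral>\<omega>. X c k \<omega> * X c l \<omega> \<partial>P)"
        unfolding X_def dW_def by (rule increment_cross[OF b c bc u0 u_less u0 u_less]) auto
      then show ?thesis using XX[OF b] XX[OF c] by (simp add: power2_eq_square mult_ac)
    qed
    have "(\<integral>\<omega>. (S \<omega>)\<^sup>2 \<partial>P) = (\<integral>\<omega>. (\<Sum>k<Suc n. \<Sum>l<Suc n. (X b k \<omega> * X c k \<omega>) * (X b l \<omega> * X c l \<omega>)) \<partial>P)"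
      by (simp only: S_def power2_eq_square sum_product)
    also have "\<dots> = (\<Sum>k<Suc n. \<Sum>l<Suc n. \<integral>\<omega>. (X b k \<omega> * X c k \<omega>) * (X b l \<omega> * X c l \<omega>) \<partial>P)"
      by (intro integral_double_sum all_moments_integrable all_moments_mult X_mom Y_mom b c)
    also have "\<dots> = (\<Sum>k<Suc n. (\<sigma>\<^sup>2 * h)\<^sup>2)"
      unfolding XXXX by (intro sum.cong refl) (subst sum.delta, auto)
    also have "\<dots> = (\<sigma>\<^sup>2 * (t - s))\<^sup>2 / Suc n"
    proof -
      have ts: "t - s = real (Suc n) * h" by (simp add: h_def)
      show ?thesis unfolding ts by (simp add: power2_eq_square del: of_nat_Suc)
    qed
    finally have SS: "(\<integral>\<omega>. (S \<omega>)\<^sup>2 \<partial>P) = (\<sigma>\<^sup>2 * (t - s))\<^sup>2 / Suc n" .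
    \<comment> \<open>The weight \<open>r\<close> balances \<open>2 |Y S| \<le> Y\<^sup>2 / r + r S\<^sup>2\<close>, because \<open>E[S\<^sup>2]\<close> is of order \<open>1 / r\<^sup>2\<close>.\<close>
    define r where "r = sqrt (Suc n)"
    have r: "r > 0" "r * r = Suc n" by (auto simp: r_def)
    have "\<bar>\<integral>\<omega>. Y \<omega> * S \<omega> \<partial>P\<bar> \<le> (\<integral>\<omega>. \<bar>Y \<omega> * S \<omega>\<bar> \<partial>P)" by (rule integral_abs_bound)
    also have "\<dots> \<le> (\<integral>\<omega>. ((Y \<omega>)\<^sup>2 / r + (S \<omega>)\<^sup>2 * r) / 2 \<partial>P)"
    proof (rule integral_mono)
      show "integrable P (\<lambda>\<omega>. \<bar>Y \<omega> * S \<omega>\<bar>)"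
        by (intro integrable_abs all_moments_integrable all_moments_mult Y_mom S_mom)
      show "integrable P (\<lambda>\<omega>. ((Y \<omega>)\<^sup>2 / r + (S \<omega>)\<^sup>2 * r) / 2)"
        using all_moments_integrable_power[OF Y_mom, of 2] all_moments_integrable_power[OF S_mom, of 2] by simp
      fix \<omega>
      have "0 \<le> (\<bar>Y \<omega>\<bar> - \<bar>S \<omega>\<bar> * r)\<^sup>2" by simp
      then have "2 * \<bar>Y \<omega> * S \<omega>\<bar> * r \<le> (Y \<omega>)\<^sup>2 + (S \<omega>)\<^sup>2 * (r * r)"
        by (simp add: power2_eq_square abs_mult algebra_simps)
      then show "\<bar>Y \<omega> * S \<omega>\<bar> \<le> ((Y \<omega>)\<^sup>2 / r + (S \<omega>)\<^sup>2 * r) / 2"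
        using r(1) by (simp add: field_simps)
    qed
    also have "\<dots> = ((\<integral>\<omega>. (Y \<omega>)\<^sup>2 \<partial>P) / r + (\<integral>\<omega>. (S \<omega>)\<^sup>2 \<partial>P) * r) / 2"
      using all_moments_integrable_power[OF Y_mom, of 2] all_moments_integrable_power[OF S_mom, of 2] by simp
    also have "\<dots> = K * (1 / r)"
      unfolding SS r(2)[symmetric] K_def using r(1) by (simp add: field_simps)
    finally show ?thesis unfolding eq r_def .
  qed
  have "(\<lambda>n. K * (1 / sqrt (Suc n))) \<longlonglongrightarrow> K * 0"
    by (intro tendsto_mult tendsto_const real_tendsto_divide_at_top[OF tendsto_const] filterlim_compose[OF sqrt_at_top]
        filterlim_compose[OF filterlim_real_sequentially] filterlim_Suc)
  then have "\<bar>\<integral>\<omega>. Y \<omega> * (dW b s t \<omega> * dW c s t \<omega>) \<partial>P\<bar> \<le> K * 0"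
    by (rule LIMSEQ_le_const) (use bound in blast)
  then show ?thesis by simp
qed

end

section \<open>The Ito formula\<close>

lemma moment_order_time:
  assumes "prob_space M" shows "moment_order M T 2 (\<lambda>s t \<omega>. t - s)"
  by (rule moment_orderI[of _ _ "\<lambda>k. 1"])
    (auto simp: moment_le_def power_mult prob_space.prob_space[OF assms] prob_space.finite_measure[OF assms] finite_measure.integrable_const)

lemma moment_order_abs: "moment_order M T q X \<Longrightarrow> moment_order M T q (\<lambda>s t \<omega>. \<bar>X s t \<omega>\<bar>)"
  by (rule moment_order_dominated[of M T q X]) (auto intro!: borel_measurable_abs intro: moment_order_measurable)

context brownian_vector
begin

lemma increment_norm_order: "moment_order P T 1 (\<lambda>s t \<omega>. norm (W t \<omega> - W s \<omega>))"
proof (rule moment_order_dominated)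
  show "moment_order P T 1 (\<lambda>s t \<omega>. \<Sum>b\<in>Basis. \<bar>dW b s t \<omega>\<bar>)"
    by (intro moment_order_sum[OF prob] moment_order_abs dW_order) auto
  fix s t :: real assume "0 \<le> s" "s < t"
  then show "(\<lambda>\<omega>. norm (W t \<omega> - W s \<omega>)) \<in> borel_measurable P"
    using W_measurable_P[of s] W_measurable_P[of t] by simp
  show "AE \<omega> in P. \<bar>norm (W t \<omega> - W s \<omega>)\<bar> \<le> \<bar>\<Sum>b\<in>Basis. \<bar>dW b s t \<omega>\<bar>\<bar>"
    using norm_le_l1 by (auto simp: dW_def sum_nonneg)
qed

text \<open>
  The starting point is deterministic only almost surely, so this is a domination up to a null set.
\<close>

lemma W_norm_order:
  "moment_order P T 0 (\<lambda>s t \<omega>. norm (W s \<omega>))" "moment_order P T 0 (\<lambda>s t \<omega>. norm (W t \<omega>))"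
proof -
  have le: "AE \<omega> in P. \<bar>norm (W s \<omega>)\<bar> \<le> \<bar>norm x0 + norm (W s \<omega> - W 0 \<omega>)\<bar>" for s
    using start by eventually_elim (use norm_triangle_sub in auto)
  note z = moment_order_from_zero[OF prob increment_norm_order[of T]]
  show "moment_order P T 0 (\<lambda>s t \<omega>. norm (W s \<omega>))"
    by (rule moment_order_dominated[OF moment_order_add[OF moment_order_const[OF prob, of _ "norm x0"] z(1)] _ le])
      (use W_measurable_P in simp_all)
  show "moment_order P T 0 (\<lambda>s t \<omega>. norm (W t \<omega>))"
    by (rule moment_order_dominated[OF moment_order_add[OF moment_order_const[OF prob, of _ "norm x0"] z(2)] _ le])
      (use W_measurable_P in simp_all)
qed

lemma growth_order: "moment_order P T 0 (\<lambda>s t \<omega>. (1 + norm (W s \<omega>) + norm (W t \<omega> - W s \<omega>)) ^ p)"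
proof -
  have "moment_order P T 0 (\<lambda>s t \<omega>. 1 + norm (W s \<omega>) + norm (W t \<omega> - W s \<omega>))"
    by (intro moment_order_add moment_order_const[OF prob] W_norm_order moment_order_mono[OF increment_norm_order]) simp
  from moment_order_power[OF prob this, of p] show ?thesis by simp
qed

lemma continuous_W_measurable:
  assumes "continuous_on UNIV (g :: 'v \<Rightarrow> real)" "0 \<le> s" "s \<le> t"
  shows "(\<lambda>\<omega>. g (W s \<omega>)) \<in> borel_measurable (F t)"
  using measurable_compose[OF W_measurable[OF assms(2,3)] borel_measurable_continuous_onI[OF assms(1)]] by simp

lemma continuous_W_continuous:
  assumes "continuous_on UNIV (g :: 'v \<Rightarrow> real)" "\<omega> \<in> space P"
  shows "continuous_on {0..} (\<lambda>t. g (W t \<omega>))"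
  by (rule continuous_on_compose2[OF assms(1) W_continuous[OF assms(2)]]) simp

lemma continuous_W_interval:
  assumes "continuous_on UNIV (g :: 'v \<Rightarrow> real)" "\<omega> \<in> space P" "0 \<le> s"
  shows "continuous_on {s..t} (\<lambda>u. g (W u \<omega>))"
  by (rule continuous_on_subset[OF continuous_W_continuous[OF assms(1,2)]]) (use assms(3) in auto)

lemma integrable_W_interval:
  assumes "continuous_on UNIV (g :: 'v \<Rightarrow> real)" "\<omega> \<in> space P" "0 \<le> s"
  shows "(\<lambda>u. g (W u \<omega>)) integrable_on {s..t}"
  by (rule integrable_continuous_real[OF continuous_W_interval[OF assms]])

lemma tame_order:
  assumes "tame k g"
  shows "moment_order P T 0 (\<lambda>s t \<omega>. g (W s \<omega>))" "moment_order P T 0 (\<lambda>s t \<omega>. g (W t \<omega>))"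
proof -
  obtain C p where C: "C \<ge> 0" "\<And>x. \<bar>g x\<bar> \<le> C * (1 + norm x) ^ p"
    by (rule poly_growthE[OF tame_poly_growth[OF assms]]) blast
  have m: "(\<lambda>\<omega>. g (W s \<omega>)) \<in> borel_measurable P" if "0 \<le> s" for s
    by (rule measurable_F[OF continuous_W_measurable[OF tame_continuous[OF assms] that order_refl]])
  have le: "AE \<omega> in P. \<bar>g (W s \<omega>)\<bar> \<le> \<bar>C * (1 + norm (W s \<omega>)) ^ p\<bar>" for s
    using C by (intro AE_I2) (auto intro: order_trans)
  have a: "moment_order P T 0 (\<lambda>s t \<omega>. C * (1 + norm (W s \<omega>)) ^ p)"
    using moment_order_power[OF prob moment_order_add[OF moment_order_const[OF prob, where c=1] W_norm_order(1)], of T p]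
    by (intro moment_order_cmult[OF prob]) simp
  have b: "moment_order P T 0 (\<lambda>s t \<omega>. C * (1 + norm (W t \<omega>)) ^ p)"
    using moment_order_power[OF prob moment_order_add[OF moment_order_const[OF prob, where c=1] W_norm_order(2)], of T p]
    by (intro moment_order_cmult[OF prob]) simp
  show "moment_order P T 0 (\<lambda>s t \<omega>. g (W s \<omega>))" by (rule moment_order_dominated[OF a m le])
  show "moment_order P T 0 (\<lambda>s t \<omega>. g (W t \<omega>))" by (rule moment_order_dominated[OF b m le]) auto
qed

lemma tame_admissible: "tame k g \<Longrightarrow> 0 \<le> s \<Longrightarrow> admissible s (\<lambda>\<omega>. g (W s \<omega>))"
  using moment_order_all_moments[OF tame_order(1), of k g s "s + 1" "s + 1"]
    continuous_W_measurable[OF tame_continuous] by (auto simp: admissible_def)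

text \<open>
  Each factor \<open>|W t - W s|\<close> of the remainder contributes one order, and the polynomial factor contributes none.
\<close>

lemma tame_taylor_order:
  assumes "tame m g" "m > 0"
  shows "moment_order P T m (\<lambda>s t \<omega>. g (W t \<omega>) - (\<Sum>j<m. (ddir (W t \<omega> - W s \<omega>) ^^ j) g (W s \<omega>) / fact j))"
    (is "moment_order P T m (\<lambda>s t \<omega>. ?R s t \<omega>)")
proof -
  obtain C p where C: "C \<ge> 0"
    "\<And>x h. \<bar>g (x + h) - (\<Sum>j<m. (ddir h ^^ j) g x / fact j)\<bar> \<le> C * ((1 + norm x + norm h) ^ p * norm h ^ m)"
    using tame_taylor[OF assms] by blast
  have dom: "moment_order P T m (\<lambda>s t \<omega>. C * ((1 + norm (W s \<omega>) + norm (W t \<omega> - W s \<omega>)) ^ p * norm (W t \<omega> - W s \<omega>) ^ m))"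
    using moment_order_mult[OF growth_order[of T p] moment_order_power[OF prob increment_norm_order, of T m]]
    by (intro moment_order_cmult[OF prob]) simp
  show ?thesis
  proof (rule moment_order_dominated[OF dom])
    fix s t :: real assume st: "0 \<le> s" "s < t"
    show "AE \<omega> in P. \<bar>?R s t \<omega>\<bar> \<le> \<bar>C * ((1 + norm (W s \<omega>) + norm (W t \<omega> - W s \<omega>)) ^ p * norm (W t \<omega> - W s \<omega>) ^ m)\<bar>"
    proof (intro AE_I2)
      fix \<omega>
      show "\<bar>?R s t \<omega>\<bar> \<le> \<bar>C * ((1 + norm (W s \<omega>) + norm (W t \<omega> - W s \<omega>)) ^ p * norm (W t \<omega> - W s \<omega>) ^ m)\<bar>"
        using C(2)[of "W s \<omega>" "W t \<omega> - W s \<omega>"] by simp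
    qed
    have Wm: "W s \<in> borel_measurable P" "W t \<in> borel_measurable P" using st by (auto intro: W_measurable_P)
    have gm: "(\<lambda>\<omega>. f (W s \<omega>)) \<in> borel_measurable P" "(\<lambda>\<omega>. f (W t \<omega>)) \<in> borel_measurable P" if "tame k f" for k f
      using measurable_F[OF continuous_W_measurable[OF tame_continuous[OF that], of s s]]
        measurable_F[OF continuous_W_measurable[OF tame_continuous[OF that], of t t]] st by auto
    have "(\<lambda>\<omega>. (ddir (W t \<omega> - W s \<omega>) ^^ j) f (W s \<omega>)) \<in> borel_measurable P" if "tame j f" for j f
      using that
    proof (induction j arbitrary: f)
      case 0
      then show ?case using gm(1)[of 0 f] by simp
    next
      case (Suc j)
      show ?case
        unfolding ddir_power_Suc_eq[OF Suc.prems]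
        by (intro borel_measurable_sum borel_measurable_times borel_measurable_inner borel_measurable_diff Wm
            borel_measurable_const Suc.IH tame_pd[OF Suc.prems])
    qed
    then show "?R s t \<in> borel_measurable P"
      by (intro borel_measurable_diff borel_measurable_sum borel_measurable_divide borel_measurable_const
          gm[OF assms(1)]) (use tame_mono[OF assms(1)] in auto)
  qed
qed

lemma tame_increment_order:
  assumes "tame 1 g" shows "moment_order P T 1 (\<lambda>s t \<omega>. g (W t \<omega>) - g (W s \<omega>))"
  using tame_taylor_order[OF assms, of T] by simp

definition time_integral :: "('v \<Rightarrow> real) \<Rightarrow> real \<Rightarrow> 'a \<Rightarrow> real" where
  "time_integral g t \<omega> = integral {0..t} (\<lambda>u. g (W u \<omega>))"

lemma time_integral_diff:
  assumes "continuous_on UNIV g" "\<omega> \<in> space P" "0 \<le> s" "s \<le> t"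
  shows "time_integral g t \<omega> - time_integral g s \<omega> = integral {s..t} (\<lambda>u. g (W u \<omega>))"
proof -
  have "integral {0..s} (\<lambda>u. g (W u \<omega>)) + integral {s..t} (\<lambda>u. g (W u \<omega>)) = integral {0..t} (\<lambda>u. g (W u \<omega>))"
    by (rule Henstock_Kurzweil_Integration.integral_combine[OF assms(3,4) integrable_W_interval[OF assms(1,2)]]) simp
  then show ?thesis by (simp add: time_integral_def)
qed

lemma time_integral_has_integral:
  assumes "continuous_on UNIV g" "\<omega> \<in> space P"
  shows "((\<lambda>u. g (W u \<omega>)) has_integral time_integral g t \<omega>) {0..t}"
  unfolding time_integral_def by (intro integrable_integral integrable_W_interval[OF assms]) simp

lemma time_integral_continuous:
  assumes "continuous_on UNIV g" "\<omega> \<in> space P"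
  shows "continuous_on {0..} (\<lambda>t. time_integral g t \<omega>)"
proof -
  have c: "continuous_on {0..real n} (\<lambda>t. time_integral g t \<omega>)" for n
    unfolding time_integral_def by (intro indefinite_integral_continuous_1 integrable_W_interval[OF assms]) simp
  show ?thesis unfolding continuous_on_eq_continuous_within
  proof
    fix t :: real assume t: "t \<in> {0..}"
    obtain n where n: "t < real n" using reals_Archimedean2 by blast
    have "continuous (at t within {0..real n}) (\<lambda>t. time_integral g t \<omega>)"
      using c[of n] t n by (auto simp: continuous_on_eq_continuous_within)
    moreover have "at t within {0..} = at t within {0..real n}"
      by (rule at_within_nhd[of _ "{..<real n}"]) (use t n in auto)
    ultimately show "continuous (at t within {0..}) (\<lambda>t. time_integral g t \<omega>)" by simp
  qed
qed

lemma time_integral_measurable: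
  assumes "continuous_on UNIV g" "0 \<le> t"
  shows "time_integral g t \<in> borel_measurable (F t)"
proof (rule borel_measurable_LIMSEQ_real)
  fix \<omega> assume "\<omega> \<in> space (F t)"
  then have "continuous_on {0..t} (\<lambda>u. g (W u \<omega>))"
    by (intro continuous_W_interval[OF assms(1)]) (auto simp: space_F)
  from riemann_sum_tendsto[OF assms(2) this]
  show "(\<lambda>n. \<Sum>k<Suc n. (t - 0) / Suc n * g (W (0 + real (Suc k) * ((t - 0) / Suc n)) \<omega>)) \<longlonglongrightarrow> time_integral g t \<omega>"
    unfolding time_integral_def .
next
  fix n
  have "real (Suc k) * ((t - 0) / Suc n) \<le> t" if "k < Suc n" for k
  proof -
    have "real (Suc k) * ((t - 0) / Suc n) \<le> real (Suc n) * ((t - 0) / Suc n)"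
      using that assms(2) by (intro mult_right_mono) auto
    then show ?thesis by simp
  qed
  then show "(\<lambda>\<omega>. \<Sum>k<Suc n. (t - 0) / Suc n * g (W (0 + real (Suc k) * ((t - 0) / Suc n)) \<omega>)) \<in> borel_measurable (F t)"
    using assms(2)
    by (intro borel_measurable_sum borel_measurable_times borel_measurable_const continuous_W_measurable[OF assms(1)]) auto
qed

lemma time_integral_order:
  assumes "tame k g" shows "moment_order P T 2 (\<lambda>s t \<omega>. time_integral g t \<omega> - time_integral g s \<omega>)"
proof (rule moment_order_cong)
  show "moment_order P T 2 (\<lambda>s t \<omega>. integral {s..t} (\<lambda>u. g (W u \<omega>)))"
  proof -
    have "continuous_on {s..} (\<lambda>u. g (W u \<omega>))" if "0 \<le> s" "\<omega> \<in> space P" for s \<omega>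
      by (rule continuous_on_subset[OF continuous_W_continuous[OF tame_continuous[OF assms] that(2)]]) (use that(1) in auto)
    from moment_order_integral[OF tame_order(2)[OF assms, of T] this] show ?thesis
      by (rule moment_order_mono) simp_all
  qed
qed (rule time_integral_diff[OF tame_continuous[OF assms]], auto)

text \<open>
  Freezing the integrand at the left end point costs an error of order \<open>1\<close> in the integrand, hence of order \<open>3\<close> in
  the integral.
\<close>

lemma time_integral_first_order:
  assumes "tame 1 g" shows "moment_order P T 3 (\<lambda>s t \<omega>. time_integral g t \<omega> - time_integral g s \<omega> - (t - s) * g (W s \<omega>))"
proof (rule moment_order_cong)
  have cont: "continuous_on {s..} (\<lambda>u. g (W u \<omega>) - g (W s \<omega>))" if "0 \<le> s" "\<omega> \<in> space P" for s \<omega>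
    using continuous_on_subset[OF continuous_W_continuous[OF tame_continuous[OF assms] that(2)], of "{s..}"] that(1)
    by (intro continuous_intros) auto
  have "moment_order P T (1 + 2) (\<lambda>s t \<omega>. integral {s..t} (\<lambda>u. g (W u \<omega>) - g (W s \<omega>)))"
    by (rule moment_order_integral[OF tame_increment_order[OF assms, of T] cont])
  then show "moment_order P T 3 (\<lambda>s t \<omega>. integral {s..t} (\<lambda>u. g (W u \<omega>) - g (W s \<omega>)))"
    by (rule moment_order_mono) simp
  fix s t :: real and \<omega> assume st: "0 \<le> s" "s < t" "\<omega> \<in> space P"
  have "(\<lambda>u. g (W u \<omega>)) integrable_on {s..t}"
    by (rule integrable_W_interval[OF tame_continuous[OF assms] st(3,1)])
  then have "integral {s..t} (\<lambda>u. g (W u \<omega>) - g (W s \<omega>)) = integral {s..t} (\<lambda>u. g (W u \<omega>)) - (t - s) * g (W s \<omega>)"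
    using st by (subst integral_diff) auto
  then show "time_integral g t \<omega> - time_integral g s \<omega> - (t - s) * g (W s \<omega>) = integral {s..t} (\<lambda>u. g (W u \<omega>) - g (W s \<omega>))"
    using time_integral_diff[OF tame_continuous[OF assms] st(3,1)] st(2) by simp
qed

text \<open>
  The martingale property in weak form: increments are orthogonal to all test variables known at their start.
\<close>

definition mean_zero_increments :: "(real \<Rightarrow> 'a \<Rightarrow> real) \<Rightarrow> bool" where
  "mean_zero_increments Z \<longleftrightarrow> (\<forall>s t Y. 0 \<le> s \<longrightarrow> s < t \<longrightarrow> admissible s Y \<longrightarrow> (\<integral>\<omega>. Y \<omega> * (Z t \<omega> - Z s \<omega>) \<partial>P) = 0)"

text \<open>
  Sewing: if the increments are conditionally centred up to an error of order \<open>3\<close>, they are exactly centred.  For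
  fixed \<open>Y\<close> the function \<open>u \<mapsto> E[Y Z(u)]\<close> has increments of order \<open>(v - u)\<^sup>3\<^sup>/\<^sup>2\<close> and is therefore constant.
\<close>

lemma mean_zero_incrementsI:
  assumes Z: "\<And>t. 0 \<le> t \<Longrightarrow> all_moments P (Z t)"
    and eq: "\<And>s t \<omega>. 0 \<le> s \<Longrightarrow> s < t \<Longrightarrow> \<omega> \<in> space P \<Longrightarrow> Z t \<omega> - Z s \<omega> = A s t \<omega> + R s t \<omega>"
    and A: "\<And>s t. 0 \<le> s \<Longrightarrow> s < t \<Longrightarrow> all_moments P (A s t)"
    and A0: "\<And>s t Y. 0 \<le> s \<Longrightarrow> s < t \<Longrightarrow> admissible s Y \<Longrightarrow> (\<integral>\<omega>. Y \<omega> * A s t \<omega> \<partial>P) = 0"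
    and R: "\<And>T. moment_order P T 3 R"
  shows "mean_zero_increments Z"
  unfolding mean_zero_increments_def
proof (intro allI impI)
  fix s t Y assume st: "0 \<le> s" "s < t" and Y: "admissible s Y"
  have Ym: "all_moments P Y" using Y by (simp add: admissible_def)
  have YR: "moment_order P t 3 (\<lambda>u v \<omega>. Y \<omega> * R u v \<omega>)"
    using moment_order_mult[OF all_moments_moment_order[OF Ym] R[of t]] by simp
  obtain C where C: "\<And>u v. 0 \<le> u \<Longrightarrow> u < v \<Longrightarrow> v \<le> t \<Longrightarrow> moment_le P 1 (C * sqrt (v - u) ^ (3 * 1)) (\<lambda>\<omega>. Y \<omega> * R u v \<omega>)"
    by (rule moment_orderE[OF YR, of 1]) blast
  have "(\<integral>\<omega>. Y \<omega> * Z t \<omega> \<partial>P) = (\<integral>\<omega>. Y \<omega> * Z s \<omega> \<partial>P)"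
  proof (rule constant_of_small_increments[OF st(2)])
    fix u v assume uv: "s \<le> u" "u < v" "v \<le> t"
    have u0: "0 \<le> u" "0 \<le> v" using st uv by auto
    have Yu: "admissible u Y" by (rule admissible_mono[OF Y uv(1)])
    have Rm: "all_moments P (R u v)" by (rule moment_order_all_moments[OF R[of t] u0(1) uv(2,3)])
    have "(\<integral>\<omega>. Y \<omega> * Z v \<omega> \<partial>P) - (\<integral>\<omega>. Y \<omega> * Z u \<omega> \<partial>P) = (\<integral>\<omega>. Y \<omega> * Z v \<omega> - Y \<omega> * Z u \<omega> \<partial>P)"
      by (intro Bochner_Integration.integral_diff[symmetric] all_moments_integrable all_moments_mult Ym Z u0)
    also have "\<dots> = (\<integral>\<omega>. Y \<omega> * A u v \<omega> + Y \<omega> * R u v \<omega> \<partial>P)"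
      using eq[OF u0(1) uv(2)] by (intro Bochner_Integration.integral_cong refl) (simp add: distrib_left[symmetric] right_diff_distrib[symmetric])
    also have "\<dots> = (\<integral>\<omega>. Y \<omega> * A u v \<omega> \<partial>P) + (\<integral>\<omega>. Y \<omega> * R u v \<omega> \<partial>P)"
      by (intro Bochner_Integration.integral_add all_moments_integrable all_moments_mult Ym A Rm u0 uv)
    also have "\<dots> = (\<integral>\<omega>. Y \<omega> * R u v \<omega> \<partial>P)" using A0[OF u0(1) uv(2) Yu] by simp
    finally have "\<bar>(\<integral>\<omega>. Y \<omega> * Z v \<omega> \<partial>P) - (\<integral>\<omega>. Y \<omega> * Z u \<omega> \<partial>P)\<bar> \<le> (\<integral>\<omega>. \<bar>Y \<omega> * R u v \<omega>\<bar> \<partial>P)"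
      by (simp only: integral_abs_bound)
    also have "\<dots> \<le> C * sqrt (v - u) ^ 3" using moment_le_integral[OF C[OF u0(1) uv(2,3)]] by simp
    finally show "\<bar>(\<integral>\<omega>. Y \<omega> * Z v \<omega> \<partial>P) - (\<integral>\<omega>. Y \<omega> * Z u \<omega> \<partial>P)\<bar> \<le> C * sqrt (v - u) ^ 3" .
  qed
  moreover have "(\<integral>\<omega>. Y \<omega> * (Z t \<omega> - Z s \<omega>) \<partial>P) = (\<integral>\<omega>. Y \<omega> * Z t \<omega> \<partial>P) - (\<integral>\<omega>. Y \<omega> * Z s \<omega> \<partial>P)"
    unfolding right_diff_distrib using st
    by (intro Bochner_Integration.integral_diff all_moments_integrable all_moments_mult Ym Z) auto
  ultimately show "(\<integral>\<omega>. Y \<omega> * (Z t \<omega> - Z s \<omega>) \<partial>P) = 0" by simp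
qed

text \<open>
  The generator of the process, since \<open>d\<langle>W\<^sub>b, W\<^sub>c\<rangle> = \<sigma>\<^sup>2 \<delta>\<^sub>b\<^sub>c dt\<close>.
\<close>

definition generator :: "('v \<Rightarrow> real) \<Rightarrow> 'v \<Rightarrow> real" where
  "generator f x = \<sigma>\<^sup>2 / 2 * laplace f x"

text \<open>
  The martingale part of \<open>f(W)\<close>.  As a pathwise expression it is adapted and continuous for every sample point, which
  a limit in probability would be only after completing the filtration.
\<close>

definition compensated :: "('v \<Rightarrow> real) \<Rightarrow> real \<Rightarrow> 'a \<Rightarrow> real" where
  "compensated f t \<omega> = f (W t \<omega>) - f (W 0 \<omega>) - time_integral (generator f) t \<omega>"

text \<open>
  The inner product of \<open>\<nabla>f(W s)\<close> with the increment of \<open>W\<close>, the main term of the increment of the martingale part.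
\<close>

definition gradient_term :: "('v \<Rightarrow> real) \<Rightarrow> real \<Rightarrow> real \<Rightarrow> 'a \<Rightarrow> real" where
  "gradient_term f s t \<omega> = (\<Sum>b\<in>Basis. dW b s t \<omega> * pd b f (W s \<omega>))"

text \<open>
  A quadratic form in the increments, minus its conditional expectation given the past.
\<close>

definition centered_quadratic :: "('v \<Rightarrow> 'v \<Rightarrow> 'v \<Rightarrow> real) \<Rightarrow> real \<Rightarrow> real \<Rightarrow> 'a \<Rightarrow> real" where
  "centered_quadratic a s t \<omega> = (\<Sum>b\<in>Basis. \<Sum>c\<in>Basis. (dW b s t \<omega> * dW c s t \<omega>) * a b c (W s \<omega>)) - \<sigma>\<^sup>2 * (t - s) * (\<Sum>b\<in>Basis. a b b (W s \<omega>))"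

lemma tame_generator: "tame (Suc (Suc k)) f \<Longrightarrow> tame k (generator f)"
  unfolding generator_def[abs_def] by (intro tame_cmult tame_laplace)

lemma gradient_term_order:
  assumes "tame (Suc k) f" shows "moment_order P T 1 (gradient_term f)"
proof -
  have "moment_order P T 1 (\<lambda>s t \<omega>. dW b s t \<omega> * pd b f (W s \<omega>))" if "b \<in> Basis" for b
    using moment_order_mult[OF dW_order[OF that] tame_order(1)[OF tame_pd[OF assms that]]] by simp
  then show ?thesis unfolding gradient_term_def[abs_def] by (intro moment_order_sum[OF prob]) auto
qed

lemma gradient_term_centered:
  assumes f: "tame (Suc k) f" and st: "0 \<le> s" "s < t" and Y: "admissible s Y"
  shows "(\<integral>\<omega>. Y \<omega> * gradient_term f s t \<omega> \<partial>P) = 0"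
proof -
  have a: "admissible s (\<lambda>\<omega>. Y \<omega> * pd b f (W s \<omega>))" if "b \<in> Basis" for b
    by (intro admissible_mult Y tame_admissible[OF tame_pd[OF f that]] st)
  have "(\<integral>\<omega>. Y \<omega> * gradient_term f s t \<omega> \<partial>P) = (\<integral>\<omega>. (\<Sum>b\<in>Basis. (Y \<omega> * pd b f (W s \<omega>)) * dW b s t \<omega>) \<partial>P)"
    by (simp add: gradient_term_def sum_distrib_left mult_ac)
  also have "\<dots> = (\<Sum>b\<in>Basis. \<integral>\<omega>. (Y \<omega> * pd b f (W s \<omega>)) * dW b s t \<omega> \<partial>P)"
    using a by (intro Bochner_Integration.integral_sum all_moments_integrable
        all_moments_mult[of P "\<lambda>\<omega>. Y \<omega> * pd _ f (W s \<omega>)"] dW_all_moments st) (auto simp: admissible_def)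
  also have "\<dots> = 0" using dW_centered[OF _ st a] by simp
  finally show ?thesis .
qed

lemma centered_quadratic_order:
  assumes "\<And>b c. b \<in> Basis \<Longrightarrow> c \<in> Basis \<Longrightarrow> tame k (a b c)"
  shows "moment_order P T 2 (centered_quadratic a)"
proof -
  have 1: "moment_order P T 2 (\<lambda>s t \<omega>. (dW b s t \<omega> * dW c s t \<omega>) * a b c (W s \<omega>))" if "b \<in> Basis" "c \<in> Basis" for b c
    using moment_order_mult[OF moment_order_mult[OF dW_order[OF that(1)] dW_order[OF that(2)]] tame_order(1)[OF assms[OF that]]]
    by (rule moment_order_mono) simp
  have "tame k (\<lambda>x. \<Sum>b\<in>Basis. a b b x)" by (intro tame_sum assms)
  from moment_order_mult[OF moment_order_time[OF prob] tame_order(1)[OF this]]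
  have 2: "moment_order P T 2 (\<lambda>s t \<omega>. (t - s) * (\<Sum>b\<in>Basis. a b b (W s \<omega>)))" by simp
  show ?thesis unfolding centered_quadratic_def[abs_def]
    using moment_order_cmult[OF prob 2, of "\<sigma>\<^sup>2"] by (intro moment_order_diff[OF prob] moment_order_sum[OF prob] 1) (auto simp: mult.assoc)
qed

text \<open>
  This is where the conditional covariance matrix \<open>\<sigma>\<^sup>2 (t - s) \<delta>\<^sub>b\<^sub>c\<close> of the increments enters.
\<close>

lemma centered_quadratic_centered:
  assumes a: "\<And>b c. b \<in> Basis \<Longrightarrow> c \<in> Basis \<Longrightarrow> tame k (a b c)" and st: "0 \<le> s" "s < t" and Y: "admissible s Y"
  shows "(\<integral>\<omega>. Y \<omega> * centered_quadratic a s t \<omega> \<partial>P) = 0"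
proof -
  define G where "G b c \<omega> = Y \<omega> * a b c (W s \<omega>)" for b c \<omega>
  have G: "admissible s (G b c)" if "b \<in> Basis" "c \<in> Basis" for b c
    unfolding G_def[abs_def] by (intro admissible_mult Y tame_admissible[OF a[OF that]] st)
  have Gm: "all_moments P (G b c)" if "b \<in> Basis" "c \<in> Basis" for b c using G[OF that] by (simp add: admissible_def)
  have i1: "integrable P (\<lambda>\<omega>. G b c \<omega> * (dW b s t \<omega> * dW c s t \<omega>))" if "b \<in> Basis" "c \<in> Basis" for b c
    by (intro all_moments_integrable all_moments_mult dW_all_moments st Gm that)
  have i2: "integrable P (G b b)" if "b \<in> Basis" for b by (intro all_moments_integrable Gm that)
  have v: "(\<integral>\<omega>. G b c \<omega> * (dW b s t \<omega> * dW c s t \<omega>) \<partial>P) = (if c = b then \<sigma>\<^sup>2 * (t - s) * (\<integral>\<omega>. G b b \<omega> \<partial>P) else 0)"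
    if "b \<in> Basis" "c \<in> Basis" for b c
    using dW_conditional_covariance_zero[OF that _ st G[OF that]] dW_conditional_variance[OF that(1) st G[OF that(1) that(1)]]
    by (auto simp: power2_eq_square)
  have "(\<integral>\<omega>. Y \<omega> * centered_quadratic a s t \<omega> \<partial>P)
      = (\<integral>\<omega>. (\<Sum>b\<in>Basis. \<Sum>c\<in>Basis. G b c \<omega> * (dW b s t \<omega> * dW c s t \<omega>)) - \<sigma>\<^sup>2 * (t - s) * (\<Sum>b\<in>Basis. G b b \<omega>) \<partial>P)"
    by (simp add: centered_quadratic_def G_def right_diff_distrib sum_distrib_left mult_ac)
  also have "\<dots> = (\<Sum>b\<in>Basis. \<Sum>c\<in>Basis. \<integral>\<omega>. G b c \<omega> * (dW b s t \<omega> * dW c s t \<omega>) \<partial>P)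
      - \<sigma>\<^sup>2 * (t - s) * (\<Sum>b\<in>Basis. \<integral>\<omega>. G b b \<omega> \<partial>P)"
    using i1 i2 by (simp add: Bochner_Integration.integral_sum Bochner_Integration.integrable_sum)
  also have "(\<Sum>b\<in>Basis. \<Sum>c\<in>Basis. \<integral>\<omega>. G b c \<omega> * (dW b s t \<omega> * dW c s t \<omega>) \<partial>P)
      = (\<Sum>b\<in>Basis. \<sigma>\<^sup>2 * (t - s) * (\<integral>\<omega>. G b b \<omega> \<partial>P))"
    by (intro sum.cong refl) (simp add: v)
  finally show ?thesis by (simp add: sum_distrib_left)
qed

text \<open>
  The factor \<open>1 / 2\<close> of Taylor's formula is included, so that the diagonal sums up to the generator divided
  by \<open>\<sigma>\<^sup>2\<close>.
\<close>

definition half_hessian :: "('v \<Rightarrow> real) \<Rightarrow> 'v \<Rightarrow> 'v \<Rightarrow> 'v \<Rightarrow> real" where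
  "half_hessian f b c x = pd c (pd b f) x / 2"

lemma tame_half_hessian: "tame (Suc (Suc k)) f \<Longrightarrow> b \<in> Basis \<Longrightarrow> c \<in> Basis \<Longrightarrow> tame k (half_hessian f b c)"
  unfolding half_hessian_def[abs_def] using tame_cmult[of k "pd c (pd b f)" "1/2"] by simp

text \<open>
  Ito's formula over a short interval: Taylor's formula to third order for \<open>f(W t) - f(W s)\<close>, combined with the
  time integral frozen at \<open>s\<close>, whose value is the conditional mean of the second-order term.
\<close>

lemma compensated_second_order:
  assumes f: "tame 3 f"
  shows "moment_order P T 3 (\<lambda>s t \<omega>. compensated f t \<omega> - compensated f s \<omega> - (gradient_term f s t \<omega> + centered_quadratic (half_hessian f) s t \<omega>))"
proof (rule moment_order_cong)
  have f': "tame (Suc (Suc (Suc 0))) f" using f by (simp only: numeral_3_eq_3)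
  have g: "tame 1 (generator f)" using tame_generator[of 1 f] f' by (simp only: One_nat_def)
  show "moment_order P T 3 (\<lambda>s t \<omega>.
      (f (W t \<omega>) - (\<Sum>j<3. (ddir (W t \<omega> - W s \<omega>) ^^ j) f (W s \<omega>) / fact j))
      - (time_integral (generator f) t \<omega> - time_integral (generator f) s \<omega> - (t - s) * generator f (W s \<omega>)))"
    by (intro moment_order_diff[OF prob] tame_taylor_order[OF f] time_integral_first_order[OF g]) simp
  fix s t :: real and \<omega>
  let ?h = "W t \<omega> - W s \<omega>"
  have t1: "tame (Suc 0) f" "tame (Suc (Suc 0)) f" by (rule tame_mono[OF f], simp)+
  have 1: "ddir ?h f (W s \<omega>) = gradient_term f s t \<omega>" by (simp add: ddir_def gradient_term_def dW_def)
  have "(ddir ?h ^^ Suc (Suc 0)) f (W s \<omega>) = (\<Sum>b\<in>Basis. dW b s t \<omega> * (\<Sum>c\<in>Basis. dW c s t \<omega> * pd c (pd b f) (W s \<omega>)))"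
    unfolding ddir_power_Suc_eq[OF t1(2)] by (simp add: ddir_def dW_def)
  then have 2: "(ddir ?h ^^ 2) f (W s \<omega>) / 2 = (\<Sum>b\<in>Basis. \<Sum>c\<in>Basis. (dW b s t \<omega> * dW c s t \<omega>) * half_hessian f b c (W s \<omega>))"
    by (simp add: numeral_2_eq_2 half_hessian_def sum_distrib_left sum_divide_distrib mult.assoc)
  have 3: "(t - s) * generator f (W s \<omega>) = \<sigma>\<^sup>2 * (t - s) * (\<Sum>b\<in>Basis. half_hessian f b b (W s \<omega>))"
    by (simp add: generator_def laplace_def half_hessian_def sum_divide_distrib[symmetric])
  have "(\<Sum>j<3. (ddir ?h ^^ j) f (W s \<omega>) / fact j) = f (W s \<omega>) + ddir ?h f (W s \<omega>) + (ddir ?h ^^ 2) f (W s \<omega>) / 2"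
    by (simp add: numeral_3_eq_3 numeral_2_eq_2)
  then show "compensated f t \<omega> - compensated f s \<omega> - (gradient_term f s t \<omega> + centered_quadratic (half_hessian f) s t \<omega>) =
      (f (W t \<omega>) - (\<Sum>j<3. (ddir (W t \<omega> - W s \<omega>) ^^ j) f (W s \<omega>) / fact j))
      - (time_integral (generator f) t \<omega> - time_integral (generator f) s \<omega> - (t - s) * generator f (W s \<omega>))"
    unfolding centered_quadratic_def compensated_def by (simp only: 1 2 3)
qed

lemma compensated_first_order:
  assumes f: "tame 3 f"
  shows "moment_order P T 2 (\<lambda>s t \<omega>. compensated f t \<omega> - compensated f s \<omega> - gradient_term f s t \<omega>)"
proof -
  have f': "tame (Suc (Suc 1)) f" using f by (simp add: numeral_3_eq_3)
  have "moment_order P T 2 (\<lambda>s t \<omega>. (compensated f t \<omega> - compensated f s \<omega> - (gradient_term f s t \<omega> + centered_quadratic (half_hessian f) s t \<omega>)) + centered_quadratic (half_hessian f) s t \<omega>)"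
    by (intro moment_order_add moment_order_mono[OF compensated_second_order[OF f]] centered_quadratic_order[of 1] tame_half_hessian[OF f']) auto
  then show ?thesis by (simp only: diff_add_eq_diff_diff_swap add.commute[of "gradient_term f _ _ _"] diff_add_cancel)
qed

lemma compensated_zero: "\<omega> \<in> space P \<Longrightarrow> compensated f 0 \<omega> = 0"
  by (simp add: compensated_def time_integral_def)

lemma compensated_increment_order:
  assumes f: "tame 3 f" shows "moment_order P T 1 (\<lambda>s t \<omega>. compensated f t \<omega> - compensated f s \<omega>)"
proof -
  have f': "tame (Suc 2) f" using f by (simp add: numeral_3_eq_3)
  have "moment_order P T 1 (\<lambda>s t \<omega>. (compensated f t \<omega> - compensated f s \<omega> - gradient_term f s t \<omega>) + gradient_term f s t \<omega>)"
    by (intro moment_order_add moment_order_mono[OF compensated_first_order[OF f]] gradient_term_order[OF f']) auto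
  then show ?thesis by simp
qed

lemma compensated_adapted_continuous:
  assumes f: "tame 3 f" shows "adapted_continuous P F (compensated f)"
proof -
  have f': "tame (Suc (Suc 1)) f" using f by (simp add: numeral_3_eq_3)
  note g = tame_continuous[OF tame_generator[OF f']] and fc = tame_continuous[OF f]
  show ?thesis unfolding adapted_continuous_def compensated_def
    by (auto intro!: borel_measurable_diff continuous_W_measurable[OF fc] time_integral_measurable[OF g]
        continuous_on_diff continuous_on_const continuous_W_continuous[OF fc] time_integral_continuous[OF g])
qed

lemma compensated_admissible:
  assumes f: "tame 3 f" "0 \<le> t" shows "admissible t (compensated f t)"
proof -
  have "moment_order P (t + 1) 0 (\<lambda>s t \<omega>. compensated f s \<omega> - compensated f 0 \<omega>)"
    by (rule moment_order_from_zero[OF prob compensated_increment_order[OF f(1)]]) simp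
  then have "all_moments P (\<lambda>\<omega>. compensated f t \<omega> - compensated f 0 \<omega>)"
    using moment_order_all_moments[of P "t + 1" 0 _ t "t + 1"] f(2) by simp
  moreover have "moment_order P 1 0 (\<lambda>s u. compensated f t)"
    by (rule moment_order_cong[OF calculation[unfolded all_moments_iff_moment_order]]) (simp add: compensated_zero)
  ultimately show ?thesis using compensated_adapted_continuous[OF f(1)] f(2)
    by (simp add: admissible_def all_moments_iff_moment_order adapted_continuous_def)
qed

lemma compensated_mean_zero:
  assumes f: "tame 3 f" shows "mean_zero_increments (compensated f)"
proof -
  have f': "tame (Suc 2) f" "tame (Suc (Suc 1)) f" using f by (simp_all add: numeral_3_eq_3 numeral_2_eq_2)
  have q: "moment_order P T 2 (centered_quadratic (half_hessian f))" for T by (rule centered_quadratic_order[of 1]) (rule tame_half_hessian[OF f'(2)])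
  show ?thesis
  proof (rule mean_zero_incrementsI[where A = "\<lambda>s t \<omega>. gradient_term f s t \<omega> + centered_quadratic (half_hessian f) s t \<omega>" and
        R = "\<lambda>s t \<omega>. compensated f t \<omega> - compensated f s \<omega> - (gradient_term f s t \<omega> + centered_quadratic (half_hessian f) s t \<omega>)"])
    show "all_moments P (compensated f t)" if "0 \<le> t" for t using compensated_admissible[OF f that] by (simp add: admissible_def)
    fix s t :: real assume st: "0 \<le> s" "s < t"
    have l: "all_moments P (gradient_term f s t)" "all_moments P (centered_quadratic (half_hessian f) s t)"
      using moment_order_all_moments[OF gradient_term_order[OF f'(1)] st order_refl] moment_order_all_moments[OF q st order_refl] by auto
    then show "all_moments P (\<lambda>\<omega>. gradient_term f s t \<omega> + centered_quadratic (half_hessian f) s t \<omega>)" by (rule all_moments_add)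
    fix Y assume Y: "admissible s Y"
    then have Ym: "all_moments P Y" by (simp add: admissible_def)
    have "(\<integral>\<omega>. Y \<omega> * (gradient_term f s t \<omega> + centered_quadratic (half_hessian f) s t \<omega>) \<partial>P) = (\<integral>\<omega>. Y \<omega> * gradient_term f s t \<omega> \<partial>P) + (\<integral>\<omega>. Y \<omega> * centered_quadratic (half_hessian f) s t \<omega> \<partial>P)"
      unfolding distrib_left by (intro Bochner_Integration.integral_add all_moments_integrable all_moments_mult Ym l)
    also have "\<dots> = 0" using gradient_term_centered[OF f'(1) st Y] centered_quadratic_centered[OF tame_half_hessian[OF f'(2)] st Y] by simp
    finally show "(\<integral>\<omega>. Y \<omega> * (gradient_term f s t \<omega> + centered_quadratic (half_hessian f) s t \<omega>) \<partial>P) = 0" .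
  qed (use compensated_second_order[OF f] in auto)
qed

end

section \<open>Martingales, quadratic variation and Ito integrals\<close>

text \<open>
  The left-point discretization of a continuous process converges uniformly on compacts, for every path, by uniform
  continuity.  To obtain measurable exceptional sets, the modulus of continuity is tested at countably many rational
  times; a general time in a cell is then approximated by rational ones in the same cell.
\<close>

lemma ucp_tendsto_left_grid:
  fixes H :: "real \<Rightarrow> 'a \<Rightarrow> 'h::euclidean_space"
  assumes P: "prob_space P" and meas: "\<And>t. 0 \<le> t \<Longrightarrow> H t \<in> borel_measurable P"
    and cont: "\<And>\<omega>. \<omega> \<in> space P \<Longrightarrow> continuous_on {0..} (\<lambda>t. H t \<omega>)"
  shows "ucp_tendsto P (\<lambda>n. simple_value (Suc n * Suc n) (\<lambda>k. real k / real (Suc n)) (\<lambda>k. H (real k / real (Suc n)))) H"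
  unfolding ucp_tendsto_def
proof (intro allI impI)
  interpret prob_space P by (rule P)
  fix t \<epsilon> \<delta> :: real assume pos: "t > 0" "\<epsilon> > 0" "\<delta> > 0"
  define Q where "Q n = {(u, v). u \<in> \<rat> \<and> v \<in> \<rat> \<and> u \<in> {0..t} \<and> v \<in> {0..t} \<and> \<bar>u - v\<bar> \<le> 1 / real (Suc n)}" for n
  \<comment> \<open>The exceptional events: they decrease to the empty set, since each path is uniformly continuous on \<open>[0, t]\<close>.\<close>
  define B where "B n = (\<Union>(u, v)\<in>Q n. {\<omega>\<in>space P. norm (H u \<omega> - H v \<omega>) > \<epsilon> / 2})" for n
  have Q_count: "countable (Q n)" for n
    by (rule countable_subset[of _ "\<rat> \<times> \<rat>"]) (auto simp: Q_def countable_rat)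
  have B_sets: "B n \<in> sets P" for n
    unfolding B_def
  proof (intro sets.countable_UN''[OF Q_count])
    fix uv assume uv: "uv \<in> Q n"
    have [measurable]: "H (fst uv) \<in> borel_measurable P" "H (snd uv) \<in> borel_measurable P"
      using uv meas by (auto simp: Q_def)
    have "{\<omega>\<in>space P. norm (H (fst uv) \<omega> - H (snd uv) \<omega>) > \<epsilon> / 2} \<in> sets P" by measurable
    then show "(case uv of (u, v) \<Rightarrow> {\<omega>\<in>space P. norm (H u \<omega> - H v \<omega>) > \<epsilon> / 2}) \<in> sets P"
      by (simp add: case_prod_beta)
  qed
  have "decseq B"
  proof (rule decseq_SucI)
    fix n
    have "1 / real (Suc (Suc n)) \<le> 1 / real (Suc n)" by (simp add: frac_le)
    then have "Q (Suc n) \<subseteq> Q n" unfolding Q_def by fastforce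
    then show "B (Suc n) \<subseteq> B n" unfolding B_def by blast
  qed
  moreover have "(\<Inter>n. B n) = {}"
  proof (rule ccontr)
    assume "(\<Inter>n. B n) \<noteq> {}"
    then obtain \<omega> where \<omega>: "\<And>n. \<omega> \<in> B n" by blast
    then have sp: "\<omega> \<in> space P" using \<omega>[of 0] by (auto simp: B_def)
    have "uniformly_continuous_on {0..t} (\<lambda>s. H s \<omega>)"
      by (intro compact_uniformly_continuous continuous_on_subset[OF cont[OF sp]]) auto
    then obtain d where d: "d > 0" "\<And>u v. u \<in> {0..t} \<Longrightarrow> v \<in> {0..t} \<Longrightarrow> dist v u < d \<Longrightarrow> dist (H v \<omega>) (H u \<omega>) < \<epsilon> / 2"
      unfolding uniformly_continuous_on_def using pos(2) by (metis half_gt_zero)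
    obtain n where n: "1 / real (Suc n) < d" using nat_approx_posE[OF d(1)] by auto
    obtain u v where uv: "(u, v) \<in> Q n" "norm (H u \<omega> - H v \<omega>) > \<epsilon> / 2" using \<omega>[of n] by (auto simp: B_def)
    have "dist (H u \<omega>) (H v \<omega>) < \<epsilon> / 2" using uv(1) n by (intro d(2)) (auto simp: Q_def dist_real_def)
    then show False using uv(2) by (simp add: dist_norm)
  qed
  ultimately have "(\<lambda>n. measure P (B n)) \<longlonglongrightarrow> 0"
    using finite_Lim_measure_decseq[of B] B_sets by auto
  then have small: "\<forall>\<^sub>F n in sequentially. measure P (B n) < \<delta>"
    using pos(3) by (rule order_tendstoD)
  obtain n0 :: nat where n0: "t < real n0" using reals_Archimedean2 by blast
  show "\<forall>\<^sub>F n in sequentially. \<exists>E\<in>sets P. measure P E < \<delta> \<and> (\<forall>\<omega>\<in>space P - E. \<forall>s\<in>{0<..t}.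
      norm (simple_value (Suc n * Suc n) (\<lambda>k. real k / real (Suc n)) (\<lambda>k. H (real k / real (Suc n))) s \<omega> - H s \<omega>) < \<epsilon>)"
    using small eventually_ge_at_top[of n0]
  proof eventually_elim
    fix n assume Bn: "measure P (B n) < \<delta>" and n: "n0 \<le> n"
    show "\<exists>E\<in>sets P. measure P E < \<delta> \<and> (\<forall>\<omega>\<in>space P - E. \<forall>s\<in>{0<..t}.
      norm (simple_value (Suc n * Suc n) (\<lambda>k. real k / real (Suc n)) (\<lambda>k. H (real k / real (Suc n))) s \<omega> - H s \<omega>) < \<epsilon>)"
    proof (intro bexI[of _ "B n"] conjI ballI Bn B_sets)
      fix \<omega> s assume \<omega>: "\<omega> \<in> space P - B n" and s: "s \<in> {0<..t}"
      define N where "N = real (Suc n)"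
      have N: "N > 0" "t < N" using n n0 by (auto simp: N_def)
      \<comment> \<open>The cell \<open>(k / N, (k + 1) / N]\<close> that contains \<open>s\<close>.\<close>
      define k where "k = nat (\<lceil>s * N\<rceil> - 1)"
      have sN: "s * N > 0" using s N by simp
      have k: "real k < s * N" "s * N \<le> real (Suc k)"
        using sN unfolding k_def by linarith+
      have "s * N < N * N" using s N by (intro mult_strict_right_mono) auto
      then have "real k < real (Suc n * Suc n)" using k(1) by (simp only: N_def of_nat_mult)
      then have km: "k < Suc n * Suc n" by (simp only: of_nat_less_iff)
      have ind: "indicator {real i / N<..real (Suc i) / N} s = (if i = k then 1 else 0 :: real)" for i
      proof -
        have "s \<in> {real i / N<..real (Suc i) / N} \<longleftrightarrow> real i < s * N \<and> s * N \<le> real (Suc i)"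
          using N(1) by (auto simp: divide_less_eq le_divide_eq)
        also have "\<dots> \<longleftrightarrow> i = k"
        proof
          assume i: "real i < s * N \<and> s * N \<le> real (Suc i)"
          then have "real i < real (Suc k)" "real k < real (Suc i)" using k by linarith+
          then show "i = k" by linarith
        qed (use k in auto)
        finally show ?thesis by (simp add: indicator_def)
      qed
      have sv: "simple_value (Suc n * Suc n) (\<lambda>k. real k / real (Suc n)) (\<lambda>k. H (real k / real (Suc n))) s \<omega> = H (real k / N) \<omega>"
        unfolding simple_value_def N_def[symmetric] ind using km
        by (simp add: if_distrib[of "\<lambda>c. c *\<^sub>R _"] cong: if_cong)
      have ks: "real k / N < s" "s \<le> real (Suc k) / N" using k N(1) by (auto simp: divide_less_eq le_divide_eq)
      have sp: "\<omega> \<in> space P" using \<omega> by simp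
      have "continuous (at s within {0..}) (\<lambda>t. H t \<omega>)"
        using cont[OF sp] s by (auto simp: continuous_on_eq_continuous_within)
      then obtain d where d: "d > 0" "\<And>u. u \<in> {0..} \<Longrightarrow> dist u s < d \<Longrightarrow> dist (H u \<omega>) (H s \<omega>) < \<epsilon> / 2"
        unfolding continuous_within_eps_delta using pos(2) by (metis half_gt_zero)
      have "max (real k / N) (s - d) < s" using ks d by simp
      then obtain r where r: "r \<in> \<rat>" "max (real k / N) (s - d) < r" "r < s"
        using Rats_dense_in_real by blast
      have k0: "0 \<le> real k / N" using N by simp
      have "real (Suc k) / N = real k / N + 1 / N" by (simp add: add_divide_distrib)
      then have "r - real k / N \<le> 1 / N" using r ks by linarith
      moreover have "real k / N \<in> \<rat>" by (simp add: N_def)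
      ultimately have "(real k / N, r) \<in> Q n"
        using r ks s k0 by (simp add: Q_def N_def[symmetric] del: of_nat_Suc)
      then have "norm (H (real k / N) \<omega> - H r \<omega>) \<le> \<epsilon> / 2" using \<omega> by (force simp: B_def)
      moreover have "dist (H r \<omega>) (H s \<omega>) < \<epsilon> / 2" using r k0 by (intro d(2)) (auto simp: dist_real_def)
      ultimately have "norm (H (real k / N) \<omega> - H s \<omega>) < \<epsilon>"
        using norm_triangle_ineq[of "H (real k / N) \<omega> - H r \<omega>" "H r \<omega> - H s \<omega>"] by (simp add: dist_norm)
      then show "norm (simple_value (Suc n * Suc n) (\<lambda>k. real k / real (Suc n)) (\<lambda>k. H (real k / real (Suc n))) s \<omega> - H s \<omega>) < \<epsilon>"
        unfolding sv .
    qed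
  qed
qed

context brownian_vector
begin

lemma mean_zero_incrementsD:
  "mean_zero_increments Z \<Longrightarrow> 0 \<le> s \<Longrightarrow> s < t \<Longrightarrow> admissible s Y \<Longrightarrow> (\<integral>\<omega>. Y \<omega> * (Z t \<omega> - Z s \<omega>) \<partial>P) = 0"
  unfolding mean_zero_increments_def by blast

text \<open>
  With all moments finite, the constant times \<open>n\<close> localize, and the defining property of conditional expectations is
  the weak martingale property tested with indicators.
\<close>

lemma continuous_local_martingaleI:
  assumes ac: "adapted_continuous P F Z" and admissible: "\<And>t. 0 \<le> t \<Longrightarrow> admissible t (Z t)" and mz: "mean_zero_increments Z"
  shows "continuous_local_martingale P F Z"
  unfolding continuous_local_martingale_def
proof (intro conjI ac exI[of _ "\<lambda>n \<omega>. real n"] allI)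
  fix n :: nat
  show "stopping_time F (\<lambda>\<omega>. real n)" by (simp add: stopping_time_def)
  show "\<forall>\<omega>\<in>space P. 0 \<le> real n" by simp
  have sub: "sigma_finite_subalgebra P (F s)" for s
    by (rule finite_measure_subalgebra_is_sigma_finite) (unfold_locales, rule subalg)
  let ?S = "\<lambda>t. min t (real n)"
  have adm0: "admissible t (\<lambda>\<omega>. Z (?S t) \<omega> - Z 0 \<omega>)" if "0 \<le> t" for t
  proof -
    have a: "admissible t (Z (?S t))" "admissible t (Z 0)" using that by (intro admissible_mono[OF admissible], auto)+
    then show ?thesis by (auto simp: admissible_def intro: borel_measurable_diff all_moments_diff[OF prob])
  qed
  show "martingale P F (\<lambda>t \<omega>. Z (min t (real n)) \<omega> - Z 0 \<omega>)"
    unfolding martingale_def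
  proof (intro conjI allI impI; (elim conjE)?)
    fix t :: real assume "0 \<le> t"
    from adm0[OF this] show "(\<lambda>\<omega>. Z (?S t) \<omega> - Z 0 \<omega>) \<in> borel_measurable (F t)" "integrable P (\<lambda>\<omega>. Z (?S t) \<omega> - Z 0 \<omega>)"
      by (auto simp: admissible_def intro: all_moments_integrable)
  next
    fix s t :: real assume st: "0 \<le> s" "s \<le> t"
    have i: "integrable P (\<lambda>\<omega>. Z (?S r) \<omega> - Z 0 \<omega>)" if "0 \<le> r" for r
      using adm0[OF that] by (auto simp: admissible_def intro: all_moments_integrable)
    show "AE \<omega> in P. real_cond_exp P (F s) (\<lambda>\<omega>. Z (?S t) \<omega> - Z 0 \<omega>) \<omega> = Z (?S s) \<omega> - Z 0 \<omega>"
    proof (rule sigma_finite_subalgebra.real_cond_exp_charact[OF sub])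
      fix A assume A: "A \<in> sets (F s)"
      have ind: "admissible s (indicator A)" by (rule admissible_indicator[OF A])
      have "(\<integral>\<omega>. indicator A \<omega> * (Z (?S t) \<omega> - Z (?S s) \<omega>) \<partial>P) = 0"
      proof (cases "s < real n \<and> s < t")
        case True
        then have "?S s = s" "s < ?S t" by auto
        then show ?thesis using mean_zero_incrementsD[OF mz st(1) _ ind, of "?S t"] by simp
      next
        case False
        then have "?S s = ?S t" using st by auto
        then show ?thesis by simp
      qed
      moreover have "(\<integral>\<omega>. indicator A \<omega> * (Z (?S t) \<omega> - Z 0 \<omega>) \<partial>P) - (\<integral>\<omega>. indicator A \<omega> * (Z (?S s) \<omega> - Z 0 \<omega>) \<partial>P)
          = (\<integral>\<omega>. indicator A \<omega> * (Z (?S t) \<omega> - Z (?S s) \<omega>) \<partial>P)"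
        using st ind adm0[of s] adm0[of t]
        by (subst Bochner_Integration.integral_diff[symmetric])
           (auto simp: admissible_def right_diff_distrib[symmetric] intro!: all_moments_integrable all_moments_mult)
      ultimately show "(LINT x:A|P. Z (?S t) x - Z 0 x) = (LINT x:A|P. Z (?S s) x - Z 0 x)"
        by (simp add: set_lebesgue_integral_def)
    qed (use st i adm0[of s] in \<open>auto simp: admissible_def\<close>)
  qed
next
  show "AE \<omega> in P. mono (\<lambda>n. real n) \<and> filterlim (\<lambda>n. real n) at_top sequentially"
    by (auto simp: mono_def filterlim_real_sequentially)
qed

lemma time_integral_admissible:
  assumes "tame k g" "0 \<le> t" shows "admissible t (time_integral g t)"
proof -
  have "moment_order P (t + 1) 0 (\<lambda>s u \<omega>. time_integral g s \<omega> - time_integral g 0 \<omega>)"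
    by (rule moment_order_from_zero[OF prob time_integral_order[OF assms(1)]]) simp
  then have "all_moments P (\<lambda>\<omega>. time_integral g t \<omega> - time_integral g 0 \<omega>)"
    using moment_order_all_moments[of P "t + 1" 0 _ t "t + 1"] assms(2) by simp
  moreover have "time_integral g 0 \<omega> = 0" for \<omega> by (simp add: time_integral_def)
  ultimately show ?thesis using time_integral_measurable[OF tame_continuous[OF assms(1)] assms(2)] by (simp add: admissible_def)
qed

text \<open>
  The density \<open>\<sigma>\<^sup>2 |\<nabla>f|\<^sup>2\<close> of the quadratic variation of the martingale part of \<open>f(W)\<close>.
\<close>

definition variation_density :: "('v \<Rightarrow> real) \<Rightarrow> 'v \<Rightarrow> real" where
  "variation_density f x = \<sigma>\<^sup>2 * (\<Sum>b\<in>Basis. pd b f x * pd b f x)"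

lemma tame_variation_density: "tame (Suc k) f \<Longrightarrow> tame k (variation_density f)"
  unfolding variation_density_def[abs_def] by (intro tame_cmult tame_sum tame_mult tame_pd) auto

text \<open>
  With \<open>Z\<close> for the martingale part, \<open>Z(t)\<^sup>2 - Z(s)\<^sup>2 = 2 Z(s) (Z(t) - Z(s)) + (Z(t) - Z(s))\<^sup>2\<close>.  The first summand is
  centred since \<open>Z\<close> is a martingale; in the second one, \<open>Z(t) - Z(s)\<close> may be replaced by its main term up to order
  \<open>3\<close>, and the square of the main term minus its conditional mean is a centred quadratic form.
\<close>

lemma compensated_square_mean_zero:
  assumes f: "tame 3 f"
  shows "mean_zero_increments (\<lambda>t \<omega>. (compensated f t \<omega>)\<^sup>2 - time_integral (variation_density f) t \<omega>)"
proof -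
  have f': "tame (Suc 2) f" using f by (simp add: numeral_3_eq_3)
  have g: "tame 2 (variation_density f)" by (rule tame_variation_density[OF f'])
  have g1: "tame 1 (variation_density f)" by (rule tame_mono[OF g]) simp
  let ?a = "\<lambda>b c x. pd b f x * pd c f x"
  let ?Z = "compensated f"
  have a: "tame 2 (?a b c)" if "b \<in> Basis" "c \<in> Basis" for b c
    by (intro tame_mult tame_pd[OF f'] that)
  have Zm: "all_moments P (?Z t)" if "0 \<le> t" for t using compensated_admissible[OF f that] by (simp add: admissible_def)
  let ?A = "\<lambda>s t \<omega>. 2 * ?Z s \<omega> * (?Z t \<omega> - ?Z s \<omega>) + centered_quadratic ?a s t \<omega>"
  let ?R = "\<lambda>s t \<omega>. (?Z t \<omega> - ?Z s \<omega> - gradient_term f s t \<omega>) * ((?Z t \<omega> - ?Z s \<omega>) + gradient_term f s t \<omega>)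
      - (time_integral (variation_density f) t \<omega> - time_integral (variation_density f) s \<omega> - (t - s) * variation_density f (W s \<omega>))"
  show ?thesis
  proof (rule mean_zero_incrementsI[where A = ?A and R = ?R])
    show "all_moments P (\<lambda>\<omega>. (?Z t \<omega>)\<^sup>2 - time_integral (variation_density f) t \<omega>)" if "0 \<le> t" for t
      using time_integral_admissible[OF g that] Zm[OF that] unfolding power2_eq_square admissible_def
      by (intro all_moments_diff[OF prob] all_moments_mult) auto
    fix s t :: real assume st: "0 \<le> s" "s < t"
    then have t0: "0 \<le> t" by simp
    have q: "all_moments P (centered_quadratic ?a s t)" by (rule moment_order_all_moments[OF centered_quadratic_order[OF a] st order_refl])
    have i: "all_moments P (\<lambda>\<omega>. 2 * ?Z s \<omega> * (?Z t \<omega> - ?Z s \<omega>))"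
      using all_moments_add[OF Zm[OF st(1)] Zm[OF st(1)]] unfolding mult_2
      by (intro all_moments_mult all_moments_diff[OF prob] Zm st t0)
    show "all_moments P (?A s t)" by (intro all_moments_add i q)
    {
      fix \<omega>
      have "centered_quadratic ?a s t \<omega> = gradient_term f s t \<omega> * gradient_term f s t \<omega> - (t - s) * variation_density f (W s \<omega>)"
        unfolding centered_quadratic_def gradient_term_def sum_product variation_density_def by (simp add: mult_ac)
      then show "((?Z t \<omega>)\<^sup>2 - time_integral (variation_density f) t \<omega>) - ((?Z s \<omega>)\<^sup>2 - time_integral (variation_density f) s \<omega>) = ?A s t \<omega> + ?R s t \<omega>"
        by (simp add: power2_eq_square algebra_simps)
    next
      fix Y assume Y: "admissible s Y"
      then have Ym: "all_moments P Y" by (simp add: admissible_def)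
      have YZ: "admissible s (\<lambda>\<omega>. Y \<omega> * ?Z s \<omega>)" by (intro admissible_mult Y compensated_admissible[OF f st(1)])
      have "(\<integral>\<omega>. Y \<omega> * ?A s t \<omega> \<partial>P) = (\<integral>\<omega>. Y \<omega> * (2 * ?Z s \<omega> * (?Z t \<omega> - ?Z s \<omega>)) \<partial>P) + (\<integral>\<omega>. Y \<omega> * centered_quadratic ?a s t \<omega> \<partial>P)"
        unfolding distrib_left by (intro Bochner_Integration.integral_add all_moments_integrable all_moments_mult[OF Ym] i q)
      also have "(\<integral>\<omega>. Y \<omega> * centered_quadratic ?a s t \<omega> \<partial>P) = 0" by (rule centered_quadratic_centered[OF a st Y])
      also have "(\<integral>\<omega>. Y \<omega> * (2 * ?Z s \<omega> * (?Z t \<omega> - ?Z s \<omega>)) \<partial>P) = (\<integral>\<omega>. 2 * ((Y \<omega> * ?Z s \<omega>) * (?Z t \<omega> - ?Z s \<omega>)) \<partial>P)"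
        by (intro Bochner_Integration.integral_cong refl) (simp add: mult_ac)
      also have "\<dots> = 0" using mean_zero_incrementsD[OF compensated_mean_zero[OF f] st YZ] by simp
      finally show "(\<integral>\<omega>. Y \<omega> * ?A s t \<omega> \<partial>P) = 0" by simp
    }
  next
    fix T
    have "moment_order P T (2 + 1) (\<lambda>s t \<omega>. (?Z t \<omega> - ?Z s \<omega> - gradient_term f s t \<omega>) * ((?Z t \<omega> - ?Z s \<omega>) + gradient_term f s t \<omega>))"
      by (intro moment_order_mult moment_order_add compensated_first_order[OF f] compensated_increment_order[OF f] gradient_term_order[OF f'])
    then have "moment_order P T 3 (\<lambda>s t \<omega>. (?Z t \<omega> - ?Z s \<omega> - gradient_term f s t \<omega>) * ((?Z t \<omega> - ?Z s \<omega>) + gradient_term f s t \<omega>))" by simp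
    then show "moment_order P T 3 ?R" by (intro moment_order_diff[OF prob] time_integral_first_order[OF g1])
  qed
qed

lemma compensated_local_martingale: "tame 3 f \<Longrightarrow> continuous_local_martingale P F (compensated f)"
  by (intro continuous_local_martingaleI compensated_adapted_continuous compensated_admissible compensated_mean_zero)

lemma time_integral_adapted_continuous: "continuous_on UNIV g \<Longrightarrow> adapted_continuous P F (time_integral g)"
  unfolding adapted_continuous_def by (auto intro: time_integral_measurable time_integral_continuous)

lemma compensated_quadratic_variation:
  assumes f: "tame 3 f" shows "quadratic_variation P F (compensated f) (time_integral (variation_density f))"
proof -
  have f': "tame (Suc 2) f" using f by (simp add: numeral_3_eq_3)
  have g: "tame 2 (variation_density f)" by (rule tame_variation_density[OF f'])
  note gc = tame_continuous[OF g]
  note ac = compensated_adapted_continuous[OF f] time_integral_adapted_continuous[OF gc]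
  have "mono_on {0..} (\<lambda>t. time_integral (variation_density f) t \<omega>)" if "\<omega> \<in> space P" for \<omega>
  proof (rule mono_onI)
    fix s t :: real assume st: "s \<in> {0..}" "t \<in> {0..}" "s \<le> t"
    have "0 \<le> integral {s..t} (\<lambda>u. variation_density f (W u \<omega>))"
      using st by (intro integral_nonneg integrable_W_interval[OF gc that]) (auto simp: variation_density_def sum_nonneg)
    then show "time_integral (variation_density f) s \<omega> \<le> time_integral (variation_density f) t \<omega>" using time_integral_diff[OF gc that, of s t] st by simp
  qed
  moreover have "continuous_local_martingale P F (\<lambda>t \<omega>. (compensated f t \<omega>)\<^sup>2 - time_integral (variation_density f) t \<omega>)"
  proof (rule continuous_local_martingaleI[OF _ _ compensated_square_mean_zero[OF f]])
    show "adapted_continuous P F (\<lambda>t \<omega>. (compensated f t \<omega>)\<^sup>2 - time_integral (variation_density f) t \<omega>)"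
      using ac unfolding adapted_continuous_def by (auto intro!: borel_measurable_diff borel_measurable_power continuous_intros)
    show "admissible t (\<lambda>\<omega>. (compensated f t \<omega>)\<^sup>2 - time_integral (variation_density f) t \<omega>)" if "0 \<le> t" for t
      using time_integral_admissible[OF g that] admissible_mult[OF compensated_admissible[OF f that] compensated_admissible[OF f that]] unfolding power2_eq_square admissible_def
      by (auto intro: borel_measurable_diff all_moments_diff[OF prob])
  qed
  ultimately show ?thesis unfolding quadratic_variation_def using ac(2) by (simp add: time_integral_def)
qed

text \<open>
  A criterion for Ito integrals: it suffices that over each interval the increment of the candidate \<open>I\<close> agrees with
  the frozen integrand times the increment of \<open>X\<close>, up to a conditionally centred error \<open>e\<close> of order \<open>2\<close>.  On the grid
  of mesh \<open>1 / (n + 1)\<close> the errors of different cells are orthogonal, so their sum has second moment at most the sum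
  of \<open>C (t - s)\<^sup>2\<close> over the cells, which is of the order of the mesh.  Chebyshev's inequality concludes.  The unit
  vector \<open>y\<close> lets real errors serve for complex-valued integrals.
\<close>

lemma ito_integralI:
  fixes H :: "real \<Rightarrow> 'a \<Rightarrow> 'h::euclidean_space" and X :: "real \<Rightarrow> 'a \<Rightarrow> 'x::real_normed_vector"
    and I :: "real \<Rightarrow> 'a \<Rightarrow> 'y::real_normed_vector"
  assumes b: "bounded_bilinear b" and I: "adapted_continuous P F I" and H: "adapted_continuous P F H"
    and I0: "\<And>\<omega>. \<omega> \<in> space P \<Longrightarrow> I 0 \<omega> = 0" and y: "norm y = 1"
    and eq: "\<And>s t \<omega>. 0 \<le> s \<Longrightarrow> s < t \<Longrightarrow> \<omega> \<in> space P \<Longrightarrow> I t \<omega> - I s \<omega> - b (H s \<omega>) (X t \<omega> - X s \<omega>) = e s t \<omega> *\<^sub>R y"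
    and e_order: "\<And>T. moment_order P T 2 e"
    and e_meas: "\<And>s t. 0 \<le> s \<Longrightarrow> s < t \<Longrightarrow> e s t \<in> borel_measurable (F t)"
    and e_centered: "\<And>s t Y. 0 \<le> s \<Longrightarrow> s < t \<Longrightarrow> admissible s Y \<Longrightarrow> (\<integral>\<omega>. Y \<omega> * e s t \<omega> \<partial>P) = 0"
  shows "ito_integral P F b H X I"
  unfolding ito_integral_def
proof (intro conjI b I exI allI impI)
  let ?m = "\<lambda>n. Suc n * Suc n" and ?\<tau> = "\<lambda>n k. real k / real (Suc n)"
  let ?\<xi> = "\<lambda>n k. H (?\<tau> n k)"
  have Hm: "H t \<in> borel_measurable (F t)" if "0 \<le> t" for t using H that by (simp add: adapted_continuous_def)
  show "simple_predictable F (?m n) (?\<tau> n) (?\<xi> n)" for n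
    unfolding simple_predictable_def using Hm by (auto simp: divide_right_mono)
  show "ucp_tendsto P (\<lambda>n. simple_value (?m n) (?\<tau> n) (?\<xi> n)) H"
    using H measurable_F[OF Hm] by (intro ucp_tendsto_left_grid[OF prob]) (auto simp: adapted_continuous_def)
  fix t :: real assume t: "0 \<le> t"
  obtain C where C: "C \<ge> 0"
    "\<And>s r. 0 \<le> s \<Longrightarrow> s < r \<Longrightarrow> r \<le> t \<Longrightarrow> moment_le P 2 (C * sqrt (r - s) ^ (2 * 2)) (e s r)"
    by (rule moment_orderE[OF e_order[of t], of 2]) blast
  have C2: "(\<integral>\<omega>. e s r \<omega> * e s r \<omega> \<partial>P) \<le> C * (r - s) * (r - s)" if "0 \<le> s" "s < r" "r \<le> t" for s r
  proof -
    have "sqrt (r - s) ^ (2 * 2) = (r - s)\<^sup>2" using that by (simp only: power_mult real_sqrt_pow2)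
    then show ?thesis using moment_le_integral[OF C(2)[OF that]] by (simp add: power2_eq_square mult.assoc abs_mult_self_eq)
  qed
  have key: "measure P {\<omega>\<in>space P. norm (simple_integral b (?m n) (?\<tau> n) (?\<xi> n) X t \<omega> - I t \<omega>) > \<epsilon>} \<le> C * t / real (Suc n) / \<epsilon>\<^sup>2"
    if \<epsilon>: "\<epsilon> > 0" and n: "t \<le> real (Suc n)" for \<epsilon> n
  proof -
    define N where "N = real (Suc n)"
    have N: "N > 0" by (simp add: N_def)
    \<comment> \<open>The grid stopped at \<open>t\<close>: a cell beyond \<open>t\<close> is empty and contributes no error.\<close>
    define v where "v k = min t (real k / N)" for k
    define a where "a k \<omega> = (if v k < v (Suc k) then e (v k) (v (Suc k)) \<omega> else 0)" for k \<omega>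
    have v0: "v 0 = 0" using t by (simp add: v_def)
    have "t \<le> real (?m n) / N" using n N by (simp only: N_def of_nat_mult) simp
    then have vm: "v (?m n) = t" by (simp only: v_def min_absorb1)
    have v_nonneg: "0 \<le> v k" and v_le: "v k \<le> t" for k using t N by (auto simp: v_def)
    have v_mono: "v k \<le> v l" if "k \<le> l" for k l
      unfolding v_def using that N by (intro min.mono divide_right_mono) auto
    have v_step: "v (Suc k) - v k \<le> 1 / N" for k
    proof -
      have "real (Suc k) / N = real k / N + 1 / N" "1 / N > 0" using N by (simp_all add: add_divide_distrib)
      then show ?thesis unfolding v_def min_def by (smt (verit))
    qed
    have a_admissible: "admissible (v l) (a k)" if "k < l" for k l
    proof (cases "v k < v (Suc k)")
      case True
      have "admissible (v (Suc k)) (e (v k) (v (Suc k)))"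
        using e_meas[OF v_nonneg True] moment_order_all_moments[OF e_order v_nonneg True order_refl] by (simp add: admissible_def)
      then have "admissible (v l) (e (v k) (v (Suc k)))" by (rule admissible_mono) (use that in \<open>auto intro: v_mono\<close>)
      then show ?thesis using True by (simp add: a_def[abs_def])
    next
      case False
      then have "a k = (\<lambda>\<omega>. 0)" by (simp add: a_def[abs_def])
      moreover have "admissible (v l) (\<lambda>\<omega>. 0 * indicator (space P) \<omega>)"
      proof -
        have "all_moments P (\<lambda>\<omega>. 0)" unfolding all_moments_iff_moment_order by (rule moment_order_const[OF prob])
        then show ?thesis by (simp add: admissible_def)
      qed
      ultimately show ?thesis by simp
    qed
    have am: "all_moments P (a k)" for k using a_admissible[of k "Suc k"] by (simp add: admissible_def)
    have orth: "(\<integral>\<omega>. a k \<omega> * a l \<omega> \<partial>P) = 0" if "k < l" for k l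
      using e_centered[OF v_nonneg _ a_admissible[OF that], of "v (Suc l)"]
      by (cases "v l < v (Suc l)") (simp_all add: a_def[of l])
    have aa: "(\<integral>\<omega>. a k \<omega> * a l \<omega> \<partial>P) = (if l = k then \<integral>\<omega>. a k \<omega> * a k \<omega> \<partial>P else 0)" for k l
      using orth[of k l] orth[of l k] by (cases k l rule: linorder_cases) (auto simp: mult.commute[of "a k _" "a l _"])
    have diag: "(\<integral>\<omega>. a k \<omega> * a k \<omega> \<partial>P) \<le> C / N * (v (Suc k) - v k)" for k
    proof (cases "v k < v (Suc k)")
      case True
      then have "(\<integral>\<omega>. a k \<omega> * a k \<omega> \<partial>P) \<le> C * (v (Suc k) - v k) * (v (Suc k) - v k)"
        using C2[OF v_nonneg True v_le] by (simp add: a_def)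
      also have "\<dots> \<le> C * (1 / N) * (v (Suc k) - v k)"
        using True C(1) v_step by (intro mult_right_mono mult_left_mono) auto
      finally show ?thesis by simp
    next
      case False
      then have "v (Suc k) = v k" using v_mono[of k "Suc k"] by simp
      then show ?thesis by (simp add: a_def)
    qed
    define S where "S \<omega> = (\<Sum>k<?m n. a k \<omega>)" for \<omega>
    have Sm: "all_moments P S" unfolding S_def[abs_def] by (intro all_moments_sum[OF prob] am) simp
    have "(\<integral>\<omega>. (S \<omega>)\<^sup>2 \<partial>P) = (\<integral>\<omega>. (\<Sum>k<?m n. \<Sum>l<?m n. a k \<omega> * a l \<omega>) \<partial>P)"
      by (simp only: S_def power2_eq_square sum_product)
    also have "\<dots> = (\<Sum>k<?m n. \<Sum>l<?m n. \<integral>\<omega>. a k \<omega> * a l \<omega> \<partial>P)"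
      by (intro integral_double_sum all_moments_integrable all_moments_mult am)
    also have "\<dots> = (\<Sum>k<?m n. \<Sum>l<?m n. if l = k then \<integral>\<omega>. a k \<omega> * a k \<omega> \<partial>P else 0)"
      by (intro sum.cong refl aa)
    also have "\<dots> = (\<Sum>k<?m n. \<integral>\<omega>. a k \<omega> * a k \<omega> \<partial>P)"
      by (intro sum.cong refl) (subst sum.delta, auto)
    also have "\<dots> \<le> (\<Sum>k<?m n. C / N * (v (Suc k) - v k))" by (intro sum_mono diag)
    also have "\<dots> = C / N * t"
      unfolding sum_distrib_left[symmetric] sum_lessThan_telescope vm v0 by simp
    finally have SS: "(\<integral>\<omega>. (S \<omega>)\<^sup>2 \<partial>P) \<le> C * t / N" by simp
    have diff: "norm (simple_integral b (?m n) (?\<tau> n) (?\<xi> n) X t \<omega> - I t \<omega>) = \<bar>S \<omega>\<bar>" if \<omega>: "\<omega> \<in> space P" for \<omega>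
    proof -
      have summand: "I (v (Suc k)) \<omega> - I (v k) \<omega> - b (H (real k / N) \<omega>) (X (v (Suc k)) \<omega> - X (v k) \<omega>) = a k \<omega> *\<^sub>R y" for k
      proof (cases "v k < v (Suc k)")
        case True
        then have "v k = real k / N" by (auto simp: v_def min_def split: if_splits)
        then show ?thesis using eq[OF v_nonneg True \<omega>] True by (simp add: a_def)
      next
        case False
        then have "v (Suc k) = v k" using v_mono[of k "Suc k"] by simp
        then show ?thesis by (simp add: a_def bounded_bilinear.zero_right[OF b])
      qed
      have tele: "(\<Sum>k<?m n. I (v (Suc k)) \<omega> - I (v k) \<omega>) = I t \<omega>"
        unfolding sum_lessThan_telescope[of "\<lambda>k. I (v k) \<omega>"] vm v0 using I0[OF \<omega>] by simp
      have int: "simple_integral b (?m n) (?\<tau> n) (?\<xi> n) X t \<omega>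
          = (\<Sum>k<?m n. b (H (real k / N) \<omega>) (X (v (Suc k)) \<omega> - X (v k) \<omega>))"
        by (simp only: simple_integral_def v_def N_def)
      have "I t \<omega> - simple_integral b (?m n) (?\<tau> n) (?\<xi> n) X t \<omega> = S \<omega> *\<^sub>R y"
      proof -
        have "S \<omega> *\<^sub>R y = (\<Sum>k<?m n. I (v (Suc k)) \<omega> - I (v k) \<omega> - b (H (real k / N) \<omega>) (X (v (Suc k)) \<omega> - X (v k) \<omega>))"
          by (simp only: summand S_def scaleR_sum_left)
        also have "\<dots> = (\<Sum>k<?m n. I (v (Suc k)) \<omega> - I (v k) \<omega>) - (\<Sum>k<?m n. b (H (real k / N) \<omega>) (X (v (Suc k)) \<omega> - X (v k) \<omega>))"
          by (rule sum_subtractf)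
        finally show ?thesis unfolding int tele by simp
      qed
      then have "norm (I t \<omega> - simple_integral b (?m n) (?\<tau> n) (?\<xi> n) X t \<omega>) = \<bar>S \<omega>\<bar>" using y by simp
      then show ?thesis by (simp only: norm_minus_commute)
    qed
    have "measure P {\<omega>\<in>space P. norm (simple_integral b (?m n) (?\<tau> n) (?\<xi> n) X t \<omega> - I t \<omega>) > \<epsilon>}
        \<le> measure P {\<omega>\<in>space P. (S \<omega>)\<^sup>2 \<ge> \<epsilon>\<^sup>2}"
    proof (rule finite_measure_mono)
      show "{\<omega>\<in>space P. norm (simple_integral b (?m n) (?\<tau> n) (?\<xi> n) X t \<omega> - I t \<omega>) > \<epsilon>} \<subseteq> {\<omega>\<in>space P. (S \<omega>)\<^sup>2 \<ge> \<epsilon>\<^sup>2}"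
      proof (intro subsetI CollectI conjI; elim CollectE conjE)
        fix \<omega> assume \<omega>: "\<omega> \<in> space P" "\<epsilon> < norm (simple_integral b (?m n) (?\<tau> n) (?\<xi> n) X t \<omega> - I t \<omega>)"
        then have "\<bar>\<epsilon>\<bar> \<le> \<bar>S \<omega>\<bar>" using \<epsilon> by (simp only: diff[OF \<omega>(1)])
        then show "\<epsilon>\<^sup>2 \<le> (S \<omega>)\<^sup>2" by (simp only: abs_le_square_iff)
      qed
      have [measurable]: "S \<in> borel_measurable P" using Sm by (simp add: all_moments_def)
      show "{\<omega>\<in>space P. (S \<omega>)\<^sup>2 \<ge> \<epsilon>\<^sup>2} \<in> sets P" by measurable
    qed
    also have "\<dots> \<le> (\<integral>\<omega>. (S \<omega>)\<^sup>2 \<partial>P) / \<epsilon>\<^sup>2"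
      using \<epsilon> by (intro integral_Markov_inequality_measure[where A = "{}"] all_moments_integrable_power Sm) auto
    also have "\<dots> \<le> C * t / N / \<epsilon>\<^sup>2" using SS by (intro divide_right_mono) auto
    finally show ?thesis unfolding N_def .
  qed
  show "tendsto_in_prob P (\<lambda>n. simple_integral b (?m n) (?\<tau> n) (?\<xi> n) X t) (I t)"
    unfolding tendsto_in_prob_def
  proof (intro allI impI)
    fix \<epsilon> :: real assume \<epsilon>: "\<epsilon> > 0"
    show "(\<lambda>n. measure P {\<omega>\<in>space P. norm (simple_integral b (?m n) (?\<tau> n) (?\<xi> n) X t \<omega> - I t \<omega>) > \<epsilon>}) \<longlonglongrightarrow> 0"
    proof (rule tendsto_sandwich[OF always_eventually _ tendsto_const])
      show "\<forall>n. 0 \<le> measure P {\<omega>\<in>space P. norm (simple_integral b (?m n) (?\<tau> n) (?\<xi> n) X t \<omega> - I t \<omega>) > \<epsilon>}" by simp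
      obtain n0 :: nat where n0: "t < real n0" using reals_Archimedean2 by blast
      show "\<forall>\<^sub>F n in sequentially. measure P {\<omega>\<in>space P. norm (simple_integral b (?m n) (?\<tau> n) (?\<xi> n) X t \<omega> - I t \<omega>) > \<epsilon>}
          \<le> C * t / real (Suc n) / \<epsilon>\<^sup>2"
        using eventually_ge_at_top[of n0] by eventually_elim (rule key[OF \<epsilon>], use n0 in linarith)
      have "(\<lambda>n. C * t / real (Suc n)) \<longlonglongrightarrow> 0"
        by (intro real_tendsto_divide_at_top[OF tendsto_const] filterlim_compose[OF filterlim_real_sequentially] filterlim_Suc)
      then have "(\<lambda>n. C * t / real (Suc n) / \<epsilon>\<^sup>2) \<longlonglongrightarrow> 0 / \<epsilon>\<^sup>2" using \<epsilon> by (intro tendsto_divide tendsto_const) auto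
      then show "(\<lambda>n. C * t / real (Suc n) / \<epsilon>\<^sup>2) \<longlonglongrightarrow> 0" by simp
    qed
  qed
qed

end

context brownian_vector
begin

lemma continuous_image_adapted:
  assumes "continuous_on UNIV (g :: 'v \<Rightarrow> 'b::topological_space)"
  shows "adapted_continuous P F (\<lambda>t \<omega>. g (W t \<omega>))"
  unfolding adapted_continuous_def
proof (intro conjI allI impI ballI)
  show "(\<lambda>\<omega>. g (W t \<omega>)) \<in> borel_measurable (F t)" if "0 \<le> t" for t
    using measurable_compose[OF W_measurable[OF that order_refl] borel_measurable_continuous_onI[OF assms]] by simp
  show "continuous_on {0..} (\<lambda>t. g (W t \<omega>))" if "\<omega> \<in> space P" for \<omega>
    by (rule continuous_on_compose2[OF assms W_continuous[OF that]]) simp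
qed

lemma compensated_solves_sde:
  assumes f: "tame 2 f" and a: "\<And>s \<omega>. a s \<omega> = complex_of_real (generator f (W s \<omega>))"
  shows "solves_sde P (\<lambda>t \<omega>. f (W t \<omega>)) (compensated f) a"
  unfolding solves_sde_def
proof (intro AE_I2 allI impI)
  fix \<omega> t assume \<omega>: "\<omega> \<in> space P" and "0 \<le> (t::real)"
  have "tame (Suc (Suc 0)) f" using f by (simp only: numeral_2_eq_2)
  from time_integral_has_integral[OF tame_continuous[OF tame_generator[OF this]] \<omega>, of t]
  have "((\<lambda>s. complex_of_real (generator f (W s \<omega>))) has_integral complex_of_real (time_integral (generator f) t \<omega>)) {0..t}"
    by (rule has_integral_of_real)
  then show "((\<lambda>s. a s \<omega>) has_integral complex_of_real (f (W t \<omega>) - f (W 0 \<omega>) - (compensated f t \<omega> - compensated f 0 \<omega>))) {0..t}"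
    unfolding a using compensated_zero[OF \<omega>, of f] by (simp add: compensated_def)
qed

lemma time_integral_solves_sde:
  assumes g: "continuous_on UNIV g" and a: "\<And>s \<omega>. a s \<omega> = complex_of_real (g (W s \<omega>))"
  shows "solves_sde P (time_integral g) (\<lambda>_ _. 0) a"
  unfolding solves_sde_def
proof (intro AE_I2 allI impI)
  fix \<omega> t assume \<omega>: "\<omega> \<in> space P" and "0 \<le> (t::real)"
  from time_integral_has_integral[OF g \<omega>, of t]
  have "((\<lambda>s. complex_of_real (g (W s \<omega>))) has_integral complex_of_real (time_integral g t \<omega>)) {0..t}"
    by (rule has_integral_of_real)
  then show "((\<lambda>s. a s \<omega>) has_integral complex_of_real (time_integral g t \<omega> - time_integral g 0 \<omega> - (0 - 0))) {0..t}"
    unfolding a by (simp add: time_integral_def)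
qed

lemma gradient_term_measurable: "tame (Suc k) f \<Longrightarrow> 0 \<le> s \<Longrightarrow> s < t \<Longrightarrow> gradient_term f s t \<in> borel_measurable (F t)"
  unfolding gradient_term_def[abs_def]
  by (intro borel_measurable_sum borel_measurable_times dW_measurable continuous_W_measurable tame_continuous[OF tame_pd]) auto

lemma compensated_measurable: "tame 3 f \<Longrightarrow> 0 \<le> s \<Longrightarrow> s \<le> t \<Longrightarrow> compensated f s \<in> borel_measurable (F t)"
  using admissible_mono[OF compensated_admissible] by (auto simp: admissible_def)

text \<open>
  If \<open>\<nabla>f = g \<nabla>k\<close>, the main terms of the increments of the two martingale parts are in the ratio \<open>g(W s)\<close> and
  cancel, which leaves an error of order \<open>2\<close>.
\<close>

lemma ito_integral_compensated:
  assumes f: "tame 3 f" and k: "tame 3 k" and g: "tame 0 g"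
    and pd: "\<And>b x. b \<in> Basis \<Longrightarrow> pd b f x = g x * pd b k x"
  shows "ito_integral P F (*) (\<lambda>t \<omega>. g (W t \<omega>)) (compensated k) (compensated f)"
proof (rule ito_integralI[where y = 1 and
      e = "\<lambda>s t \<omega>. compensated f t \<omega> - compensated f s \<omega> - g (W s \<omega>) * (compensated k t \<omega> - compensated k s \<omega>)"])
  let ?e = "\<lambda>s t \<omega>. compensated f t \<omega> - compensated f s \<omega> - g (W s \<omega>) * (compensated k t \<omega> - compensated k s \<omega>)"
  have gradient_term: "gradient_term f s t \<omega> = g (W s \<omega>) * gradient_term k s t \<omega>" for s t \<omega>
    by (simp add: gradient_term_def pd sum_distrib_left mult_ac)
  show "moment_order P T 2 ?e" for T
  proof (rule moment_order_cong)
    have "moment_order P T (0 + 2) (\<lambda>s t \<omega>. g (W s \<omega>) * (compensated k t \<omega> - compensated k s \<omega> - gradient_term k s t \<omega>))"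
      by (intro moment_order_mult tame_order[OF g] compensated_first_order k)
    then have "moment_order P T 2 (\<lambda>s t \<omega>. g (W s \<omega>) * (compensated k t \<omega> - compensated k s \<omega> - gradient_term k s t \<omega>))"
      by (rule moment_order_mono) simp
    then show "moment_order P T 2 (\<lambda>s t \<omega>. (compensated f t \<omega> - compensated f s \<omega> - gradient_term f s t \<omega>)
        - g (W s \<omega>) * (compensated k t \<omega> - compensated k s \<omega> - gradient_term k s t \<omega>))"
      by (rule moment_order_diff[OF prob compensated_first_order[OF f]])
  qed (simp add: gradient_term algebra_simps)
  fix s t :: real assume st: "0 \<le> s" "s < t"
  then have t0: "0 \<le> t" by simp
  show "?e s t \<in> borel_measurable (F t)" using st
    by (intro borel_measurable_diff borel_measurable_times compensated_measurable f k continuous_W_measurable[OF tame_continuous[OF g]]) auto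
  fix Y assume Y: "admissible s Y"
  have Yg: "admissible s (\<lambda>\<omega>. Y \<omega> * g (W s \<omega>))" by (intro admissible_mult Y tame_admissible[OF g] st)
  have d: "all_moments P (\<lambda>\<omega>. compensated f t \<omega> - compensated f s \<omega>)" "all_moments P (\<lambda>\<omega>. compensated k t \<omega> - compensated k s \<omega>)"
    using compensated_admissible[OF f st(1)] compensated_admissible[OF f t0] compensated_admissible[OF k st(1)] compensated_admissible[OF k t0]
    by (auto simp: admissible_def intro: all_moments_diff[OF prob])
  have "(\<integral>\<omega>. Y \<omega> * ?e s t \<omega> \<partial>P) = (\<integral>\<omega>. Y \<omega> * (compensated f t \<omega> - compensated f s \<omega>)
      - (Y \<omega> * g (W s \<omega>)) * (compensated k t \<omega> - compensated k s \<omega>) \<partial>P)"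
    by (intro Bochner_Integration.integral_cong refl) (simp add: algebra_simps)
  also have "\<dots> = (\<integral>\<omega>. Y \<omega> * (compensated f t \<omega> - compensated f s \<omega>) \<partial>P)
      - (\<integral>\<omega>. (Y \<omega> * g (W s \<omega>)) * (compensated k t \<omega> - compensated k s \<omega>) \<partial>P)"
    using Y tame_admissible[OF g st(1)] unfolding admissible_def
    by (intro Bochner_Integration.integral_diff all_moments_integrable all_moments_mult d) auto
  also have "\<dots> = 0"
    using mean_zero_incrementsD[OF compensated_mean_zero[OF f] st Y] mean_zero_incrementsD[OF compensated_mean_zero[OF k] st Yg] by simp
  finally show "(\<integral>\<omega>. Y \<omega> * ?e s t \<omega> \<partial>P) = 0" .
qed (auto intro!: bounded_bilinear_mult compensated_adapted_continuous f compensated_zero continuous_image_adapted tame_continuous[OF g])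

text \<open>
  Here the frozen integrand times the increment of \<open>W\<close> is exactly the main term of the increment of the
  martingale part.
\<close>

lemma ito_integral_gradient:
  fixes H :: "'v \<Rightarrow> 'h::euclidean_space"
  assumes f: "tame 3 f" and b: "bounded_bilinear b" and H: "continuous_on UNIV H"
    and grad: "\<And>x h. b (H x) h = complex_of_real (pd h f x)"
  shows "ito_integral P F b (\<lambda>t \<omega>. H (W t \<omega>)) W (\<lambda>t \<omega>. complex_of_real (compensated f t \<omega>))"
proof (rule ito_integralI[where y = 1 and e = "\<lambda>s t \<omega>. compensated f t \<omega> - compensated f s \<omega> - gradient_term f s t \<omega>"])
  have f': "tame (Suc 2) f" using f by (simp add: numeral_3_eq_3)
  show "adapted_continuous P F (\<lambda>t \<omega>. complex_of_real (compensated f t \<omega>))"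
    using compensated_adapted_continuous[OF f] unfolding adapted_continuous_def
    by (auto intro!: borel_measurable_of_real continuous_on_of_real)
  fix s t :: real
  show "complex_of_real (compensated f t \<omega>) - complex_of_real (compensated f s \<omega>) - b (H (W s \<omega>)) (W t \<omega> - W s \<omega>)
      = (compensated f t \<omega> - compensated f s \<omega> - gradient_term f s t \<omega>) *\<^sub>R 1" for \<omega>
    using tame_pd_eq_ddir[OF f', of "W t \<omega> - W s \<omega>" "W s \<omega>"]
    by (simp add: grad gradient_term_def ddir_def dW_def of_real_def algebra_simps)
  assume st: "0 \<le> s" "s < t"
  then have t0: "0 \<le> t" by simp
  show "(\<lambda>\<omega>. compensated f t \<omega> - compensated f s \<omega> - gradient_term f s t \<omega>) \<in> borel_measurable (F t)" using st
    by (intro borel_measurable_diff gradient_term_measurable[OF f'] compensated_measurable f) auto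
  fix Y assume Y: "admissible s Y"
  then have Ym: "all_moments P Y" by (simp add: admissible_def)
  have d: "all_moments P (\<lambda>\<omega>. compensated f t \<omega> - compensated f s \<omega>)"
    using compensated_admissible[OF f st(1)] compensated_admissible[OF f t0] by (auto simp: admissible_def intro: all_moments_diff[OF prob])
  have l: "all_moments P (gradient_term f s t)" by (rule moment_order_all_moments[OF gradient_term_order[OF f'] st order_refl])
  have "(\<integral>\<omega>. Y \<omega> * (compensated f t \<omega> - compensated f s \<omega> - gradient_term f s t \<omega>) \<partial>P)
      = (\<integral>\<omega>. Y \<omega> * (compensated f t \<omega> - compensated f s \<omega>) \<partial>P) - (\<integral>\<omega>. Y \<omega> * gradient_term f s t \<omega> \<partial>P)"
    unfolding right_diff_distrib[of _ "_ - _"]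
    by (intro Bochner_Integration.integral_diff all_moments_integrable all_moments_mult d l Ym)
  also have "\<dots> = 0" using mean_zero_incrementsD[OF compensated_mean_zero[OF f] st Y] gradient_term_centered[OF f' st Y] by simp
  finally show "(\<integral>\<omega>. Y \<omega> * (compensated f t \<omega> - compensated f s \<omega> - gradient_term f s t \<omega>) \<partial>P) = 0" .
qed (auto intro!: b compensated_first_order f continuous_image_adapted H simp: compensated_zero)

end

section \<open>Derivatives of determinants and inverses\<close>

lemma matrix_inv_mult:
  assumes "det (A :: complex^'n^'n) \<noteq> 0"
  shows "A ** matrix_inv A = mat 1" "matrix_inv A ** A = mat 1"
proof -
  have "\<exists>B. A ** B = mat 1 \<and> B ** A = mat 1"
    using assms by (simp add: invertible_det_nz[symmetric] invertible_def)
  then have "A ** matrix_inv A = mat 1 \<and> matrix_inv A ** A = mat 1"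
    unfolding matrix_inv_def by (rule someI_ex)
  then show "A ** matrix_inv A = mat 1" "matrix_inv A ** A = mat 1" by auto
qed

lemma bounded_bilinear_matrix_mult: "bounded_bilinear ((**) :: complex^'n^'n \<Rightarrow> complex^'n^'n \<Rightarrow> complex^'n^'n)"
  unfolding bilinear_conv_bounded_bilinear[symmetric] bilinear_def linear_iff
  by (auto simp: matrix_matrix_mult_def vec_eq_iff sum.distrib algebra_simps scaleR_sum_right)

lemmas matrix_mult_diff_right = bounded_bilinear.diff_right[OF bounded_bilinear_matrix_mult]
lemmas matrix_mult_diff_left = bounded_bilinear.diff_left[OF bounded_bilinear_matrix_mult]
lemmas matrix_mult_minus_left = bounded_bilinear.minus_left[OF bounded_bilinear_matrix_mult]
lemmas matrix_mult_scaleR_right = bounded_bilinear.scaleR_right[OF bounded_bilinear_matrix_mult]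
lemmas matrix_mult_scaleR_left = bounded_bilinear.scaleR_left[OF bounded_bilinear_matrix_mult]

lemma bounded_linear_trace: "bounded_linear (trace :: complex^'n^'n \<Rightarrow> complex)"
  unfolding linear_conv_bounded_linear[symmetric] linear_iff
  by (auto simp: trace_def sum.distrib scaleR_sum_right)

lemma bounded_linear_dagger: "bounded_linear (dagger :: complex^'n^'n \<Rightarrow> complex^'n^'n)"
  unfolding linear_conv_bounded_linear[symmetric] linear_iff
  by (auto simp: dagger_def vec_eq_iff)

lemma bounded_linear_entry: "bounded_linear (\<lambda>A :: complex^'n^'m. A $ i $ k)"
  by (rule bounded_linear_compose[OF bounded_linear_vec_nth bounded_linear_vec_nth])

lemma dagger_mult: "dagger (A ** B) = dagger B ** dagger A"
  by (simp add: dagger_def matrix_matrix_mult_def vec_eq_iff mult.commute)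

lemma dagger_dagger [simp]: "dagger (dagger A) = A"
  by (simp add: dagger_def vec_eq_iff)

lemma dagger_mat: "dagger (mat c) = mat (cnj c)"
  by (simp add: dagger_def mat_def vec_eq_iff)

lemma trace_dagger: "trace (dagger A) = cnj (trace A)"
  by (simp add: trace_def dagger_def)

lemma mat_mult_commute: "mat c ** A = A ** mat (c :: complex)"
  by (simp add: matrix_matrix_mult_def mat_def vec_eq_iff if_distrib[of "\<lambda>x. x * _"] if_distrib[of "\<lambda>x. _ * x"] mult.commute cong: if_cong)

lemma trace_mat_mult: "trace (A ** mat (c :: complex)) = c * trace A"
  by (simp add: trace_def matrix_matrix_mult_def mat_def if_distrib[of "\<lambda>x. _ * x"] sum_distrib_left mult.commute cong: if_cong)

text \<open>
  The determinant is linear in each row; the product rule in the Leibniz formula replaces one row at a time.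
\<close>

lemma det_has_derivative_rows:
  fixes A :: "complex^'n^'n"
  shows "(det has_derivative (\<lambda>H. \<Sum>i\<in>UNIV. det (\<chi> j. if j = i then H $ i else A $ j))) (at A)"
proof -
  have "(det has_derivative (\<lambda>H. \<Sum>p | p permutes UNIV. of_int (sign p) * (\<Sum>i\<in>UNIV. H $ i $ p i * (\<Prod>j\<in>UNIV - {i}. A $ j $ p j)))) (at A)"
    unfolding det_def
    by (intro has_derivative_sum has_derivative_mult_right has_derivative_prod bounded_linear_imp_has_derivative bounded_linear_entry)
  moreover have "(\<Prod>j\<in>UNIV. (if j = i then H $ i else A $ j) $ p j) = H $ i $ p i * (\<Prod>j\<in>UNIV - {i}. A $ j $ p j)" for H :: "complex^'n^'n" and i p
    by (subst prod.remove[of UNIV i]) (auto intro!: prod.cong)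
  ultimately show ?thesis
    unfolding det_def vec_lambda_beta by (simp add: sum_distrib_left sum.swap[of _ _ UNIV])
qed

text \<open>
  Jacobi's formula.  Writing \<open>H = C A\<close> expresses the rows of \<open>H\<close> by those of \<open>A\<close>, and Cramer's lemma evaluates the
  determinant with one row replaced.
\<close>

lemma det_has_derivative:
  fixes A :: "complex^'n^'n"
  assumes "det A \<noteq> 0"
  shows "(det has_derivative (\<lambda>H. det A * trace (matrix_inv A ** H))) (at A)"
proof -
  have "(\<Sum>i\<in>UNIV. det (\<chi> j. if j = i then H $ i else A $ j)) = det A * trace (matrix_inv A ** H)" for H
  proof -
    define C where "C = H ** matrix_inv A"
    \<comment> \<open>The \<open>i\<close>-th row of \<open>H\<close> is the combination of the rows of \<open>A\<close> with coefficients \<open>C $ i\<close>.\<close>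
    have HC: "H = C ** A"
      unfolding C_def by (simp add: matrix_mul_assoc[symmetric] matrix_inv_mult[OF assms])
    have "det (\<chi> j. if j = i then H $ i else A $ j) = C $ i $ i * det A" for i
    proof -
      have "H $ i = (\<Sum>l\<in>UNIV. (C $ i) $ l *s row l A)"
        unfolding HC by (simp add: vec_eq_iff matrix_matrix_mult_def row_def)
      then have "(\<chi> j. if j = i then H $ i else A $ j) = (\<chi> j. if j = i then (\<Sum>l\<in>UNIV. (C $ i) $ l *s row l A) else row j A)"
        by (simp add: vec_eq_iff row_def)
      then show ?thesis using cramer_lemma_transpose[of i "C $ i" A] by simp
    qed
    then have "(\<Sum>i\<in>UNIV. det (\<chi> j. if j = i then H $ i else A $ j)) = det A * trace C"
      by (simp add: trace_def sum_distrib_left mult.commute)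
    then show ?thesis unfolding C_def trace_mul_sym[of H "matrix_inv A"] .
  qed
  then show ?thesis using det_has_derivative_rows[of A] by simp
qed

lemma continuous_det: "continuous (at A) (det :: complex^'n^'n \<Rightarrow> complex)"
  by (rule has_derivative_continuous[OF det_has_derivative_rows])

lemma tendsto_det: "(X \<longlongrightarrow> A) G \<Longrightarrow> ((\<lambda>y. det (X y)) \<longlongrightarrow> det A) G" for A :: "complex^'n^'n"
  using continuous_det[of A] by (rule isCont_tendsto_compose)

lemma matrix_inv_entry:
  fixes A :: "complex^'n^'n"
  assumes "det A \<noteq> 0"
  shows "matrix_inv A $ i $ j = det (\<chi> a b. if b = i then axis j 1 $ a else A $ a $ b) / det A"
proof -
  have "A *v column j (matrix_inv A) = axis j 1"
  proof -
    have "A *v column j (matrix_inv A) = column j (A ** matrix_inv A)"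
      by (simp add: vec_eq_iff matrix_vector_mult_def matrix_matrix_mult_def column_def)
    then show ?thesis by (simp add: matrix_inv_mult[OF assms] vec_eq_iff column_def mat_def axis_def eq_commute)
  qed
  then have "column j (matrix_inv A) = (\<chi> k. det (\<chi> a b. if b = k then axis j 1 $ a else A $ a $ b) / det A)"
    using cramer[OF assms] by blast
  then have "column j (matrix_inv A) $ i = (\<chi> k. det (\<chi> a b. if b = k then axis j 1 $ a else A $ a $ b) / det A) $ i"
    by simp
  then show ?thesis by (simp add: column_def)
qed

text \<open>
  Continuity comes from Cramer's rule, which writes the entries of the inverse as quotients of determinants.
\<close>

lemma tendsto_matrix_inv:
  fixes A :: "complex^'n^'n"
  assumes "det A \<noteq> 0"
  shows "(matrix_inv \<longlongrightarrow> matrix_inv A) (at A)"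
proof (intro vec_tendstoI)
  fix i j
  have d: "(det \<longlongrightarrow> det A) (at A)" using continuous_det[of A] by (simp add: isCont_def)
  have "((\<lambda>B. \<chi> a b. if b = i then axis j 1 $ a else B $ a $ b) \<longlongrightarrow> (\<chi> a b. if b = i then axis j 1 $ a else A $ a $ b)) (at A)"
    by (intro vec_tendstoI) (auto intro!: tendsto_vec_nth tendsto_ident_at)
  then have "((\<lambda>B. det (\<chi> a b. if b = i then axis j 1 $ a else B $ a $ b) / det B) \<longlongrightarrow> matrix_inv A $ i $ j) (at A)"
    unfolding matrix_inv_entry[OF assms] by (intro tendsto_divide tendsto_det d assms tendsto_ident_at)
  moreover have "\<forall>\<^sub>F B in at A. det B \<noteq> 0" using d assms by (rule tendsto_imp_eventually_ne)
  then have "\<forall>\<^sub>F B in at A. det (\<chi> a b. if b = i then axis j 1 $ a else B $ a $ b) / det B = matrix_inv B $ i $ j"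
    by eventually_elim (simp add: matrix_inv_entry)
  ultimately show "((\<lambda>B. matrix_inv B $ i $ j) \<longlongrightarrow> matrix_inv A $ i $ j) (at A)"
    by (rule Lim_transform_eventually)
qed

text \<open>
  By the identity \<open>B\<^sup>-\<^sup>1 - A\<^sup>-\<^sup>1 + A\<^sup>-\<^sup>1 (B - A) A\<^sup>-\<^sup>1 = (A\<^sup>-\<^sup>1 - B\<^sup>-\<^sup>1) (B - A) A\<^sup>-\<^sup>1\<close>, continuity of the inverse already gives
  its derivative.
\<close>

lemma matrix_inv_has_derivative:
  fixes A :: "complex^'n^'n"
  assumes "det A \<noteq> 0"
  shows "(matrix_inv has_derivative (\<lambda>H. - (matrix_inv A ** H ** matrix_inv A))) (at A)"
proof -
  let ?G = "matrix_inv A"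
  have "\<exists>K>0. \<forall>(A :: complex^'n^'n) (B :: complex^'n^'n). norm (A ** B) \<le> norm A * norm B * K"
    by (rule bounded_bilinear.pos_bounded[OF bounded_bilinear_matrix_mult])
  then obtain K where K: "K > 0" "\<And>(A :: complex^'n^'n) (B :: complex^'n^'n). norm (A ** B) \<le> norm A * norm B * K"
    by auto
  have bl: "bounded_linear (\<lambda>H. - (?G ** H ** ?G))"
    by (rule bounded_linear_minus[OF bounded_linear_compose[OF bounded_bilinear.bounded_linear_left[OF bounded_bilinear_matrix_mult]
        bounded_bilinear.bounded_linear_right[OF bounded_bilinear_matrix_mult]]])
  have d: "(det \<longlongrightarrow> det A) (at A)" using continuous_det[of A] by (simp add: isCont_def)
  have "((\<lambda>B. norm (matrix_inv B - ?G) * (norm ?G * K * K)) \<longlongrightarrow> norm (?G - ?G) * (norm ?G * K * K)) (at A)"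
    by (intro tendsto_intros tendsto_matrix_inv assms)
  then have lim: "((\<lambda>B. norm (matrix_inv B - ?G) * (norm ?G * K * K)) \<longlongrightarrow> 0) (at A)" by simp
  have "\<forall>\<^sub>F B in at A. det B \<noteq> 0" using d assms by (rule tendsto_imp_eventually_ne)
  then have bound: "\<forall>\<^sub>F B in at A. norm ((matrix_inv B - ?G - - (?G ** (B - A) ** ?G)) /\<^sub>R norm (B - A)) \<le> norm (matrix_inv B - ?G) * (norm ?G * K * K)"
  proof eventually_elim
    fix B :: "complex^'n^'n" assume B: "det B \<noteq> 0"
    have "(?G - matrix_inv B) ** ((B - A) ** ?G) = ?G ** (B - A) ** ?G - (matrix_inv B ** B) ** ?G + matrix_inv B ** (A ** ?G)"
      by (simp add: matrix_mult_diff_left matrix_mult_diff_right matrix_mul_assoc)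
    also have "\<dots> = matrix_inv B - ?G - - (?G ** (B - A) ** ?G)"
      by (simp add: matrix_inv_mult[OF assms] matrix_inv_mult[OF B])
    finally have "norm (matrix_inv B - ?G - - (?G ** (B - A) ** ?G)) = norm ((?G - matrix_inv B) ** ((B - A) ** ?G))" by simp
    also have "\<dots> \<le> norm (?G - matrix_inv B) * norm ((B - A) ** ?G) * K" by (rule K)
    also have "\<dots> \<le> norm (?G - matrix_inv B) * (norm (B - A) * norm ?G * K) * K"
      using K(1) by (intro mult_right_mono mult_left_mono K(2)) auto
    finally have "norm (matrix_inv B - ?G - - (?G ** (B - A) ** ?G)) \<le> norm (B - A) * (norm (matrix_inv B - ?G) * (norm ?G * K * K))"
      by (simp add: norm_minus_commute mult_ac)
    then show "norm ((matrix_inv B - ?G - - (?G ** (B - A) ** ?G)) /\<^sub>R norm (B - A)) \<le> norm (matrix_inv B - ?G) * (norm ?G * K * K)"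
    proof (cases "B = A")
      case False
      have *: "inverse c * N \<le> R" if "N \<le> c * R" "c > 0" for N c R :: real using that by (simp add: field_simps)
      show ?thesis
        unfolding norm_scaleR abs_inverse abs_norm_cancel by (rule *) (use False \<open>_ \<le> norm (B - A) * _\<close> in auto)
    qed (simp add: K(1) less_imp_le)
  qed
  have "((\<lambda>B. (matrix_inv B - ?G - - (?G ** (B - A) ** ?G)) /\<^sub>R norm (B - A)) \<longlongrightarrow> 0) (at A)"
    by (rule Lim_null_comparison[OF bound lim])
  then show ?thesis unfolding has_derivative_at_within using bl by simp
qed

section \<open>The regularized Gram matrix\<close>

text \<open>
  The matrix \<open>A\<^sup>* A + r\<close>.  It depends on \<open>w\<close> only through \<open>r = |w|\<^sup>2\<close>, and \<open>r\<close> is the variable in which the derivatives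
  in \<open>w\<close> are computed.
\<close>

definition gram :: "complex^'n^'n \<Rightarrow> real \<Rightarrow> complex^'n^'n" where
  "gram A r = dagger A ** A + mat (complex_of_real r)"

lemma hhat_eq_gram: "hhat z w m = gram (m - mat z) ((cmod w)\<^sup>2)"
proof -
  have "dagger (m - mat z) = dagger m - mat (cnj z)"
    by (simp add: linear_diff[OF bounded_linear.linear[OF bounded_linear_dagger]] dagger_mat)
  then show ?thesis by (simp add: hhat_def gram_def)
qed

lemma dagger_gram: "dagger (gram A r) = gram A r"
  by (simp add: gram_def linear_add[OF bounded_linear.linear[OF bounded_linear_dagger]] dagger_mult dagger_mat)

lemma dagger_adjoint: "(dagger A *v x) \<bullet> y = x \<bullet> (A *v y)"
proof -
  have "(dagger A *v x) \<bullet> y = (\<Sum>i\<in>UNIV. \<Sum>j\<in>UNIV. (cnj (A $ j $ i) * x $ j) \<bullet> (y $ i))"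
    by (simp add: inner_vec_def matrix_vector_mult_def dagger_def inner_sum_left)
  also have "\<dots> = (\<Sum>i\<in>UNIV. \<Sum>j\<in>UNIV. (x $ j) \<bullet> (A $ j $ i * y $ i))"
    by (intro sum.cong refl) (simp add: inner_complex_def algebra_simps)
  also have "\<dots> = x \<bullet> (A *v y)"
    by (subst sum.swap) (simp add: inner_vec_def matrix_vector_mult_def inner_sum_right)
  finally show ?thesis .
qed

text \<open>
  The matrix is bounded below by \<open>r\<close> in the sense of quadratic forms; pair its value at \<open>v\<close> with \<open>v\<close> and use the
  Cauchy--Schwarz inequality.
\<close>

lemma gram_lower_bound:
  assumes "r > 0" shows "r * norm v \<le> norm (gram A r *v v)"
proof -
  have "mat (complex_of_real r) *v v = r *\<^sub>R v"
    by (simp add: vec_eq_iff matrix_vector_mult_def mat_def if_distrib[of "\<lambda>x. x * _"] cong: if_cong) (simp add: scaleR_conv_of_real)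
  then have "gram A r *v v = dagger A *v (A *v v) + r *\<^sub>R v"
    by (simp add: gram_def matrix_vector_mult_add_rdistrib matrix_vector_mul_assoc)
  then have "(gram A r *v v) \<bullet> v = (A *v v) \<bullet> (A *v v) + r * (v \<bullet> v)"
    by (simp add: inner_add_left dagger_adjoint)
  then have "r * (norm v * norm v) \<le> (gram A r *v v) \<bullet> v"
    by (simp add: dot_square_norm power2_eq_square)
  also have "\<dots> \<le> norm (gram A r *v v) * norm v" by (rule norm_cauchy_schwarz)
  finally have "(r * norm v) * norm v \<le> norm (gram A r *v v) * norm v" by (simp add: mult.assoc)
  then show ?thesis by (cases "v = 0") (auto simp: mult_le_cancel_right)
qed

lemma det_gram_nonzero: assumes "r > 0" shows "det (gram A r) \<noteq> 0"
proof -
  have "v = 0" if "gram A r *v v = 0" for v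
    using gram_lower_bound[OF assms, of v A] that assms by (simp add: mult_le_0_iff)
  then have "\<exists>B. B ** gram A r = mat 1" by (simp add: matrix_left_invertible_ker)
  then show ?thesis by (simp add: invertible_det_nz[symmetric] invertible_left_inverse)
qed

lemma det_gram_real: "Im (det (gram A r)) = 0"
  using det_dagger[of "gram A r"] by (simp add: dagger_gram complex_eq_iff)

definition gramdet :: "complex^'n^'n \<Rightarrow> real \<Rightarrow> real" where
  "gramdet A r = Re (det (gram A r))"

lemma of_real_gramdet: "complex_of_real (gramdet A r) = det (gram A r)"
  by (simp add: gramdet_def complex_eq_iff det_gram_real)

text \<open>
  Deform \<open>A\<close> to \<open>0\<close> along \<open>t A\<close>: the determinant never vanishes and is \<open>r\<^sup>N > 0\<close> at \<open>t = 0\<close>.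
\<close>

lemma gramdet_positive: assumes "r > 0" shows "gramdet (A :: complex^'n^'n) r > 0"
proof (rule ccontr)
  assume neg: "\<not> gramdet A r > 0"
  let ?f = "\<lambda>t::real. gramdet (t *\<^sub>R A) r"
  have "continuous_on {0..1} ?f"
    unfolding gramdet_def gram_def continuous_on_def
    by (intro ballI tendsto_Re tendsto_det tendsto_add tendsto_const bounded_bilinear.tendsto[OF bounded_bilinear_matrix_mult]
        bounded_linear.tendsto[OF bounded_linear_dagger] tendsto_scaleR tendsto_ident_at)
  moreover have "?f 0 > 0"
  proof -
    have "gram (0 *\<^sub>R A) r = mat (complex_of_real r)" by (simp add: gram_def)
    moreover have "det (mat (complex_of_real r) :: complex^'n^'n) = of_real (r ^ CARD('n))"
      by (subst det_diagonal) (simp_all add: mat_def)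
    ultimately show ?thesis using assms by (simp add: gramdet_def del: of_real_power)
  qed
  ultimately obtain t where "?f t = 0"
    using IVT2'[of ?f 1 0 0] neg by auto
  then show False using det_gram_nonzero[OF assms, of "t *\<^sub>R A"] of_real_gramdet[of "t *\<^sub>R A" r] by simp
qed

text \<open>
  The entries of the inverse are at most \<open>1 / r\<close>, so by the Leibniz formula the determinant of the inverse is at most
  \<open>N! / r\<^sup>N\<close>.  The constant is far from the optimal \<open>r\<^sup>N\<close>, but any positive bound uniform in \<open>A\<close> serves to make the
  square root and the logarithm of the determinant tame.
\<close>

lemma gramdet_lower_bound:
  assumes r: "r > 0" shows "gramdet (A :: complex^'n^'n) r \<ge> r ^ CARD('n) / fact CARD('n)"
proof -
  let ?h = "gram A r" and ?N = "CARD('n)"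
  let ?G = "matrix_inv ?h"
  note nz = det_gram_nonzero[OF r, of A]
  have entry: "cmod (?G $ i $ j) \<le> 1 / r" for i j
  proof -
    have "?h *v column j ?G = column j (?h ** ?G)"
      by (simp add: vec_eq_iff matrix_vector_mult_def matrix_matrix_mult_def column_def)
    also have "\<dots> = axis j 1"
      by (simp add: matrix_inv_mult[OF nz] vec_eq_iff column_def mat_def axis_def eq_commute)
    finally have "r * norm (column j ?G) \<le> norm (axis j 1 :: complex^'n)"
      using gram_lower_bound[OF r, of "column j ?G" A] by simp
    then have "r * norm (column j ?G) \<le> 1" by simp
    moreover have "cmod (column j ?G $ i) \<le> norm (column j ?G)" by (rule Finite_Cartesian_Product.norm_nth_le)
    then have "r * cmod (?G $ i $ j) \<le> r * norm (column j ?G)" using r by (simp add: column_def)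
    ultimately have "r * cmod (?G $ i $ j) \<le> 1" by linarith
    then show ?thesis using r by (simp add: field_simps)
  qed
  have "cmod (det ?G) \<le> (\<Sum>p | p permutes (UNIV::'n set). (1 / r) ^ ?N)"
    unfolding det_def
  proof (rule sum_norm_le)
    fix p :: "'n \<Rightarrow> 'n"
    have "cmod (of_int (sign p) * (\<Prod>i\<in>UNIV. ?G $ i $ p i)) = (\<Prod>i\<in>UNIV. cmod (?G $ i $ p i))"
      by (simp add: norm_mult prod_norm sign_def)
    also have "\<dots> \<le> (\<Prod>i\<in>(UNIV::'n set). 1 / r)" by (intro prod_mono) (auto simp: entry)
    finally show "cmod (of_int (sign p) * (\<Prod>i\<in>UNIV. ?G $ i $ p i)) \<le> (1 / r) ^ ?N" by simp
  qed
  also have "\<dots> = fact ?N / r ^ ?N" by (simp add: card_permutations power_divide)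
  finally have G: "cmod (det ?G) \<le> fact ?N / r ^ ?N" .
  have "det ?h * det ?G = 1" by (simp add: det_mul[symmetric] matrix_inv_mult[OF nz])
  then have "cmod (det ?h) * cmod (det ?G) = 1" by (metis norm_mult norm_one)
  moreover have "cmod (det ?h) = gramdet A r"
    using gramdet_positive[OF r, of A] by (simp add: of_real_gramdet[symmetric])
  ultimately have "1 \<le> gramdet A r * (fact ?N / r ^ ?N)"
    using G gramdet_positive[OF r, of A] by (metis mult_left_mono less_imp_le)
  then show ?thesis using r by (simp add: field_simps)
qed

text \<open>
  Complex-valued polynomials in the entries are handled through this auxiliary class, because only real-valued functions
  are called tame.
\<close>

definition ctame :: "nat \<Rightarrow> ('v::euclidean_space \<Rightarrow> complex) \<Rightarrow> bool" where
  "ctame k f \<longleftrightarrow> tame k (\<lambda>x. Re (f x)) \<and> tame k (\<lambda>x. Im (f x))"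

lemma ctame_const: "ctame k (\<lambda>x. c)" by (simp add: ctame_def tame_const)

lemma ctame_add: "ctame k f \<Longrightarrow> ctame k g \<Longrightarrow> ctame k (\<lambda>x. f x + g x)"
  by (simp add: ctame_def tame_add)

lemma ctame_diff: "ctame k f \<Longrightarrow> ctame k g \<Longrightarrow> ctame k (\<lambda>x. f x - g x)"
  by (simp add: ctame_def tame_diff)

lemma ctame_mult: "ctame k f \<Longrightarrow> ctame k g \<Longrightarrow> ctame k (\<lambda>x. f x * g x)"
  by (simp add: ctame_def tame_add tame_diff tame_mult)

lemma ctame_cnj: "ctame k f \<Longrightarrow> ctame k (\<lambda>x. cnj (f x))"
  using tame_cmult[of k "\<lambda>x. Im (f x)" "-1"] by (simp add: ctame_def)

lemma ctame_sum: "(\<And>i. i \<in> I \<Longrightarrow> ctame k (f i)) \<Longrightarrow> ctame k (\<lambda>x. \<Sum>i\<in>I. f i x)"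
  by (induction I rule: infinite_finite_induct) (auto intro: ctame_const ctame_add)

lemma ctame_prod: "(\<And>i. i \<in> I \<Longrightarrow> ctame k (f i)) \<Longrightarrow> ctame k (\<lambda>x. \<Prod>i\<in>I. f i x)"
  by (induction I rule: infinite_finite_induct) (auto intro: ctame_const ctame_mult)

lemma ctame_entry: "ctame k (\<lambda>m :: complex^'n^'m. m $ i $ j)"
proof -
  have "Re (m $ i $ j) = m \<bullet> axis i (axis j 1)" "Im (m $ i $ j) = m \<bullet> axis i (axis j \<i>)" for m :: "complex^'n^'m"
    by (simp_all add: inner_axis inner_complex_def)
  then show ?thesis by (simp add: ctame_def tame_inner)
qed

lemma tame_gramdet: "tame k (\<lambda>m :: complex^'n^'n. gramdet (m - mat z) r)"
proof -
  have "ctame k (\<lambda>m :: complex^'n^'n. det (gram (m - mat z) r))"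
    unfolding det_def gram_def dagger_def matrix_matrix_mult_def vector_add_component vec_lambda_beta vector_minus_component
    by (intro ctame_sum ctame_mult ctame_const ctame_prod ctame_add ctame_cnj ctame_diff ctame_entry)
  then show ?thesis by (simp add: ctame_def gramdet_def)
qed

section \<open>Laplacian and gradient of the determinant\<close>

definition trace_inv :: "complex^'n^'n \<Rightarrow> real \<Rightarrow> real" where
  "trace_inv A r = Re (trace (matrix_inv (gram A r)))"

definition trace_inv_sq :: "complex^'n^'n \<Rightarrow> real \<Rightarrow> real" where
  "trace_inv_sq A r = Re (trace (matrix_inv (gram A r) ** matrix_inv (gram A r)))"

text \<open>
  The matrix \<open>(A\<^sup>* A + r)\<^sup>-\<^sup>1 A\<^sup>*\<close>, which tends to the pseudo-inverse of \<open>A\<close> as \<open>r \<rightarrow> 0\<close>; twice its adjoint is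
  the gradient of the logarithm of the determinant.
\<close>

definition regularized_inverse :: "complex^'n^'n \<Rightarrow> real \<Rightarrow> complex^'n^'n" where
  "regularized_inverse A r = matrix_inv (gram A r) ** dagger A"

lemma dagger_gram_inv:
  assumes "r > 0" shows "dagger (matrix_inv (gram A r)) = matrix_inv (gram A r)"
proof -
  let ?h = "gram A r" and ?G = "matrix_inv (gram A r)"
  note inv = matrix_inv_mult[OF det_gram_nonzero[OF assms, of A]]
  have "dagger ?G ** ?h = mat 1"
    using arg_cong[OF inv(1), of dagger] by (simp add: dagger_mult dagger_gram dagger_mat)
  then have "dagger ?G ** (?h ** ?G) = ?G" by (simp add: matrix_mul_assoc)
  then show ?thesis by (simp add: inv)
qed

lemma gram_inv_gram:
  assumes "r > 0"
  shows "matrix_inv (gram A r) ** (dagger A ** A) = mat 1 - r *\<^sub>R matrix_inv (gram A r)"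
proof -
  let ?G = "matrix_inv (gram A r)"
  have "dagger A ** A = gram A r - mat (complex_of_real r)" by (simp add: gram_def)
  moreover have "?G ** mat (complex_of_real r) = r *\<^sub>R ?G"
    by (simp add: matrix_matrix_mult_def mat_def vec_eq_iff if_distrib[of "\<lambda>x. _ * x"] cong: if_cong)
       (simp add: scaleR_conv_of_real)
  ultimately show ?thesis
    by (simp add: matrix_mult_diff_right matrix_inv_mult[OF det_gram_nonzero[OF assms]])
qed

lemma trace_gram_inv:
  assumes "r > 0" shows "trace (matrix_inv (gram A r)) = complex_of_real (trace_inv A r)"
  using trace_dagger[of "matrix_inv (gram A r)"] by (simp add: dagger_gram_inv[OF assms] trace_inv_def complex_eq_iff)

lemma trace_conj_gram_inv:
  fixes A :: "complex^'n^'n"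
  assumes "r > 0"
  shows "trace (A ** matrix_inv (gram A r) ** dagger A) = of_nat CARD('n) - complex_of_real (r * trace_inv A r)"
proof -
  let ?G = "matrix_inv (gram A r)"
  have "trace (A ** ?G ** dagger A) = trace (?G ** (dagger A ** A))"
    by (metis matrix_mul_assoc trace_mul_sym)
  also have "\<dots> = of_nat CARD('n) - r *\<^sub>R trace ?G"
    by (simp add: gram_inv_gram[OF assms] trace_sub trace_I linear_scale[OF bounded_linear.linear[OF bounded_linear_trace]])
  finally show ?thesis by (simp add: trace_gram_inv[OF assms] scaleR_conv_of_real)
qed

text \<open>
  With \<open>G = (A\<^sup>* A + r)\<^sup>-\<^sup>1\<close> the squared Frobenius norm is the trace of \<open>G A\<^sup>* A G = G - r G\<^sup>2\<close>.
\<close>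

lemma regularized_inverse_norm:
  assumes "r > 0"
  shows "(\<Sum>j\<in>UNIV. \<Sum>k\<in>UNIV. (cmod (regularized_inverse A r $ k $ j))\<^sup>2) = trace_inv A r - r * trace_inv_sq A r"
proof -
  let ?G = "matrix_inv (gram A r)"
  have "trace (regularized_inverse A r ** dagger (regularized_inverse A r)) = (\<Sum>k\<in>UNIV. \<Sum>j\<in>UNIV. regularized_inverse A r $ k $ j * cnj (regularized_inverse A r $ k $ j))"
    by (simp add: trace_def matrix_matrix_mult_def dagger_def)
  then have "Re (trace (regularized_inverse A r ** dagger (regularized_inverse A r))) = (\<Sum>k\<in>UNIV. \<Sum>j\<in>UNIV. (cmod (regularized_inverse A r $ k $ j))\<^sup>2)"
    by (simp add: complex_mult_cnj cmod_power2)
  moreover have "regularized_inverse A r ** dagger (regularized_inverse A r) = ?G ** (dagger A ** A) ** ?G"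
    by (simp add: regularized_inverse_def dagger_mult dagger_gram_inv[OF assms] matrix_mul_assoc)
  moreover have "\<dots> = ?G - r *\<^sub>R (?G ** ?G)"
    by (simp add: gram_inv_gram[OF assms] matrix_mult_diff_left matrix_mult_scaleR_left)
  ultimately have "(\<Sum>k\<in>UNIV. \<Sum>j\<in>UNIV. (cmod (regularized_inverse A r $ k $ j))\<^sup>2) = trace_inv A r - r * trace_inv_sq A r"
    by (simp add: trace_inv_def trace_inv_sq_def trace_sub linear_scale[OF bounded_linear.linear[OF bounded_linear_trace]])
  then show ?thesis by (subst sum.swap)
qed

lemma gram_has_derivative:
  "((\<lambda>m. gram (m - mat z) r) has_derivative (\<lambda>H. dagger (m - mat z) ** H + dagger H ** (m - mat z))) (at m)"
  unfolding gram_def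
  by (auto intro!: derivative_eq_intros bounded_bilinear.FDERIV[OF bounded_bilinear_matrix_mult]
      bounded_linear.has_derivative[OF bounded_linear_dagger])

text \<open>
  The two terms of the derivative are adjoint to each other under the trace, so their real parts agree.
\<close>

lemma trace_gram_derivative:
  assumes "r > 0"
  shows "Re (trace (matrix_inv (gram A r) ** (dagger A ** H + dagger H ** A))) = 2 * Re (trace (regularized_inverse A r ** H))"
proof -
  let ?G = "matrix_inv (gram A r)"
  have "trace (?G ** (dagger H ** A)) = trace (dagger H ** A ** ?G)"
    by (simp only: trace_mul_sym[of ?G])
  also have "dagger H ** A ** ?G = dagger (regularized_inverse A r ** H)"
    by (simp add: regularized_inverse_def dagger_mult dagger_gram_inv[OF assms] matrix_mul_assoc)
  finally have "Re (trace (?G ** (dagger H ** A))) = Re (trace (regularized_inverse A r ** H))" by (simp add: trace_dagger)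
  moreover have "?G ** (dagger A ** H) = regularized_inverse A r ** H" by (simp add: regularized_inverse_def matrix_mul_assoc)
  ultimately show ?thesis by (simp add: matrix_add_ldistrib trace_add)
qed

lemma gramdet_has_derivative:
  assumes "r > 0"
  shows "((\<lambda>m. gramdet (m - mat z) r) has_derivative (\<lambda>H. gramdet (m - mat z) r * (2 * Re (trace (regularized_inverse (m - mat z) r ** H))))) (at m)"
proof -
  let ?A = "m - mat z"
  note nz = det_gram_nonzero[OF assms, of ?A]
  have "((\<lambda>m. Re (det (gram (m - mat z) r))) has_derivative
      (\<lambda>H. Re (det (gram ?A r) * trace (matrix_inv (gram ?A r) ** (dagger ?A ** H + dagger H ** ?A))))) (at m)"
    by (rule bounded_linear.has_derivative[OF bounded_linear_Re has_derivative_compose[OF gram_has_derivative det_has_derivative[OF nz]]])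
  moreover have eq: "Re (det (gram ?A r) * x) = gramdet ?A r * Re x" for x
    by (simp add: of_real_gramdet[symmetric])
  ultimately show ?thesis by (simp only: eq trace_gram_derivative[OF assms] gramdet_def[symmetric])
qed

lemma regularized_inverse_has_derivative:
  assumes "r > 0"
  shows "((\<lambda>m. regularized_inverse (m - mat z) r) has_derivative (\<lambda>H. matrix_inv (gram (m - mat z) r) ** dagger H
     - matrix_inv (gram (m - mat z) r) ** (dagger (m - mat z) ** H + dagger H ** (m - mat z)) ** regularized_inverse (m - mat z) r)) (at m)"
proof -
  let ?A = "m - mat z"
  have d: "((\<lambda>m. dagger (m - mat z)) has_derivative dagger) (at m)"
    by (rule bounded_linear.has_derivative[OF bounded_linear_dagger]) (auto intro!: derivative_eq_intros)
  have "((\<lambda>m. matrix_inv (gram (m - mat z) r) ** dagger (m - mat z)) has_derivative (\<lambda>H. matrix_inv (gram ?A r) ** dagger H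
      + (- (matrix_inv (gram ?A r) ** (dagger ?A ** H + dagger H ** ?A) ** matrix_inv (gram ?A r))) ** dagger ?A)) (at m)"
    by (rule bounded_bilinear.FDERIV[OF bounded_bilinear_matrix_mult
          has_derivative_compose[OF gram_has_derivative matrix_inv_has_derivative[OF det_gram_nonzero[OF assms]]] d])
  then show ?thesis unfolding regularized_inverse_def by (simp add: matrix_mult_minus_left matrix_mul_assoc)
qed

lemma sum_Basis_vec:
  fixes g :: "'b::euclidean_space^'m \<Rightarrow> real"
  shows "(\<Sum>b\<in>Basis. g b) = (\<Sum>i\<in>UNIV. \<Sum>u\<in>Basis. g (axis i u))"
proof -
  have "bij_betw (\<lambda>(i, u). axis i u) (UNIV \<times> Basis) (Basis :: ('b^'m) set)"
    by (auto simp: bij_betw_def inj_on_def axis_eq_axis Basis_vec_def dest: nonzero_Basis)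
  from sum.reindex_bij_betw[OF this, of g] show ?thesis
    by (simp add: sum.cartesian_product case_prod_beta')
qed

text \<open>
  The real standard basis of the space of complex matrices: one real and one imaginary direction per entry.
\<close>

lemma sum_Basis_complex_matrix:
  fixes g :: "complex^'n^'m \<Rightarrow> real"
  shows "(\<Sum>b\<in>Basis. g b) = (\<Sum>j\<in>UNIV. \<Sum>k\<in>UNIV. g (axis j (axis k 1)) + g (axis j (axis k \<i>)))"
  by (simp add: sum_Basis_vec Basis_complex_def)

lemma mult_unit:
  fixes X :: "complex^'n^'n"
  shows "(X ** axis j (axis k u)) $ a $ b = (if b = k then X $ a $ j * u else 0)"
proof -
  have "(X ** axis j (axis k u)) $ a $ b = (\<Sum>c\<in>UNIV. if c = j then X $ a $ c * axis k u $ b else 0)"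
    unfolding matrix_matrix_mult_def vec_lambda_beta by (intro sum.cong refl) (simp add: axis_def)
  then show ?thesis by (simp add: axis_def)
qed

lemma dagger_unit: "dagger (axis j (axis k u)) = axis k (axis j (cnj u))"
  by (simp add: dagger_def axis_def vec_eq_iff)

lemma trace_mult_unit:
  fixes X :: "complex^'n^'n"
  shows "trace (X ** axis j (axis k u)) = X $ k $ j * u"
  by (simp add: trace_def mult_unit)

lemma mult_unit_mult:
  fixes X :: "complex^'n^'n"
  shows "(X ** axis j (axis k u) ** Y) $ a $ b = X $ a $ j * u * Y $ k $ b"
proof -
  have "(X ** axis j (axis k u) ** Y) $ a $ b = (\<Sum>c\<in>UNIV. (X ** axis j (axis k u)) $ a $ c * Y $ c $ b)"
    by (simp add: matrix_matrix_mult_def[of "X ** axis j (axis k u)"])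
  also have "\<dots> = (\<Sum>c\<in>UNIV. if c = k then X $ a $ j * u * Y $ c $ b else 0)"
    by (intro sum.cong refl) (simp add: mult_unit)
  finally show ?thesis by simp
qed

lemma pd_gramdet:
  assumes "r > 0"
  shows "pd H (\<lambda>m. gramdet (m - mat z) r) m = gramdet (m - mat z) r * (2 * Re (trace (regularized_inverse (m - mat z) r ** H)))"
  by (rule pd_eq[OF gramdet_has_derivative[OF assms]])

text \<open>
  The product rule for \<open>p \<cdot> 2 Re tr(K H)\<close> with \<open>K = (A\<^sup>* A + r)\<^sup>-\<^sup>1 A\<^sup>*\<close>.  In the direction of a matrix unit all traces
  collapse to products of single entries.
\<close>

lemma pd_pd_gramdet_unit:
  fixes m :: "complex^'n^'n" and j k :: 'n and u z :: complex
  assumes "r > 0"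
  defines "E \<equiv> axis j (axis k u)"
  defines "A \<equiv> m - mat z"
  shows "pd E (pd E (\<lambda>m. gramdet (m - mat z) r)) m = gramdet A r *
    (4 * (Re (regularized_inverse A r $ k $ j * u))\<^sup>2
     + 2 * Re ((cmod u)\<^sup>2 * (matrix_inv (gram A r) $ k $ k * (1 - (A ** matrix_inv (gram A r) ** dagger A) $ j $ j))
               - (regularized_inverse A r $ k $ j * u)\<^sup>2))"
proof -
  let ?G = "matrix_inv (gram A r)" and ?K = "regularized_inverse A r"
  let ?dK = "?G ** dagger E - ?G ** (dagger A ** E + dagger E ** A) ** ?K"
  have "((\<lambda>m. Re (trace (regularized_inverse (m - mat z) r ** E))) has_derivative (\<lambda>H. Re (trace ((?G ** dagger H - ?G ** (dagger A ** H + dagger H ** A) ** ?K) ** E)))) (at m)"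
    unfolding A_def
    by (rule bounded_linear.has_derivative[OF bounded_linear_Re bounded_linear.has_derivative[OF bounded_linear_trace
        bounded_linear.has_derivative[OF bounded_bilinear.bounded_linear_left[OF bounded_bilinear_matrix_mult] regularized_inverse_has_derivative[OF assms(1)]]]])
  from has_derivative_mult[OF gramdet_has_derivative[OF assms(1), of z m] has_derivative_mult_right[OF this, of 2], folded A_def]
  have "((\<lambda>m. gramdet (m - mat z) r * (2 * Re (trace (regularized_inverse (m - mat z) r ** E)))) has_derivative
    (\<lambda>H. gramdet A r * (2 * Re (trace ((?G ** dagger H - ?G ** (dagger A ** H + dagger H ** A) ** ?K) ** E)))
      + gramdet A r * (2 * Re (trace (?K ** H))) * (2 * Re (trace (?K ** E))))) (at m)" .
  from pd_eq[OF this, of E] have 1: "pd E (pd E (\<lambda>m. gramdet (m - mat z) r)) m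
      = gramdet A r * (2 * Re (trace (?dK ** E)) + 4 * (Re (trace (?K ** E)))\<^sup>2)"
    unfolding pd_gramdet[OF assms(1), abs_def] by (simp add: power2_eq_square algebra_simps)
  have K: "trace (?K ** E) = ?K $ k $ j * u" by (simp add: E_def trace_mult_unit)
  have a: "?G ** (dagger A ** E + dagger E ** A) ** ?K = ?K ** E ** ?K + ?G ** dagger E ** (A ** ?G ** dagger A)"
    by (simp add: regularized_inverse_def matrix_add_ldistrib bounded_bilinear.add_left[OF bounded_bilinear_matrix_mult] matrix_mul_assoc)
  have "trace (?dK ** E) = ?dK $ k $ j * u" unfolding E_def by (rule trace_mult_unit)
  also have "?dK $ k $ j = ?G $ k $ k * cnj u - (?K $ k $ j * u * ?K $ k $ j + ?G $ k $ k * cnj u * (A ** ?G ** dagger A) $ j $ j)"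
    unfolding a by (simp add: E_def dagger_unit mult_unit mult_unit_mult)
  also have "(\<dots>) * u = (cmod u)\<^sup>2 * (?G $ k $ k * (1 - (A ** ?G ** dagger A) $ j $ j)) - (?K $ k $ j * u)\<^sup>2"
    unfolding complex_norm_square by (simp add: power2_eq_square algebra_simps)
  finally show ?thesis unfolding 1 K by (simp add: add.commute)
qed

text \<open>
  In the sum over the directions \<open>1\<close> and \<open>\<i>\<close> of an entry, the terms \<open>(K u)\<^sup>2\<close> cancel, while the sums of \<open>|u|\<^sup>2\<close> and
  of \<open>(Re (K u))\<^sup>2\<close> are \<open>2\<close> and \<open>|K|\<^sup>2\<close>.  The remaining double sum over the entries factors into the trace of
  \<open>G\<close> and the trace of \<open>1 - A G A\<^sup>*\<close>, which is \<open>r\<close> times the trace of \<open>G\<close>.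
\<close>

lemma laplace_gramdet:
  fixes z :: complex
  assumes "r > 0"
  defines "f \<equiv> (\<lambda>m :: complex^'n^'n. gramdet (m - mat z) r)"
  shows "laplace f m = 4 * f m * (trace_inv (m - mat z) r - r * trace_inv_sq (m - mat z) r + r * (trace_inv (m - mat z) r)\<^sup>2)"
proof -
  let ?A = "m - mat z"
  let ?G = "matrix_inv (gram ?A r)" and ?K = "regularized_inverse ?A r" and ?B = "?A ** matrix_inv (gram ?A r) ** dagger ?A"
  have sq: "(Re (x * 1))\<^sup>2 + (Re (x * \<i>))\<^sup>2 = (cmod x)\<^sup>2" for x
    by (simp add: cmod_power2)
  have "laplace f m = (\<Sum>j\<in>UNIV. \<Sum>k\<in>UNIV. f m * (4 * (cmod (?K $ k $ j))\<^sup>2 + 4 * Re (?G $ k $ k * (1 - ?B $ j $ j))))"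
    unfolding laplace_def sum_Basis_complex_matrix f_def pd_pd_gramdet_unit[OF assms(1)]
    by (intro sum.cong refl) (simp add: sq[symmetric] algebra_simps power_mult_distrib)
  also have "\<dots> = 4 * f m * ((\<Sum>j\<in>UNIV. \<Sum>k\<in>UNIV. (cmod (?K $ k $ j))\<^sup>2) + (\<Sum>j\<in>UNIV. \<Sum>k\<in>UNIV. Re (?G $ k $ k * (1 - ?B $ j $ j))))"
    by (simp add: sum_distrib_left[symmetric] sum.distrib)
  also have "(\<Sum>j\<in>UNIV. \<Sum>k\<in>UNIV. Re (?G $ k $ k * (1 - ?B $ j $ j))) = Re (trace ?G * (\<Sum>j\<in>UNIV. 1 - ?B $ j $ j))"
    by (subst sum.swap) (simp only: trace_def sum_product Re_sum)
  also have "(\<Sum>j\<in>UNIV. 1 - ?B $ j $ j) = complex_of_real (r * trace_inv ?A r)"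
  proof -
    have "(\<Sum>j\<in>UNIV. 1 - ?B $ j $ j) = of_nat CARD('n) - trace ?B" by (simp add: sum_subtractf trace_def)
    then show ?thesis by (simp add: trace_conj_gram_inv[OF assms(1)])
  qed
  finally show ?thesis by (simp add: regularized_inverse_norm[OF assms(1)] trace_gram_inv[OF assms(1)]) (simp add: power2_eq_square mult_ac)
qed

lemma grad_square_gramdet:
  fixes z :: complex
  assumes "r > 0"
  defines "f \<equiv> (\<lambda>m :: complex^'n^'n. gramdet (m - mat z) r)"
  shows "(\<Sum>b\<in>Basis. pd b f m * pd b f m) = 4 * (f m)\<^sup>2 * (trace_inv (m - mat z) r - r * trace_inv_sq (m - mat z) r)"
proof -
  have sq: "(F * (2 * Re (x * 1))) * (F * (2 * Re (x * 1))) + (F * (2 * Re (x * \<i>))) * (F * (2 * Re (x * \<i>)))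
      = 4 * F\<^sup>2 * (cmod x)\<^sup>2" for F x
    unfolding cmod_power2 by (simp add: power2_eq_square algebra_simps)
  have "(\<Sum>b\<in>Basis. pd b f m * pd b f m) = (\<Sum>j\<in>UNIV. \<Sum>k\<in>UNIV. 4 * (f m)\<^sup>2 * (cmod (regularized_inverse (m - mat z) r $ k $ j))\<^sup>2)"
    unfolding sum_Basis_complex_matrix f_def pd_gramdet[OF assms(1)]
    by (simp only: trace_mult_unit sq)
  also have "\<dots> = 4 * (f m)\<^sup>2 * (trace_inv (m - mat z) r - r * trace_inv_sq (m - mat z) r)"
    by (simp only: sum_distrib_left[symmetric] regularized_inverse_norm[OF assms(1)])
  finally show ?thesis .
qed

lemma pd_chain:
  assumes "tame (Suc k) f" "(\<phi> has_real_derivative d) (at (f x))"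
  shows "pd b (\<lambda>x. \<phi> (f x)) x = d * pd b f x"
  by (rule pd_eq) (rule has_derivative_compose[OF tame_has_derivative[OF assms(1)] assms(2)[unfolded has_field_derivative_def]])

text \<open>
  This transfers the Laplacian and gradient of the determinant to its square root and its logarithm.
\<close>

lemma laplace_chain:
  fixes f :: "'v::euclidean_space \<Rightarrow> real"
  assumes f: "tame 2 f" and d1: "\<And>x. (\<phi> has_real_derivative \<phi>' (f x)) (at (f x))"
    and d2: "(\<phi>' has_real_derivative \<phi>'') (at (f x))"
  shows "laplace (\<lambda>x. \<phi> (f x)) x = \<phi>' (f x) * laplace f x + \<phi>'' * (\<Sum>b\<in>Basis. pd b f x * pd b f x)"
proof -
  have f': "tame (Suc (Suc 0)) f" using f by (simp only: numeral_2_eq_2)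
  have "pd b (pd b (\<lambda>x. \<phi> (f x))) x = \<phi>' (f x) * pd b (pd b f) x + \<phi>'' * (pd b f x * pd b f x)" if b: "b \<in> Basis" for b
  proof -
    have "pd b (\<lambda>x. \<phi> (f x)) = (\<lambda>x. \<phi>' (f x) * pd b f x)" using pd_chain[OF f' d1] by blast
    moreover have "((\<lambda>x. \<phi>' (f x) * pd b f x) has_derivative (\<lambda>h. \<phi>' (f x) * pd h (pd b f) x + \<phi>'' * pd h f x * pd b f x)) (at x)"
      by (rule has_derivative_mult[OF has_derivative_compose[OF tame_has_derivative[OF f'] d2[unfolded has_field_derivative_def]]
          tame_has_derivative[OF tame_pd[OF f' b]]])
    ultimately show ?thesis using pd_eq by fastforce
  qed
  then show ?thesis unfolding laplace_def by (simp add: sum.distrib sum_distrib_left)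
qed

section \<open>Derivatives in the regularization parameter\<close>

lemma gram_r_has_derivative: "((\<lambda>r. gram A r) has_derivative (\<lambda>s. mat (complex_of_real s))) (at r)"
proof -
  have "bounded_linear (\<lambda>s. mat (complex_of_real s) :: complex^'n^'n)"
    unfolding linear_conv_bounded_linear[symmetric] linear_iff
    by (auto simp: mat_def vec_eq_iff of_real_def scaleR_add_left)
  then show ?thesis unfolding gram_def
    by (auto intro!: derivative_eq_intros bounded_linear_imp_has_derivative)
qed

lemma gramdet_r_deriv:
  assumes "r > 0" shows "((\<lambda>r. gramdet A r) has_real_derivative gramdet A r * trace_inv A r) (at r)"
proof -
  have "((\<lambda>r. Re (det (gram A r))) has_derivative (\<lambda>s. Re (det (gram A r) * trace (matrix_inv (gram A r) ** mat (complex_of_real s))))) (at r)"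
    by (rule bounded_linear.has_derivative[OF bounded_linear_Re
        has_derivative_compose[OF gram_r_has_derivative det_has_derivative[OF det_gram_nonzero[OF assms]]]])
  moreover have "Re (det (gram A r) * trace (matrix_inv (gram A r) ** mat (complex_of_real s))) = gramdet A r * trace_inv A r * s" for s
    by (simp add: of_real_gramdet[symmetric] trace_mat_mult trace_gram_inv[OF assms])
  ultimately show ?thesis unfolding has_field_derivative_def gramdet_def[symmetric] by (simp add: mult_commute_abs)
qed

lemma trace_inv_r_deriv:
  assumes "r > 0" shows "((\<lambda>r. trace_inv A r) has_real_derivative - trace_inv_sq A r) (at r)"
proof -
  let ?G = "matrix_inv (gram A r)"
  have "((\<lambda>r. Re (trace (matrix_inv (gram A r)))) has_derivative (\<lambda>s. Re (trace (- (?G ** mat (complex_of_real s) ** ?G))))) (at r)"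
    by (rule bounded_linear.has_derivative[OF bounded_linear_Re bounded_linear.has_derivative[OF bounded_linear_trace
        has_derivative_compose[OF gram_r_has_derivative matrix_inv_has_derivative[OF det_gram_nonzero[OF assms]]]]])
  moreover have eq: "Re (trace (- (?G ** mat (complex_of_real s) ** ?G))) = s * - trace_inv_sq A r" for s
  proof -
    have "?G ** mat (complex_of_real s) ** ?G = (?G ** ?G) ** mat (complex_of_real s)"
      by (simp only: matrix_mul_assoc[symmetric] mat_mult_commute)
    then show ?thesis
      by (simp add: linear_neg[OF bounded_linear.linear[OF bounded_linear_trace]] trace_mat_mult trace_inv_sq_def mult.commute)
  qed
  ultimately show ?thesis unfolding has_field_derivative_def by (simp only: eq trace_inv_def[symmetric] mult_commute_abs)
qed

lemma cmod_square_has_derivative: "((\<lambda>w. (cmod w)\<^sup>2) has_derivative (\<lambda>h. 2 * (w \<bullet> h))) (at w)"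
  unfolding power2_norm_eq_inner by (auto intro!: derivative_eq_intros simp: inner_commute)

lemma radial_has_derivative:
  assumes "(\<phi> has_real_derivative d) (at ((cmod w)\<^sup>2))"
  shows "((\<lambda>w. complex_of_real (\<phi> ((cmod w)\<^sup>2))) has_derivative (\<lambda>h. complex_of_real (d * (2 * (w \<bullet> h))))) (at w)"
  by (rule bounded_linear.has_derivative[OF bounded_linear_of_real
      has_derivative_compose[OF cmod_square_has_derivative assms[unfolded has_field_derivative_def]]])

lemma wirtinger_radial:
  assumes "(\<phi> has_real_derivative d) (at ((cmod w)\<^sup>2))"
  shows "wirtinger (\<lambda>w. complex_of_real (\<phi> ((cmod w)\<^sup>2))) w = of_real d * cnj w"
    "wirtinger_bar (\<lambda>w. complex_of_real (\<phi> ((cmod w)\<^sup>2))) w = of_real d * w"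
  unfolding wirtinger_def wirtinger_bar_def frechet_derivative_at[OF radial_has_derivative[OF assms], symmetric]
  by (simp_all add: complex_eq_iff inner_complex_def)

text \<open>
  For radial functions \<open>\<partial>\<phi>/\<partial>w' = \<phi>'(|w|\<^sup>2) w\<close>, where \<open>w'\<close> is the conjugate of \<open>w\<close>; differentiating once more
  requires this formula in a neighbourhood, which is where \<open>w \<noteq> 0\<close> is used.
\<close>

lemma wirtinger_wirtinger_bar_radial:
  assumes w: "w \<noteq> 0" and d1: "\<And>\<rho>. \<rho> > 0 \<Longrightarrow> (\<phi> has_real_derivative \<phi>' \<rho>) (at \<rho>)"
    and d2: "(\<phi>' has_real_derivative d) (at ((cmod w)\<^sup>2))"
  shows "wirtinger (wirtinger_bar (\<lambda>w. complex_of_real (\<phi> ((cmod w)\<^sup>2)))) w = of_real (\<phi>' ((cmod w)\<^sup>2) + (cmod w)\<^sup>2 * d)"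
proof -
  let ?g = "\<lambda>v. of_real (\<phi>' ((cmod v)\<^sup>2)) * v"
  let ?D = "\<lambda>h. of_real (\<phi>' ((cmod w)\<^sup>2)) * h + complex_of_real (d * (2 * (w \<bullet> h))) * w"
  have "(?g has_derivative ?D) (at w)"
    by (rule has_derivative_mult[OF radial_has_derivative[OF d2] has_derivative_ident])
  then have "(wirtinger_bar (\<lambda>w. complex_of_real (\<phi> ((cmod w)\<^sup>2))) has_derivative ?D) (at w)"
  proof (rule has_derivative_transform_within_open[of _ _ w UNIV "- {0}"])
    fix v :: complex assume "v \<in> - {0}"
    then show "?g v = wirtinger_bar (\<lambda>w. complex_of_real (\<phi> ((cmod w)\<^sup>2))) v"
      using wirtinger_radial(2)[OF d1, of v] by simp
  qed (use w in auto)
  then have D: "frechet_derivative (wirtinger_bar (\<lambda>w. complex_of_real (\<phi> ((cmod w)\<^sup>2)))) (at w) = ?D"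
    using frechet_derivative_at by metis
  show ?thesis
    unfolding wirtinger_def D using cmod_power2[of w] by (simp add: complex_eq_iff inner_complex_def power2_eq_square algebra_simps)
qed

section \<open>The three random fields\<close>

lemma Delta2_eq_gramdet: "Delta2 z w m = gramdet (m - mat z) ((cmod w)\<^sup>2)"
  by (simp add: Delta2_def gramdet_def hhat_eq_gram)

lemma Delta_eq_gramdet: "Delta z w m = sqrt (gramdet (m - mat z) ((cmod w)\<^sup>2))"
  by (simp add: Delta_def Delta2_eq_gramdet)

lemma Psi_eq_gramdet: "Psi z w (m :: complex^'n^'n) = ln (gramdet (m - mat z) ((cmod w)\<^sup>2)) / (2 * CARD('n))"
  by (simp add: Psi_def Delta2_eq_gramdet)

lemma gramdet_bounds:
  assumes "w \<noteq> (0::complex)"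
  obtains c where "c > 0" "\<And>m :: complex^'n^'n. gramdet (m - mat z) ((cmod w)\<^sup>2) \<ge> c"
proof
  have r: "(cmod w)\<^sup>2 > 0" using assms by simp
  then show "((cmod w)\<^sup>2) ^ CARD('n) / fact CARD('n) > 0" by simp
  show "gramdet (m - mat z) ((cmod w)\<^sup>2) \<ge> ((cmod w)\<^sup>2) ^ CARD('n) / fact CARD('n)" for m :: "complex^'n^'n"
    by (rule gramdet_lower_bound[OF r])
qed

lemma tame_Delta2: "tame k (Delta2 z w :: complex^'n^'n \<Rightarrow> real)"
  unfolding Delta2_eq_gramdet[abs_def] by (rule tame_gramdet)

lemma tame_Delta:
  assumes "w \<noteq> 0" shows "tame k (Delta z w :: complex^'n^'n \<Rightarrow> real)"
  unfolding Delta_eq_gramdet[abs_def]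
  by (rule gramdet_bounds[OF assms]) (rule tame_sqrt[OF tame_gramdet])

lemma tame_Psi:
  assumes "w \<noteq> 0" shows "tame k (Psi z w :: complex^'n^'n \<Rightarrow> real)"
proof -
  obtain c where "c > 0" "\<And>m :: complex^'n^'n. gramdet (m - mat z) ((cmod w)\<^sup>2) \<ge> c"
    by (rule gramdet_bounds[OF assms]) blast
  then have "tame k (\<lambda>m :: complex^'n^'n. 1 / (2 * CARD('n)) * ln (gramdet (m - mat z) ((cmod w)\<^sup>2)))"
    by (intro tame_cmult tame_ln[OF tame_gramdet])
  then show ?thesis unfolding Psi_eq_gramdet[abs_def] by simp
qed

lemma sqrt_deriv: "p > 0 \<Longrightarrow> (sqrt has_real_derivative inverse (sqrt p) / 2) (at p)"
  by (rule DERIV_real_sqrt)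

lemma inverse_sqrt_deriv: "p > 0 \<Longrightarrow> ((\<lambda>p. inverse (sqrt p) / 2) has_real_derivative - (inverse (sqrt p) / (4 * p))) (at p)"
  by (auto intro!: derivative_eq_intros simp: field_simps power2_eq_square)

lemma laplace_Delta2:
  assumes "w \<noteq> 0"
  defines "r \<equiv> (cmod w)\<^sup>2"
  shows "laplace (Delta2 z w) m = 4 * Delta2 z w m * (trace_inv (m - mat z) r - r * trace_inv_sq (m - mat z) r + r * (trace_inv (m - mat z) r)\<^sup>2)"
  using laplace_gramdet[of r z m] assms by (simp add: Delta2_eq_gramdet[abs_def])

lemma laplace_Delta:
  assumes "w \<noteq> 0"
  defines "r \<equiv> (cmod w)\<^sup>2"
  shows "laplace (Delta z w) m = Delta z w m * (trace_inv (m - mat z) r - r * trace_inv_sq (m - mat z) r + 2 * r * (trace_inv (m - mat z) r)\<^sup>2)"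
proof -
  have r: "r > 0" using assms by simp
  define p where "p = gramdet (m - mat z) r"
  have p: "p > 0" "gramdet (m - mat z) r > 0" for m by (auto simp: p_def gramdet_positive[OF r])
  have ss: "sqrt p * sqrt p = p" using p by simp
  have "laplace (Delta z w) m = inverse (sqrt p) / 2 * (4 * p * (trace_inv (m - mat z) r - r * trace_inv_sq (m - mat z) r + r * (trace_inv (m - mat z) r)\<^sup>2))
      + - (inverse (sqrt p) / (4 * p)) * (4 * p\<^sup>2 * (trace_inv (m - mat z) r - r * trace_inv_sq (m - mat z) r))"
    unfolding Delta_eq_gramdet[abs_def] r_def[symmetric]
    by (subst laplace_chain[OF tame_gramdet sqrt_deriv inverse_sqrt_deriv])
       (simp_all only: p laplace_gramdet[OF r] grad_square_gramdet[OF r] p_def)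
  also have "\<dots> = sqrt p * (trace_inv (m - mat z) r - r * trace_inv_sq (m - mat z) r + 2 * r * (trace_inv (m - mat z) r)\<^sup>2)"
  proof -
    have "inverse (sqrt p) * p = sqrt p" using p(1) ss by (simp add: field_simps)
    moreover have "inverse (sqrt p) / (4 * p) * (4 * p\<^sup>2 * x) = inverse (sqrt p) * p * x" for x
      using p(1) by (simp add: power2_eq_square field_simps)
    moreover have "inverse (sqrt p) / 2 * (4 * p * x) = inverse (sqrt p) * p * (2 * x)" for x by simp
    ultimately show ?thesis by (simp only: minus_mult_left[symmetric]) (simp add: algebra_simps)
  qed
  finally show ?thesis by (simp add: Delta_eq_gramdet p_def r_def)
qed

lemma laplace_Psi:
  assumes "w \<noteq> 0"
  defines "r \<equiv> (cmod w)\<^sup>2"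
  shows "laplace (Psi z w) (m :: complex^'n^'n) = 4 * r * (trace_inv (m - mat z) r)\<^sup>2 / (2 * CARD('n))"
proof -
  have r: "r > 0" using assms by simp
  define p where "p = gramdet (m - mat z) r"
  define c where "c = real (2 * CARD('n))"
  have p: "p > 0" "gramdet (m - mat z) r > 0" for m :: "complex^'n^'n" by (auto simp: p_def gramdet_positive[OF r])
  have d1: "((\<lambda>p. ln p / c) has_real_derivative 1 / (c * p)) (at p)" if "p > 0" for p
    using that by (auto intro!: derivative_eq_intros simp: c_def field_simps)
  have d2: "((\<lambda>p. 1 / (c * p)) has_real_derivative - (1 / (c * p\<^sup>2))) (at p)" if "p > 0" for p
    using that by (auto intro!: derivative_eq_intros simp: c_def field_simps power2_eq_square)
  have "laplace (Psi z w) m = 1 / (c * p) * (4 * p * (trace_inv (m - mat z) r - r * trace_inv_sq (m - mat z) r + r * (trace_inv (m - mat z) r)\<^sup>2))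
      + - (1 / (c * p\<^sup>2)) * (4 * p\<^sup>2 * (trace_inv (m - mat z) r - r * trace_inv_sq (m - mat z) r))"
    unfolding Psi_eq_gramdet[abs_def] r_def[symmetric] c_def[symmetric]
    by (subst laplace_chain[OF tame_gramdet d1 d2])
       (simp_all only: p laplace_gramdet[OF r] grad_square_gramdet[OF r] p_def)
  also have "\<dots> = 4 * r * (trace_inv (m - mat z) r)\<^sup>2 / c"
  proof -
    have "1 / (c * p) * (4 * p * x) = 4 * x / c" "1 / (c * p\<^sup>2) * (4 * p\<^sup>2 * x) = 4 * x / c" for x
      using p(1) by (simp_all add: c_def)
    then show ?thesis by (simp only: minus_mult_left[symmetric]) (simp add: c_def field_simps)
  qed
  finally show ?thesis by (simp add: c_def)
qed

lemma pd_Psi: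
  assumes "w \<noteq> 0"
  shows "pd h (Psi z w) (m :: complex^'n^'n) = Re (trace (regularized_inverse (m - mat z) ((cmod w)\<^sup>2) ** h)) / CARD('n)"
proof -
  have r: "(cmod w)\<^sup>2 > 0" using assms by simp
  let ?p = "gramdet (m - mat z) ((cmod w)\<^sup>2)"
  have p: "?p > 0" by (rule gramdet_positive[OF r])
  have "((\<lambda>p. ln p / (2 * CARD('n))) has_real_derivative 1 / (2 * CARD('n) * ?p)) (at ?p)"
    using p by (auto intro!: derivative_eq_intros simp: field_simps)
  from pd_chain[OF tame_gramdet this] show ?thesis
    unfolding Psi_eq_gramdet[abs_def] using p by (simp add: pd_gramdet[OF r])
qed

text \<open>
  The gradients of the three fields are proportional to each other, because the fields are functions of the same
  determinant.  This is the source of the relations between their martingale parts.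
\<close>

lemma pd_Delta2:
  assumes "w \<noteq> 0"
  shows "pd h (Delta2 z w) (m :: complex^'n^'n) = 2 * CARD('n) * Delta2 z w m * pd h (Psi z w) m"
  using pd_gramdet[of "(cmod w)\<^sup>2" h z m] assms unfolding pd_Psi[OF assms]
  by (simp add: Delta2_eq_gramdet[abs_def])

lemma pd_Delta:
  assumes "w \<noteq> 0"
  shows "pd h (Delta z w) (m :: complex^'n^'n) = CARD('n) * Delta z w m * pd h (Psi z w) m"
proof -
  have r: "(cmod w)\<^sup>2 > 0" using assms by simp
  let ?p = "gramdet (m - mat z) ((cmod w)\<^sup>2)"
  have p: "?p > 0" by (rule gramdet_positive[OF r])
  have "inverse (sqrt ?p) * ?p = sqrt ?p"
    using p real_sqrt_mult_self[of ?p] by (simp add: field_simps)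
  then have "inverse (sqrt ?p) / 2 * (?p * (2 * x)) = sqrt ?p * x" for x
    by (simp add: mult.assoc[symmetric])
  then show ?thesis
    using pd_chain[OF tame_gramdet sqrt_deriv[OF p]] unfolding pd_Psi[OF assms]
    by (simp add: Delta_eq_gramdet[abs_def] pd_gramdet[OF r])
qed

text \<open>
  Follows from the squared gradient of the determinant, as the two gradients are proportional.
\<close>

lemma grad_square_Psi:
  assumes "w \<noteq> 0"
  defines "r \<equiv> (cmod w)\<^sup>2"
  shows "(\<Sum>b\<in>Basis. pd b (Psi z w) (m :: complex^'n^'n) * pd b (Psi z w) m) = (trace_inv (m - mat z) r - r * trace_inv_sq (m - mat z) r) / (CARD('n))\<^sup>2"
proof -
  have r: "r > 0" using assms by simp
  have p: "gramdet (m - mat z) r > 0" by (rule gramdet_positive[OF r])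
  let ?c = "2 * CARD('n) * gramdet (m - mat z) r"
  have "pd b (\<lambda>m. gramdet (m - mat z) r) m = ?c * pd b (Psi z w) m" for b
    using pd_Delta2[OF assms(1), of b z m] by (simp add: Delta2_eq_gramdet[abs_def] r_def)
  then have "?c\<^sup>2 * (\<Sum>b\<in>Basis. pd b (Psi z w) m * pd b (Psi z w) m)
      = (\<Sum>b\<in>Basis. pd b (\<lambda>m. gramdet (m - mat z) r) m * pd b (\<lambda>m. gramdet (m - mat z) r) m)"
    by (simp add: sum_distrib_left power2_eq_square mult_ac)
  also have "\<dots> = ?c\<^sup>2 * ((trace_inv (m - mat z) r - r * trace_inv_sq (m - mat z) r) / (CARD('n))\<^sup>2)"
    unfolding grad_square_gramdet[OF r] by (simp add: power_mult_distrib)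
  finally have "?c\<^sup>2 * (\<Sum>b\<in>Basis. pd b (Psi z w) m * pd b (Psi z w) m)
      = ?c\<^sup>2 * ((trace_inv (m - mat z) r - r * trace_inv_sq (m - mat z) r) / (CARD('n))\<^sup>2)" .
  moreover have "?c\<^sup>2 \<noteq> 0" using p by simp
  ultimately show ?thesis by (simp only: mult_cancel_left simp_thms)
qed

lemma wirtinger_Delta2:
  fixes m :: "complex^'n^'n" and z w :: complex
  assumes "w \<noteq> 0"
  defines "r \<equiv> (cmod w)\<^sup>2" and "A \<equiv> m - mat z"
  shows "laplacian (\<lambda>w. complex_of_real (Delta2 z w m)) w
    = of_real (4 * (Delta2 z w m * (trace_inv A r - r * trace_inv_sq A r + r * (trace_inv A r)\<^sup>2)))"
proof -
  have r: "r > 0" using assms by simp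
  have d2: "((\<lambda>\<rho>. gramdet A \<rho> * trace_inv A \<rho>) has_real_derivative gramdet A r * (- trace_inv_sq A r) + gramdet A r * trace_inv A r * trace_inv A r) (at ((cmod w)\<^sup>2))"
    unfolding r_def[symmetric] by (rule DERIV_mult'[OF gramdet_r_deriv[OF r] trace_inv_r_deriv[OF r]])
  have dd: "wirtinger (wirtinger_bar (\<lambda>w. complex_of_real (gramdet A ((cmod w)\<^sup>2)))) w
      = of_real (gramdet A ((cmod w)\<^sup>2) * trace_inv A ((cmod w)\<^sup>2) + (cmod w)\<^sup>2 * (gramdet A r * (- trace_inv_sq A r) + gramdet A r * trace_inv A r * trace_inv A r))"
    by (rule wirtinger_wirtinger_bar_radial[OF assms(1) _ d2]) (rule gramdet_r_deriv)
  show ?thesis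
    unfolding laplacian_def Delta2_eq_gramdet A_def[symmetric] dd r_def[symmetric]
    by (simp add: algebra_simps power2_eq_square)
qed

lemma wirtinger_Delta:
  fixes m :: "complex^'n^'n" and z w :: complex
  assumes "w \<noteq> 0"
  defines "r \<equiv> (cmod w)\<^sup>2" and "A \<equiv> m - mat z"
  shows "wirtinger (\<lambda>w. complex_of_real (Delta z w m)) w = of_real (Delta z w m * trace_inv A r / 2) * cnj w"
    "wirtinger (wirtinger_bar (\<lambda>w. complex_of_real (Delta z w m))) w
    = of_real (Delta z w m * (trace_inv A r / 2 - r * trace_inv_sq A r / 2 + r * (trace_inv A r)\<^sup>2 / 4))"
proof -
  have r: "r > 0" using assms by simp
  have d1: "((\<lambda>\<rho>. sqrt (gramdet A \<rho>)) has_real_derivative sqrt (gramdet A \<rho>) * trace_inv A \<rho> / 2) (at \<rho>)" if \<rho>: "\<rho> > 0" for \<rho>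
  proof -
    have p: "gramdet A \<rho> > 0" by (rule gramdet_positive[OF \<rho>])
    have "inverse (sqrt (gramdet A \<rho>)) * gramdet A \<rho> = sqrt (gramdet A \<rho>)"
      using p real_sqrt_mult_self[of "gramdet A \<rho>"] by (simp add: field_simps)
    then have "inverse (sqrt (gramdet A \<rho>)) / 2 * (gramdet A \<rho> * trace_inv A \<rho>) = sqrt (gramdet A \<rho>) * trace_inv A \<rho> / 2"
      by (simp add: mult.assoc[symmetric])
    then show ?thesis using DERIV_chain2[OF sqrt_deriv[OF p] gramdet_r_deriv[OF \<rho>]] by (simp only:)
  qed
  have d2: "((\<lambda>\<rho>. sqrt (gramdet A \<rho>) * trace_inv A \<rho> / 2) has_real_derivative
      (sqrt (gramdet A r) * (- trace_inv_sq A r) + sqrt (gramdet A r) * trace_inv A r / 2 * trace_inv A r) / 2) (at ((cmod w)\<^sup>2))"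
    unfolding r_def[symmetric] by (rule DERIV_cdivide[OF DERIV_mult'[OF d1[OF r] trace_inv_r_deriv[OF r]]])
  show "wirtinger (\<lambda>w. complex_of_real (Delta z w m)) w = of_real (Delta z w m * trace_inv A r / 2) * cnj w"
    unfolding Delta_eq_gramdet A_def[symmetric] r_def
    by (rule wirtinger_radial(1)[OF d1]) (use assms in simp)
  have dd: "wirtinger (wirtinger_bar (\<lambda>w. complex_of_real (sqrt (gramdet A ((cmod w)\<^sup>2))))) w
      = of_real (sqrt (gramdet A ((cmod w)\<^sup>2)) * trace_inv A ((cmod w)\<^sup>2) / 2
        + (cmod w)\<^sup>2 * ((sqrt (gramdet A r) * (- trace_inv_sq A r) + sqrt (gramdet A r) * trace_inv A r / 2 * trace_inv A r) / 2))"
    by (rule wirtinger_wirtinger_bar_radial[OF assms(1) _ d2]) (rule d1)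
  show "wirtinger (wirtinger_bar (\<lambda>w. complex_of_real (Delta z w m))) w
    = of_real (Delta z w m * (trace_inv A r / 2 - r * trace_inv_sq A r / 2 + r * (trace_inv A r)\<^sup>2 / 4))"
    unfolding Delta_eq_gramdet A_def[symmetric] dd r_def[symmetric]
    by (rule arg_cong[where f = complex_of_real]) (simp add: field_simps power2_eq_square)
qed

lemma wirtinger_Psi:
  fixes m :: "complex^'n^'n" and z w :: complex
  assumes "w \<noteq> 0"
  defines "r \<equiv> (cmod w)\<^sup>2" and "A \<equiv> m - mat z"
  shows "wirtinger (\<lambda>w. complex_of_real (Psi z w m)) w = of_real (trace_inv A r / (2 * CARD('n))) * cnj w"
    "laplacian (\<lambda>w. complex_of_real (Psi z w m)) w = of_real (4 * ((trace_inv A r - r * trace_inv_sq A r) / (2 * CARD('n))))"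
proof -
  have r: "r > 0" using assms by simp
  define c where "c = real (2 * CARD('n))"
  have c: "c > 0" by (simp add: c_def)
  have d1: "((\<lambda>\<rho>. ln (gramdet A \<rho>) / c) has_real_derivative trace_inv A \<rho> / c) (at \<rho>)" if \<rho>: "\<rho> > 0" for \<rho>
  proof -
    have p: "gramdet A \<rho> > 0" by (rule gramdet_positive[OF \<rho>])
    have "1 / gramdet A \<rho> * (gramdet A \<rho> * trace_inv A \<rho>) = trace_inv A \<rho>" using p by simp
    then show ?thesis
      using DERIV_cdivide[OF DERIV_chain2[OF DERIV_ln_divide[OF p] gramdet_r_deriv[OF \<rho>]], of c] by (simp only:)
  qed
  have d2: "((\<lambda>\<rho>. trace_inv A \<rho> / c) has_real_derivative (- trace_inv_sq A r) / c) (at ((cmod w)\<^sup>2))"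
    unfolding r_def[symmetric] by (rule DERIV_cdivide[OF trace_inv_r_deriv[OF r]])
  show "wirtinger (\<lambda>w. complex_of_real (Psi z w m)) w = of_real (trace_inv A r / (2 * CARD('n))) * cnj w"
    unfolding Psi_eq_gramdet A_def[symmetric] r_def c_def[symmetric]
    by (rule wirtinger_radial(1)[OF d1]) (use assms in simp)
  have dd: "wirtinger (wirtinger_bar (\<lambda>w. complex_of_real (ln (gramdet A ((cmod w)\<^sup>2)) / c))) w
      = of_real (trace_inv A ((cmod w)\<^sup>2) / c + (cmod w)\<^sup>2 * ((- trace_inv_sq A r) / c))"
    by (rule wirtinger_wirtinger_bar_radial[OF assms(1) _ d2]) (rule d1)
  show "laplacian (\<lambda>w. complex_of_real (Psi z w m)) w = of_real (4 * ((trace_inv A r - r * trace_inv_sq A r) / (2 * CARD('n))))"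
    unfolding laplacian_def Psi_eq_gramdet A_def[symmetric] c_def[symmetric] dd r_def[symmetric]
    using c by (simp add: field_simps)
qed

lemma stochastic_gradient_bilinear:
  fixes N :: real
  shows "bounded_bilinear (\<lambda>(K, L) (dM :: complex^'n^'n). 1 / (2 * N) * (trace (K ** dM) + trace (L ** dagger dM)))"
  unfolding bilinear_conv_bounded_bilinear[symmetric] bilinear_def linear_iff
  by (auto simp: matrix_add_ldistrib bounded_bilinear.add_left[OF bounded_bilinear_matrix_mult] trace_add
      linear_add[OF bounded_linear.linear[OF bounded_linear_dagger]] linear_scale[OF bounded_linear.linear[OF bounded_linear_dagger]]
      linear_scale[OF bounded_linear.linear[OF bounded_linear_trace]] matrix_mult_scaleR_left matrix_mult_scaleR_right
      scaleR_conv_of_real[where 'a = complex] add_divide_distrib distrib_left)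

text \<open>
  The two traces are complex conjugates of each other, so the stochastic differential in the theorem is the real
  differential of \<open>\<Psi>\<close>.
\<close>

lemma stochastic_gradient_Psi:
  fixes m :: "complex^'n^'n"
  assumes "w \<noteq> 0"
  shows "1 / (2 * real CARD('n)) *
      (trace (matrix_inv (hhat z w m) ** (dagger m - mat (cnj z)) ** h) + trace ((m - mat z) ** matrix_inv (hhat z w m) ** dagger h))
    = complex_of_real (pd h (Psi z w) m)"
proof -
  let ?A = "m - mat z" and ?r = "(cmod w)\<^sup>2"
  let ?G = "matrix_inv (gram ?A ?r)"
  have r: "?r > 0" using assms by simp
  have A: "dagger m - mat (cnj z) = dagger ?A"
    by (simp add: linear_diff[OF bounded_linear.linear[OF bounded_linear_dagger]] dagger_mat)
  have "?A ** ?G ** dagger h = dagger (h ** regularized_inverse ?A ?r)"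
    by (simp add: regularized_inverse_def dagger_mult dagger_gram_inv[OF r] matrix_mul_assoc)
  then have "trace (?A ** ?G ** dagger h) = cnj (trace (regularized_inverse ?A ?r ** h))"
    by (simp only: trace_dagger trace_mul_sym[of h])
  then have "trace (?G ** dagger ?A ** h) + trace (?A ** ?G ** dagger h) = 2 * complex_of_real (Re (trace (regularized_inverse ?A ?r ** h)))"
    by (simp add: regularized_inverse_def complex_add_cnj)
  then show ?thesis unfolding hhat_eq_gram A pd_Psi[OF assms] by simp
qed

lemma continuous_stochastic_gradient:
  assumes "w \<noteq> 0"
  shows "continuous_on UNIV (\<lambda>m :: complex^'n^'n. (matrix_inv (hhat z w m) ** (dagger m - mat (cnj z)), (m - mat z) ** matrix_inv (hhat z w m)))"
proof -
  let ?r = "(cmod w)\<^sup>2"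
  have r: "?r > 0" using assms by simp
  have "continuous_on UNIV (\<lambda>m :: complex^'n^'n. matrix_inv (gram (m - mat z) ?r))"
  proof (intro continuous_at_imp_continuous_on ballI)
    fix m :: "complex^'n^'n"
    show "isCont (\<lambda>m. matrix_inv (gram (m - mat z) ?r)) m"
      by (rule has_derivative_continuous[OF has_derivative_compose[OF gram_has_derivative
            matrix_inv_has_derivative[OF det_gram_nonzero[OF r]]]])
  qed
  moreover have "continuous_on UNIV (\<lambda>m :: complex^'n^'n. dagger m)"
    by (rule linear_continuous_on[OF bounded_linear_dagger])
  ultimately show ?thesis
    unfolding hhat_eq_gram
    by (intro continuous_on_Pair bounded_bilinear.continuous_on[OF bounded_bilinear_matrix_mult] continuous_intros)
qed

section \<open>The matrix-valued Brownian motion\<close>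

lemma brownian_increment_integrable:
  assumes "prob_space P" "standard_brownian_motion P F B" "0 \<le> s" "s < t"
  shows "(\<lambda>\<omega>. B t \<omega> - B s \<omega>) \<in> borel_measurable P" "integrable P (\<lambda>\<omega>. (B t \<omega> - B s \<omega>)\<^sup>2)"
proof -
  interpret prob_space P by (rule assms)
  have D: "distributed P lborel (\<lambda>\<omega>. B t \<omega> - B s \<omega>) (normal_density 0 (sqrt (t - s)))"
    using assms by (simp add: standard_brownian_motion_def)
  show "(\<lambda>\<omega>. B t \<omega> - B s \<omega>) \<in> borel_measurable P" using distributed_measurable[OF D] by simp
  show "integrable P (\<lambda>\<omega>. (B t \<omega> - B s \<omega>)\<^sup>2)"
    using distributed_integrable[OF D, of "\<lambda>x. x\<^sup>2"] integrable_normal_moment[of "sqrt (t - s)" 0 2] assms by simp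
qed

lemma integrable_product_of_squares:
  fixes X Y :: "'a \<Rightarrow> real"
  assumes "X \<in> borel_measurable M" "Y \<in> borel_measurable M" "integrable M (\<lambda>\<omega>. (X \<omega>)\<^sup>2)" "integrable M (\<lambda>\<omega>. (Y \<omega>)\<^sup>2)"
  shows "integrable M (\<lambda>\<omega>. X \<omega> * Y \<omega>)"
proof (rule Bochner_Integration.integrable_bound)
  show "integrable M (\<lambda>\<omega>. (X \<omega>)\<^sup>2 + (Y \<omega>)\<^sup>2)" using assms by simp
  show "AE \<omega> in M. norm (X \<omega> * Y \<omega>) \<le> norm ((X \<omega>)\<^sup>2 + (Y \<omega>)\<^sup>2)"
  proof (intro AE_I2)
    fix \<omega>
    have "0 \<le> (\<bar>X \<omega>\<bar> - \<bar>Y \<omega>\<bar>)\<^sup>2" by simp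
    then have "2 * (\<bar>X \<omega>\<bar> * \<bar>Y \<omega>\<bar>) \<le> (X \<omega>)\<^sup>2 + (Y \<omega>)\<^sup>2" by (simp add: power2_eq_square algebra_simps)
    moreover have "0 \<le> \<bar>X \<omega>\<bar> * \<bar>Y \<omega>\<bar>" by simp
    ultimately show "norm (X \<omega> * Y \<omega>) \<le> norm ((X \<omega>)\<^sup>2 + (Y \<omega>)\<^sup>2)" by (simp only: real_norm_def abs_mult abs_of_nonneg sum_power2_ge_zero)
  qed
qed (use assms in simp)

text \<open>
  Both factors are measurable functions of single paths, and the paths are independent.
\<close>

lemma independent_processes_increments:
  assumes P: "prob_space P" and ind: "independent_processes P B" and ij: "i \<noteq> j"
    and bm: "\<And>i. standard_brownian_motion P F (B i)"
    and st: "0 \<le> s" "s < t" "0 \<le> u" "u < v"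
  shows "(\<integral>\<omega>. ((B i t \<omega> - B i s \<omega>) * (B i v \<omega> - B i u \<omega>)) * ((B j t \<omega> - B j s \<omega>) * (B j v \<omega> - B j u \<omega>)) \<partial>P)
    = (\<integral>\<omega>. (B i t \<omega> - B i s \<omega>) * (B i v \<omega> - B i u \<omega>) \<partial>P) * (\<integral>\<omega>. (B j t \<omega> - B j s \<omega>) * (B j v \<omega> - B j u \<omega>) \<partial>P)"
proof -
  interpret prob_space P by (rule P)
  let ?path = "\<lambda>i \<omega>. \<lambda>t\<in>{0..}. B i t \<omega>"
  let ?M = "\<lambda>_. \<Pi>\<^sub>M t\<in>{0::real..}. (borel :: real measure)"
  let ?f = "\<lambda>i p. (p i t - p i s) * (p i v - p i u) :: real"
  have ind': "indep_vars ?M ?path UNIV" using ind by (simp add: independent_processes_def)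
  have r: "indep_var (Pi\<^sub>M {i} ?M) (\<lambda>\<omega>. restrict (\<lambda>k. ?path k \<omega>) {i}) (Pi\<^sub>M {j} ?M) (\<lambda>\<omega>. restrict (\<lambda>k. ?path k \<omega>) {j})"
    using ij by (intro indep_var_restrict[OF ind']) auto
  have m: "?f k \<in> borel_measurable (Pi\<^sub>M {k} ?M)" for k
  proof -
    have "(\<lambda>p. p k a) \<in> borel_measurable (Pi\<^sub>M {k} ?M)" if "0 \<le> a" for a
    proof -
      have 1: "(\<lambda>p. p k) \<in> measurable (Pi\<^sub>M {k} ?M) (\<Pi>\<^sub>M t\<in>{0..}. borel)" by (rule measurable_component_singleton) simp
      have 2: "(\<lambda>q. q a) \<in> measurable (\<Pi>\<^sub>M t\<in>{0..}. borel) (borel :: real measure)"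
        by (rule measurable_component_singleton) (use that in simp)
      show ?thesis using measurable_compose[OF 1 2] by simp
    qed
    then show ?thesis using st by (intro borel_measurable_times borel_measurable_diff) auto
  qed
  have i: "integrable P (\<lambda>\<omega>. (B k t \<omega> - B k s \<omega>) * (B k v \<omega> - B k u \<omega>))" for k
    by (intro integrable_product_of_squares brownian_increment_integrable[OF P bm] st)
  have "indep_var borel (?f i \<circ> (\<lambda>\<omega>. restrict (\<lambda>k. ?path k \<omega>) {i})) borel (?f j \<circ> (\<lambda>\<omega>. restrict (\<lambda>k. ?path k \<omega>) {j}))"
    by (rule indep_var_compose[OF r m m])
  moreover have "?f k \<circ> (\<lambda>\<omega>. restrict (\<lambda>k. ?path k \<omega>) {k}) = (\<lambda>\<omega>. (B k t \<omega> - B k s \<omega>) * (B k v \<omega> - B k u \<omega>))" for k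
    using st by (simp add: fun_eq_iff)
  ultimately show ?thesis using indep_var_lebesgue_integral[OF _ i i] by simp
qed

definition unit_matrix :: "('n \<times> 'n) + ('n \<times> 'n) \<Rightarrow> complex^'n^'n" where
  "unit_matrix i = (case i of Inl (j, k) \<Rightarrow> axis j (axis k 1) | Inr (j, k) \<Rightarrow> axis j (axis k \<i>))"

lemma Basis_eq_unit_matrices: "(Basis :: (complex^'n^'n) set) = range unit_matrix"
proof -
  have "(Basis :: (complex^'n^'n) set) = (\<Union>j. \<Union>k. {axis j (axis k 1), axis j (axis k \<i>)})"
    by (auto simp: Basis_vec_def Basis_complex_def)
  also have "\<dots> = range unit_matrix"
  proof (intro equalityI subsetI)
    fix x :: "complex^'n^'n" assume "x \<in> (\<Union>j. \<Union>k. {axis j (axis k 1), axis j (axis k \<i>)})"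
    then obtain j k where "x = unit_matrix (Inl (j, k)) \<or> x = unit_matrix (Inr (j, k))" by (auto simp: unit_matrix_def)
    then show "x \<in> range unit_matrix" by blast
  qed (fastforce simp: unit_matrix_def split: sum.splits)
  finally show ?thesis .
qed

lemma matrix_bm_inner_unit:
  fixes BR BI :: "'n::finite \<Rightarrow> 'n \<Rightarrow> real \<Rightarrow> 'a \<Rightarrow> real"
  shows "matrix_bm M0 BR BI t \<omega> \<bullet> unit_matrix i
    = M0 \<bullet> unit_matrix i + 1 / sqrt (2 * CARD('n)) * (case i of Inl (j, k) \<Rightarrow> BR j k | Inr (j, k) \<Rightarrow> BI j k) t \<omega>"
  by (auto simp: matrix_bm_def unit_matrix_def inner_axis inner_complex_def split: sum.splits)

text \<open>
  The coordinates of the matrix in the real basis are the given Brownian motions, up to the shift by the initial value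
  and the factor \<open>1 / \<surd>(2 N)\<close>.
\<close>

lemma matrix_bm_brownian_vector:
  fixes BR BI :: "'n::finite \<Rightarrow> 'n \<Rightarrow> real \<Rightarrow> 'a \<Rightarrow> real"
  assumes filt: "filtered_prob_space P F"
    and BR: "\<And>j k. standard_brownian_motion P F (BR j k)"
    and BI: "\<And>j k. standard_brownian_motion P F (BI j k)"
    and ind: "independent_processes P (\<lambda>i. case i of Inl (j, k) \<Rightarrow> BR j k | Inr (j, k) \<Rightarrow> BI j k)"
  shows "brownian_vector P F (matrix_bm M0 BR BI) (1 / sqrt (2 * CARD('n))) M0"
proof -
  define B where "B = (\<lambda>i. case i of Inl (j, k) \<Rightarrow> BR j k | Inr (j, k) \<Rightarrow> BI j k)"
  define c where "c = 1 / sqrt (2 * CARD('n))"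
  let ?W = "matrix_bm M0 BR BI"
  have P: "prob_space P" using filt by (simp add: filtered_prob_space_def)
  interpret prob_space P by (rule P)
  have c: "c > 0" by (simp add: c_def)
  have bm: "standard_brownian_motion P F (B i)" for i
    using BR BI by (auto simp: B_def split: sum.splits)
  have W: "?W t \<omega> \<bullet> unit_matrix i = M0 \<bullet> unit_matrix i + c * B i t \<omega>" for t \<omega> i
    unfolding B_def c_def by (rule matrix_bm_inner_unit)
  have dW: "(?W t \<omega> - ?W s \<omega>) \<bullet> unit_matrix i = c * (B i t \<omega> - B i s \<omega>)" for s t \<omega> i
    by (simp add: inner_diff_left W algebra_simps)
  have ac: "adapted_continuous P F (B i)" for i using bm by (simp add: standard_brownian_motion_def)
  show ?thesis
    unfolding c_def[symmetric]
  proof (unfold_locales)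
    show "filtered_prob_space P F" by (rule filt)
    show "adapted_continuous P F ?W"
      unfolding adapted_continuous_def
    proof (intro conjI allI impI ballI)
      fix t :: real assume "0 \<le> t"
      then have "B i t \<in> borel_measurable (F t)" for i using ac by (simp add: adapted_continuous_def)
      then have "(\<lambda>\<omega>. ?W t \<omega> \<bullet> unit_matrix i) \<in> borel_measurable (F t)" for i
        unfolding W by (intro borel_measurable_add borel_measurable_times borel_measurable_const)
      then show "?W t \<in> borel_measurable (F t)"
        by (subst borel_measurable_euclidean_space) (auto simp: Basis_eq_unit_matrices)
    next
      fix \<omega> assume "\<omega> \<in> space P"
      then have "continuous_on {0..} (\<lambda>t. B i t \<omega>)" for i using ac by (simp add: adapted_continuous_def)
      then have "continuous_on {0..} (\<lambda>t. ?W t \<omega> \<bullet> unit_matrix i)" for i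
        unfolding W by (intro continuous_intros)
      then show "continuous_on {0..} (\<lambda>t. ?W t \<omega>)"
        by (subst continuous_on_componentwise) (auto simp: Basis_eq_unit_matrices)
    qed
    have "AE \<omega> in P. \<forall>i. B i 0 \<omega> = 0"
      using AE_finite_allI[of UNIV "\<lambda>i \<omega>. B i 0 \<omega> = 0" P] bm by (simp add: standard_brownian_motion_def)
    then show "AE \<omega> in P. ?W 0 \<omega> = M0"
    proof eventually_elim
      fix \<omega> assume "\<forall>i. B i 0 \<omega> = 0"
      then have "?W 0 \<omega> \<bullet> b = M0 \<bullet> b" if "b \<in> Basis" for b
        using that by (auto simp: Basis_eq_unit_matrices W)
      then show "?W 0 \<omega> = M0" by (rule euclidean_eqI)
    qed
    show "0 < c" by (rule c)
    {
      fix b :: "complex^'n^'n" and s t :: real assume "b \<in> Basis" and st: "0 \<le> s" "s < t"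
      then obtain i where b: "b = unit_matrix i" by (auto simp: Basis_eq_unit_matrices)
      have D: "distributed P lborel (\<lambda>\<omega>. B i t \<omega> - B i s \<omega>) (normal_density 0 (sqrt (t - s)))"
        using bm st by (simp add: standard_brownian_motion_def)
      show "distributed P lborel (\<lambda>\<omega>. (?W t \<omega> - ?W s \<omega>) \<bullet> b) (normal_density 0 (c * sqrt (t - s)))"
        using normal_density_affine[OF D, of c 0] st c by (simp add: b dW)
      have "indep_set (sets (F s)) {(\<lambda>\<omega>. B i t \<omega> - B i s \<omega>) -` A \<inter> space P | A. A \<in> sets borel}"
        using bm st by (simp add: standard_brownian_motion_def)
      moreover have "{(\<lambda>\<omega>. (?W t \<omega> - ?W s \<omega>) \<bullet> b) -` A \<inter> space P | A. A \<in> sets borel}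
          \<subseteq> {(\<lambda>\<omega>. B i t \<omega> - B i s \<omega>) -` A \<inter> space P | A. A \<in> sets borel}"
      proof safe
        fix A :: "real set" assume "A \<in> sets borel"
        then have "(\<lambda>x. c * x) -` A \<inter> space borel \<in> sets borel" by (intro measurable_sets[of _ borel borel]) auto
        then show "\<exists>A'. (\<lambda>\<omega>. (?W t \<omega> - ?W s \<omega>) \<bullet> b) -` A \<inter> space P = (\<lambda>\<omega>. B i t \<omega> - B i s \<omega>) -` A' \<inter> space P \<and> A' \<in> sets borel"
          by (intro exI[of _ "(\<lambda>x. c * x) -` A"]) (auto simp: b dW)
      qed
      ultimately show "indep_set (sets (F s)) {(\<lambda>\<omega>. (?W t \<omega> - ?W s \<omega>) \<bullet> b) -` A \<inter> space P | A. A \<in> sets borel}"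
        unfolding indep_set_def by (elim indep_sets_mono_sets) (auto split: bool.splits)
    }
    fix b b' :: "complex^'n^'n" and s t u v :: real
    assume "b \<in> Basis" "b' \<in> Basis" "b \<noteq> b'" and st: "0 \<le> s" "s < t" "0 \<le> u" "u < v"
    then obtain i j where b: "b = unit_matrix i" "b' = unit_matrix j" and ij: "i \<noteq> j" by (auto simp: Basis_eq_unit_matrices)
    have scale: "(\<integral>\<omega>. (c * X \<omega>) * (c * Y \<omega>) \<partial>P) = c * c * (\<integral>\<omega>. X \<omega> * Y \<omega> \<partial>P)" for X Y
    proof -
      have "(\<integral>\<omega>. (c * X \<omega>) * (c * Y \<omega>) \<partial>P) = (\<integral>\<omega>. (c * c) * (X \<omega> * Y \<omega>) \<partial>P)"
        by (intro Bochner_Integration.integral_cong refl) (simp only: mult_ac)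
      then show ?thesis by (simp only: integral_mult_right_zero)
    qed
    note e = independent_processes_increments[OF P ind[folded B_def] ij bm st]
    have "(\<integral>\<omega>. (((?W t \<omega> - ?W s \<omega>) \<bullet> b) * ((?W v \<omega> - ?W u \<omega>) \<bullet> b)) * (((?W t \<omega> - ?W s \<omega>) \<bullet> b') * ((?W v \<omega> - ?W u \<omega>) \<bullet> b')) \<partial>P)
      = (\<integral>\<omega>. (c * c * c * c) * (((B i t \<omega> - B i s \<omega>) * (B i v \<omega> - B i u \<omega>)) * ((B j t \<omega> - B j s \<omega>) * (B j v \<omega> - B j u \<omega>))) \<partial>P)"
      unfolding b dW by (intro Bochner_Integration.integral_cong refl) (simp only: mult_ac)
    also have "\<dots> = (c * c * (\<integral>\<omega>. (B i t \<omega> - B i s \<omega>) * (B i v \<omega> - B i u \<omega>) \<partial>P)) * (c * c * (\<integral>\<omega>. (B j t \<omega> - B j s \<omega>) * (B j v \<omega> - B j u \<omega>) \<partial>P))"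
      unfolding integral_mult_right_zero e by (simp only: mult_ac)
    also have "\<dots> = (\<integral>\<omega>. ((?W t \<omega> - ?W s \<omega>) \<bullet> b) * ((?W v \<omega> - ?W u \<omega>) \<bullet> b) \<partial>P) * (\<integral>\<omega>. ((?W t \<omega> - ?W s \<omega>) \<bullet> b') * ((?W v \<omega> - ?W u \<omega>) \<bullet> b') \<partial>P)"
      unfolding b dW scale ..
    finally show "(\<integral>\<omega>. (((?W t \<omega> - ?W s \<omega>) \<bullet> b) * ((?W v \<omega> - ?W u \<omega>) \<bullet> b)) * (((?W t \<omega> - ?W s \<omega>) \<bullet> b') * ((?W v \<omega> - ?W u \<omega>) \<bullet> b')) \<partial>P)
      = (\<integral>\<omega>. ((?W t \<omega> - ?W s \<omega>) \<bullet> b) * ((?W v \<omega> - ?W u \<omega>) \<bullet> b) \<partial>P) * (\<integral>\<omega>. ((?W t \<omega> - ?W s \<omega>) \<bullet> b') * ((?W v \<omega> - ?W u \<omega>) \<bullet> b') \<partial>P)" .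
  qed
qed

theorem theorem1p6:
  fixes P :: "'a measure" and F :: "real \<Rightarrow> 'a measure"
    and BR BI :: "'n::finite \<Rightarrow> 'n \<Rightarrow> real \<Rightarrow> 'a \<Rightarrow> real"
    and M0 :: "complex^'n^'n"
    and M :: "real \<Rightarrow> 'a \<Rightarrow> complex^'n^'n"
    and N :: real
  defines "M \<equiv> matrix_bm M0 BR BI"
    and "N \<equiv> real CARD('n)"
  assumes "filtered_prob_space P F"
    and "\<And>j k. standard_brownian_motion P F (BR j k)"
    and "\<And>j k. standard_brownian_motion P F (BI j k)"
    and "independent_processes P
           (\<lambda>i. case i of Inl (j, k) \<Rightarrow> BR j k | Inr (j, k) \<Rightarrow> BI j k)"
  shows "\<exists>M\<Delta> M\<Delta>2 M\<Psi> :: complex \<Rightarrow> complex \<Rightarrow> real \<Rightarrow> 'a \<Rightarrow> real. \<forall>z w. w \<noteq> 0 \<longrightarrow>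
    continuous_local_martingale P F (M\<Delta> z w) \<and>
    continuous_local_martingale P F (M\<Delta>2 z w) \<and>
    continuous_local_martingale P F (M\<Psi> z w) \<and>
    solves_sde P (\<lambda>t \<omega>. Delta z w (M t \<omega>)) (M\<Delta> z w)
      (\<lambda>t \<omega>. 1 / (2 * N) *
         (wirtinger (wirtinger_bar (\<lambda>w. Delta z w (M t \<omega>))) w
          + 3 / Delta z w (M t \<omega>) * (cmod (wirtinger (\<lambda>w. Delta z w (M t \<omega>)) w))\<^sup>2)) \<and>
    solves_sde P (\<lambda>t \<omega>. Delta2 z w (M t \<omega>)) (M\<Delta>2 z w)
      (\<lambda>t \<omega>. 1 / (4 * N) * laplacian (\<lambda>w. Delta2 z w (M t \<omega>)) w) \<and>
    solves_sde P (\<lambda>t \<omega>. Psi z w (M t \<omega>)) (M\<Psi> z w)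
      (\<lambda>t \<omega>. 2 * (cmod (wirtinger (\<lambda>w. Psi z w (M t \<omega>)) w))\<^sup>2) \<and>
    ito_integral P F (*) (\<lambda>t \<omega>. N * Delta z w (M t \<omega>)) (M\<Psi> z w) (M\<Delta> z w) \<and>
    ito_integral P F (*) (\<lambda>t \<omega>. 2 * N * Delta2 z w (M t \<omega>)) (M\<Psi> z w) (M\<Delta>2 z w) \<and>
    ito_integral P F
      (\<lambda>(K, L) dM. 1 / (2 * N) * (trace (K ** dM) + trace (L ** dagger dM)))
      (\<lambda>t \<omega>. (matrix_inv (hhat z w (M t \<omega>)) ** (dagger (M t \<omega>) - mat (cnj z)),
                (M t \<omega> - mat z) ** matrix_inv (hhat z w (M t \<omega>))))
      M (\<lambda>t \<omega>. complex_of_real (M\<Psi> z w t \<omega>)) \<and>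
    (\<exists>A. quadratic_variation P F (M\<Psi> z w) A \<and>
         solves_sde P A (\<lambda>_ _. 0)
           (\<lambda>t \<omega>. 1 / (4 * N\<^sup>2) * laplacian (\<lambda>w. Psi z w (M t \<omega>)) w))"
proof -
  \<comment> \<open>The martingales are the compensated fields, defined for every \<open>w\<close> and martingales for \<open>w \<noteq> 0\<close>.\<close>
  interpret bv: brownian_vector P F M "1 / sqrt (2 * N)" M0
    using matrix_bm_brownian_vector[OF assms(3-6), of M0] by (simp add: M_def N_def)
  have N: "N > 0" by (simp add: N_def)
  have \<sigma>2: "(1 / sqrt (2 * N))\<^sup>2 = 1 / (2 * N)" using N by (simp add: power_divide)
  have generator: "bv.generator f x = laplace f x / (4 * N)" for f x
    unfolding bv.generator_def \<sigma>2 by simp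
  show ?thesis
  proof (rule exI[of _ "\<lambda>z w. bv.compensated (Delta z w)"], rule exI[of _ "\<lambda>z w. bv.compensated (Delta2 z w)"],
      rule exI[of _ "\<lambda>z w. bv.compensated (Psi z w)"], intro allI impI conjI)
    fix z w :: complex assume w: "w \<noteq> 0"
    define r where "r = (cmod w)\<^sup>2"
    have r: "r > 0" using w by (simp add: r_def)
    note tD = tame_Delta[OF w, of _ z] and tD2 = tame_Delta2[of _ z w] and tP = tame_Psi[OF w, of _ z]
    have Dpos: "Delta z w m > 0" for m :: "complex^'n^'n"
      using gramdet_positive[OF r] by (simp add: Delta_eq_gramdet r_def)
    show "continuous_local_martingale P F (bv.compensated (Delta z w))"
      "continuous_local_martingale P F (bv.compensated (Delta2 z w))"
      "continuous_local_martingale P F (bv.compensated (Psi z w))"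
      by (rule bv.compensated_local_martingale, rule tD tD2 tP)+
    show "solves_sde P (\<lambda>t \<omega>. Delta z w (M t \<omega>)) (bv.compensated (Delta z w))
      (\<lambda>t \<omega>. 1 / (2 * N) *
         (wirtinger (wirtinger_bar (\<lambda>w. Delta z w (M t \<omega>))) w
          + 3 / Delta z w (M t \<omega>) * (cmod (wirtinger (\<lambda>w. Delta z w (M t \<omega>)) w))\<^sup>2))"
    proof (rule bv.compensated_solves_sde[OF tD])
      fix s \<omega>
      let ?D = "Delta z w (M s \<omega>)" and ?T1 = "trace_inv (M s \<omega> - mat z) r" and ?T2 = "trace_inv_sq (M s \<omega> - mat z) r"
      have c: "(cmod (of_real (?D * ?T1 / 2) * cnj w))\<^sup>2 = (?D * ?T1 / 2)\<^sup>2 * r"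
        by (simp add: norm_mult power_mult_distrib r_def power_divide)
      have "1 / (2 * N) * (?D * (?T1 / 2 - r * ?T2 / 2 + r * ?T1\<^sup>2 / 4) + 3 / ?D * ((?D * ?T1 / 2)\<^sup>2 * r)) = bv.generator (Delta z w) (M s \<omega>)"
        unfolding generator laplace_Delta[OF w] r_def[symmetric] using N Dpos[of "M s \<omega>"]
        by (simp add: field_simps power2_eq_square)
      from arg_cong[OF this, of complex_of_real]
      show "1 / (2 * N) *
         (wirtinger (wirtinger_bar (\<lambda>w. Delta z w (M s \<omega>))) w
          + 3 / Delta z w (M s \<omega>) * (cmod (wirtinger (\<lambda>w. Delta z w (M s \<omega>)) w))\<^sup>2) = complex_of_real (bv.generator (Delta z w) (M s \<omega>))"
        unfolding wirtinger_Delta[OF w] r_def[symmetric] c by simp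
    qed
    show "solves_sde P (\<lambda>t \<omega>. Delta2 z w (M t \<omega>)) (bv.compensated (Delta2 z w))
      (\<lambda>t \<omega>. 1 / (4 * N) * laplacian (\<lambda>w. Delta2 z w (M t \<omega>)) w)"
    proof (rule bv.compensated_solves_sde[OF tD2])
      fix s \<omega>
      show "1 / (4 * N) * laplacian (\<lambda>w. Delta2 z w (M s \<omega>)) w = complex_of_real (bv.generator (Delta2 z w) (M s \<omega>))"
        unfolding generator laplace_Delta2[OF w] wirtinger_Delta2[OF w] by simp
    qed
    show "solves_sde P (\<lambda>t \<omega>. Psi z w (M t \<omega>)) (bv.compensated (Psi z w))
      (\<lambda>t \<omega>. 2 * (cmod (wirtinger (\<lambda>w. Psi z w (M t \<omega>)) w))\<^sup>2)"
    proof (rule bv.compensated_solves_sde[OF tP])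
      fix s \<omega>
      have c: "(cmod (of_real x * cnj w))\<^sup>2 = x\<^sup>2 * r" for x
        by (simp add: norm_mult power_mult_distrib r_def)
      show "2 * (cmod (wirtinger (\<lambda>w. Psi z w (M s \<omega>)) w))\<^sup>2 = complex_of_real (bv.generator (Psi z w) (M s \<omega>))"
        unfolding generator laplace_Psi[OF w] wirtinger_Psi(1)[OF w] c r_def[symmetric]
        by (simp add: N_def field_simps power2_eq_square)
    qed
    show "ito_integral P F (*) (\<lambda>t \<omega>. N * Delta z w (M t \<omega>)) (bv.compensated (Psi z w)) (bv.compensated (Delta z w))"
      by (rule bv.ito_integral_compensated[where g = "\<lambda>m. N * Delta z w m", OF tD tP tame_cmult[OF tD]])
        (simp add: pd_Delta[OF w] N_def)
    show "ito_integral P F (*) (\<lambda>t \<omega>. 2 * N * Delta2 z w (M t \<omega>)) (bv.compensated (Psi z w)) (bv.compensated (Delta2 z w))"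
      by (rule bv.ito_integral_compensated[where g = "\<lambda>m. 2 * N * Delta2 z w m", OF tD2 tP tame_cmult[OF tD2]])
        (simp add: pd_Delta2[OF w] N_def)
    show "ito_integral P F
      (\<lambda>(K, L) dM. 1 / (2 * N) * (trace (K ** dM) + trace (L ** dagger dM)))
      (\<lambda>t \<omega>. (matrix_inv (hhat z w (M t \<omega>)) ** (dagger (M t \<omega>) - mat (cnj z)),
                (M t \<omega> - mat z) ** matrix_inv (hhat z w (M t \<omega>))))
      M (\<lambda>t \<omega>. complex_of_real (bv.compensated (Psi z w) t \<omega>))"
      by (rule bv.ito_integral_gradient[OF tP stochastic_gradient_bilinear continuous_stochastic_gradient[OF w]])
        (simp only: prod.case stochastic_gradient_Psi[OF w] N_def)
    show "\<exists>A. quadratic_variation P F (bv.compensated (Psi z w)) A \<and>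
         solves_sde P A (\<lambda>_ _. 0) (\<lambda>t \<omega>. 1 / (4 * N\<^sup>2) * laplacian (\<lambda>w. Psi z w (M t \<omega>)) w)"
    proof (intro exI conjI)
      show "quadratic_variation P F (bv.compensated (Psi z w)) (bv.time_integral (bv.variation_density (Psi z w)))"
        by (rule bv.compensated_quadratic_variation[OF tP])
      show "solves_sde P (bv.time_integral (bv.variation_density (Psi z w))) (\<lambda>_ _. 0) (\<lambda>t \<omega>. 1 / (4 * N\<^sup>2) * laplacian (\<lambda>w. Psi z w (M t \<omega>)) w)"
      proof (rule bv.time_integral_solves_sde)
        show "continuous_on UNIV (bv.variation_density (Psi z w))" by (rule tame_continuous[OF bv.tame_variation_density[OF tP]])
        fix s \<omega>
        show "1 / (4 * N\<^sup>2) * laplacian (\<lambda>w. Psi z w (M s \<omega>)) w = complex_of_real (bv.variation_density (Psi z w) (M s \<omega>))"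
          unfolding bv.variation_density_def \<sigma>2 grad_square_Psi[OF w] wirtinger_Psi(2)[OF w]
          by (simp add: N_def field_simps power2_eq_square)
      qed
    qed
  qed
qed

end
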